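(* Let $f$ be a transcendental entire function with a logarithmic singularity over $\infty$. Then the set of all $z\in\mathbb{C}$ such that $$\liminf_{n\to\infty} \frac{1}{n} \log \log (f^n)^\#(z) \geq \log (1+ \lambda(f))$$ is dense in the Julia set $J(f)$.
   Context: $f^n$ denotes the $n$-th iterate of $f$. The Julia set $J(f)$ is the set of all points of $\mathbb{C}$ having no neighborhood in which the iterates $(f^n)_{n\in\mathbb{N}}$ form a normal family. For an entire function $g$, the spherical derivative is $g^\#(z)=\frac{|g'(z)|}{1+|g(z)|^2}$. The function $f$ has a logarithmic singularity over $\infty$ if there exist $R>0$ and a connected component $U$ of $\{z\in\mathbb{C}:|f(z)|>R\}$ such that $f:U\to\{w\in\mathbb{C}:|w|>R\}$ is a universal covering. With $M(r,f)=\max_{|z|=r}|f(z)|$, the lower order of $f$ is $\lambda(f)=\liminf_{r\to\infty}\frac{\log\log M(r,f)}{\log r}\in[0,\infty]$; if $\lambda(f)=\infty$, then $\log(1+\lambda(f))$ is read as $\infty$. The displayed inequality includes the requirement that $(f^n)^\#(z)>1$ for all large $n$, so that $\log\log (f^n)^\#(z)$ is defined for large $n$. *)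

theory Defs
  imports "HOL-Complex_Analysis.Complex_Analysis"
begin

definition transcendental_entire :: "(complex \<Rightarrow> complex) \<Rightarrow> bool" where
  "transcendental_entire f \<longleftrightarrow> f holomorphic_on UNIV \<and> (\<nexists>p. \<forall>z. f z = poly p z)"

text \<open>
  The Riemann sphere is modelled by the unit sphere of \<open>\<complex> \<times> \<real>\<close>, the point at infinity being the
  north pole \<open>(0, 1)\<close>. The Euclidean distance of images under the following (inverse)
  stereographic projection is the chordal distance on the plane.
\<close>

definition stereo :: "complex \<Rightarrow> complex \<times> real" where
  "stereo z = (z * of_real (2 / (1 + (cmod z)\<^sup>2)), ((cmod z)\<^sup>2 - 1) / ((cmod z)\<^sup>2 + 1))"

lemma norm_stereo: "norm (stereo z) = 1"
proof -
  define t where "t = (cmod z)\<^sup>2"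
  have t: "1 + t > 0" by (simp add: t_def add_pos_nonneg)
  have "(norm (stereo z))\<^sup>2 = (cmod z * (2 / (1 + t)))\<^sup>2 + ((t - 1) / (t + 1))\<^sup>2"
    using t by (simp add: stereo_def norm_prod_def t_def norm_mult norm_divide power_divide
        del: of_real_divide of_real_add of_real_power)
  also have "\<dots> = (4 * t + (t - 1)\<^sup>2) / (1 + t)\<^sup>2"
    by (simp add: power_mult_distrib power_divide add_divide_distrib add.commute flip: t_def)
  also have "4 * t + (t - 1)\<^sup>2 = (1 + t)\<^sup>2"
    by (simp add: power2_eq_square algebra_simps)
  also have "(1 + t)\<^sup>2 / (1 + t)\<^sup>2 = 1"
    using t by simp
  finally show ?thesis
    using power2_eq_imp_eq[of "norm (stereo z)" 1] by simp
qed

text \<open>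
  Normality with respect to the spherical metric: the limit \<open>g\<close> may take the value infinity,
  so locally uniform divergence to infinity is permitted. As the sphere is closed, \<open>g\<close> takes
  its values on \<open>U\<close> in the sphere automatically.
\<close>

definition normal_family_on :: "complex set \<Rightarrow> (complex \<Rightarrow> complex) set \<Rightarrow> bool" where
  "normal_family_on U F \<longleftrightarrow>
     (\<forall>h :: nat \<Rightarrow> complex \<Rightarrow> complex. range h \<subseteq> F \<longrightarrow>
       (\<exists>r g. strict_mono r \<and>
         (\<forall>K. compact K \<and> K \<subseteq> U \<longrightarrow>
            uniform_limit K (\<lambda>k z. stereo (h (r k) z)) g sequentially)))"

definition Julia_set :: "(complex \<Rightarrow> complex) \<Rightarrow> complex set" where
  "Julia_set f =
     {z. \<not> (\<exists>U. open U \<and> z \<in> U \<and> normal_family_on U (range (\<lambda>n. f ^^ n)))}"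

definition spherical_deriv :: "(complex \<Rightarrow> complex) \<Rightarrow> complex \<Rightarrow> real" where
  "spherical_deriv g z = cmod (deriv g z) / (1 + (cmod (g z))\<^sup>2)"

text \<open>A universal covering is a covering by a simply connected space.\<close>

definition has_log_singularity_over_infinity :: "(complex \<Rightarrow> complex) \<Rightarrow> bool" where
  "has_log_singularity_over_infinity f \<longleftrightarrow>
     (\<exists>R>0. \<exists>U \<in> components {z. cmod (f z) > R}.
        simply_connected U \<and> covering_space U f {w. cmod w > R})"

definition max_modulus :: "real \<Rightarrow> (complex \<Rightarrow> complex) \<Rightarrow> real" where
  "max_modulus r f = (SUP z\<in>sphere 0 r. cmod (f z))"

definition lower_order :: "(complex \<Rightarrow> complex) \<Rightarrow> ereal" where
  "lower_order f = Liminf at_top (\<lambda>r. ereal (ln (ln (max_modulus r f)) / ln r))"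

text \<open>\<open>log (1 + x)\<close> on \<open>[0, \<infinity>]\<close>; the value at \<open>- \<infinity>\<close> is irrelevant.\<close>

definition log_one_plus :: "ereal \<Rightarrow> ereal" where
  "log_one_plus x = (if x = \<infinity> then \<infinity> else ereal (ln (1 + real_of_ereal x)))"

text \<open>
  Since \<^const>\<open>ln\<close> is total, the condition that the iterated logarithm is eventually defined
  has to be required separately.
\<close>

definition fast_growth_set :: "(complex \<Rightarrow> complex) \<Rightarrow> complex set" where
  "fast_growth_set f =
     {z. (\<forall>\<^sub>F n in sequentially. spherical_deriv (f ^^ n) z > 1) \<and>
         liminf (\<lambda>n. ereal (1 / real n * ln (ln (spherical_deriv (f ^^ n) z))))
           \<ge> log_one_plus (lower_order f)}"

end

theory Submission
  imports Defs
begin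

text \<open>
  Write \<open>F\<^sup>#\<close> for the spherical derivative and \<open>M(r)\<close> for the maximum modulus of \<open>f\<close>. Suppose that
  the orbit \<open>z\<^sub>k = f\<^sup>k(z)\<close> has \<open>|z\<^sub>k|\<close> comparable to \<open>r\<^sub>k\<close> and that
  \<open>|f'(z\<^sub>k)| \<ge> (r\<^sub>k\<^sub>+\<^sub>1 / r\<^sub>k) log M(r\<^sub>k) / K\<close> for all \<open>k\<close>. The product of these bounds telescopes, and dividing
  by \<open>1 + |z\<^sub>n|\<^sup>2\<close> leaves \<open>(f\<^sup>n)\<^sup>#(z) \<ge> const \<cdot> r\<^sub>n\<^sup>-\<^sup>1 \<Prod>\<^sub>k\<^sub><\<^sub>n (log M(r\<^sub>k) / K)\<close>. With
  \<open>a\<^sub>k = log r\<^sub>k\<close> and \<open>b(x) = log (log M(e\<^sup>x) / K)\<close>, the logarithm of the right-hand side is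
  \<open>\<Sum>\<^sub>k\<^sub><\<^sub>n b(a\<^sub>k) - a\<^sub>n\<close> up to a constant, and \<open>b(x) \<ge> (\<lambda> - \<epsilon>) x\<close> for large \<open>x\<close>, by definition of the lower
  order \<open>\<lambda>\<close>. Choosing \<open>a\<^sub>k\<^sub>+\<^sub>1 = a\<^sub>k + (1 - 1/(k+2)) b(a\<^sub>k)\<close> makes \<open>a\<^sub>k\<close> grow at least like \<open>(1 + \<lambda> - \<epsilon>)\<^sup>k\<close>
  for every \<open>\<epsilon> > 0\<close> (faster than every exponential if \<open>\<lambda> = \<infinity>\<close>), and still leaves the gain
  \<open>\<Sum>\<^sub>k\<^sub><\<^sub>n b(a\<^sub>k)/(k+2)\<close>, for which the same lower bounds on the exponential rate hold
  (\<open>gain_exponential\<close>). It tends to infinity even if \<open>\<lambda> = 0\<close>, because \<open>b \<ge> 1\<close> (\<open>gain_at_top\<close>). This is the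
  required growth.

  Orbits of this kind are found in three steps.

  First, the logarithmic tract is simply connected and unbounded, so it cannot contain a large
  circle: every large circle meets a fixed sublevel set \<open>{|f| \<le> R}\<close> (\<open>circles_meet_sublevel\<close>). The same circle
  contains a point where \<open>|f| = M(r)\<close>. Harnack's inequality and a Hopf-type boundary estimate for the
  positive harmonic function \<open>log |f/s|\<close> on \<open>{|f| > s}\<close> then produce, near that circle, a point \<open>\<zeta>\<close> with
  \<open>|f(\<zeta>)| = s\<close> and \<open>|f'(\<zeta>)| \<ge> const \<cdot> s log M(r) / r\<close> (\<open>growth_on_circle_le_level_derivative\<close>).

  Second, a point where an entire function \<open>h\<close> has a large spherical derivative has, within distance 1, a point
  where \<open>h\<close> takes one of five given values with derivative at least 1 (\<open>lappan_five_values\<close>, in the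
  spirit of Lappan's five-point theorem). Otherwise Zalcman's rescaling gives in the limit a nonconstant entire
  function \<open>g\<close> with bounded spherical derivative that is totally ramified over five values \<open>a\<^sub>i\<close>. Then
  \<open>\<Phi> = g'\<^sup>2 / \<Prod> (g - a\<^sub>i)\<close> is entire and bounded, hence constant, and the equation \<open>g'\<^sup>2 = \<Phi> \<Prod> (g - a\<^sub>i)\<close>
  is incompatible with \<open>|g'| \<le> 2 (1 + |g|\<^sup>2)\<close> unless \<open>g\<close> is bounded (\<open>no_entire_totally_ramified\<close>).

  Third, at each scale \<open>r\<^sub>k\<close> there are five disjoint annuli, and the two preceding steps show that from any one of
  them, one of five arbitrarily prescribed points of the annuli at the next scale can be reached with large derivative
  (\<open>expanding_step\<close>). Choosing finite orbits backwards and using compactness gives infinite orbits that start in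
  each of the five annuli of the first scale (\<open>expanding_orbit\<close>).

  For density, let \<open>z\<close> be in the Julia set. By the easy half of Marty's criterion the spherical derivatives of the
  iterates are unbounded near \<open>z\<close>, so \<open>lappan_five_values\<close>, applied to an iterate and to the five starting points
  found above, gives a point \<open>v\<close> near \<open>z\<close> which some iterate maps with nonzero derivative to one of
  them. So \<open>(f\<^sup>n)\<^sup>#(v)\<close> grows as required, and \<open>v\<close> is in the Julia set because \<open>(f\<^sup>n)\<^sup>#(v) \<longlonglongrightarrow> \<infinity>\<close>.
\<close>

section \<open>Growth on a circle and derivatives on a level set\<close>

text \<open>
  A branch of \<open>log f\<close> maps the disc into the right half-plane. Composing it with the Cayley map that
  sends the value at \<open>c\<close> to 0 gives a self-map of the unit disc to which the Schwarz lemma applies.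
\<close>
lemma harnack_zero_free:
  assumes hol: "f holomorphic_on ball c d" and gt: "\<And>z. z \<in> ball c d \<Longrightarrow> 1 < cmod (f z)"
    and z: "z \<in> ball c d"
  shows "(1 - dist c z / d) / (1 + dist c z / d) * ln (cmod (f c)) \<le> ln (cmod (f z))"
proof -
  have d: "d > 0" using z by (metis ball_empty empty_iff not_le)
  obtain g where g: "g holomorphic_on ball c d" and fg: "\<And>z. z \<in> ball c d \<Longrightarrow> f z = exp (g z)"
  proof (rule holomorphic_logarithm_exists[OF convex_ball open_ball hol])
    show "f z \<noteq> 0" if "z \<in> ball c d" for z using gt[OF that] by auto
    show "c \<in> ball c d" using d by simp
  qed auto
  have Re: "Re (g w) = ln (cmod (f w))" "Re (g w) > 0" if "w \<in> ball c d" for w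
  proof -
    have "cmod (f w) = exp (Re (g w))" using fg[OF that] by simp
    then show "Re (g w) = ln (cmod (f w))" by simp
    then show "Re (g w) > 0" using ln_gt_zero[OF gt[OF that]] by simp
  qed
  define a where "a = Re (g c)"
  have a: "a > 0" unfolding a_def by (rule Re(2)) (use d in simp)
  define \<phi> where "\<phi> = (\<lambda>w. (g (c + of_real d * w) - g c) / (g (c + of_real d * w) + cnj (g c)))"
  have inb: "c + of_real d * w \<in> ball c d" if "norm w < 1" for w
    using that d by (simp add: dist_norm norm_mult)
  have nz: "g (c + of_real d * w) + cnj (g c) \<noteq> 0" if "norm w < 1" for w
  proof -
    have "Re (g (c + of_real d * w) + cnj (g c)) > 0"
      using Re(2)[OF inb[OF that]] a by (simp add: a_def)
    thus ?thesis by (metis less_irrefl zero_complex.simps(1))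
  qed
  have hcomp: "(\<lambda>w. g (c + of_real d * w)) holomorphic_on ball 0 1"
    by (rule holomorphic_on_compose_gen[OF _ g, unfolded o_def])
       (auto intro!: holomorphic_intros inb)
  have hphi: "\<phi> holomorphic_on ball 0 1"
    unfolding \<phi>_def by (intro holomorphic_intros hcomp) (use nz in auto)
  have lt: "norm (\<phi> w) < 1" if "norm w < 1" for w
  proof -
    let ?G = "g (c + of_real d * w)"
    have "Re ?G > 0" using Re(2)[OF inb[OF that]] .
    have "(cmod (?G - g c))\<^sup>2 < (cmod (?G + cnj (g c)))\<^sup>2"
    proof -
      have "(cmod (?G + cnj (g c)))\<^sup>2 - (cmod (?G - g c))\<^sup>2 = 4 * (Re ?G * a)"
        unfolding cmod_power2 a_def by (simp add: power2_eq_square algebra_simps)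
      moreover have "0 < Re ?G * a" using \<open>0 < Re ?G\<close> a by (rule mult_pos_pos)
      ultimately show ?thesis by linarith
    qed
    then have "cmod (?G - g c) < cmod (?G + cnj (g c))"
      by (rule power2_less_imp_less) simp
    thus ?thesis unfolding \<phi>_def using nz[OF that] by (simp add: norm_divide)
  qed
  define w where "w = (z - c) / of_real d"
  define t where "t = dist c z / d"
  have wz: "c + of_real d * w = z" using d by (simp add: w_def)
  have wt: "norm w = t" using d by (simp add: w_def t_def norm_divide dist_norm norm_minus_commute)
  have t: "0 \<le> t" "t < 1" using z d by (auto simp: t_def)
  have "norm (\<phi> w) \<le> norm w"
    by (rule Schwarz_Lemma(1)[OF hphi _ lt]) (auto simp: \<phi>_def wt t)
  then have "cmod (g z - g c) \<le> t * cmod (g z + cnj (g c))"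
    using nz[of w] t wt by (simp add: \<phi>_def wz norm_divide divide_simps)
  then have "(cmod (g z - g c))\<^sup>2 \<le> t\<^sup>2 * (cmod (g z + cnj (g c)))\<^sup>2"
    by (metis norm_ge_zero power_mono power_mult_distrib)
  then have "(Re (g z) - a)\<^sup>2 + (Im (g z) - Im (g c))\<^sup>2
      \<le> t\<^sup>2 * (Re (g z) + a)\<^sup>2 + t\<^sup>2 * (Im (g z) - Im (g c))\<^sup>2"
    by (simp add: cmod_power2 a_def algebra_simps)
  moreover have "t\<^sup>2 * (Im (g z) - Im (g c))\<^sup>2 \<le> (Im (g z) - Im (g c))\<^sup>2"
    using t by (simp add: mult_left_le_one_le power_le_one)
  ultimately have "(a - Re (g z))\<^sup>2 \<le> (t * (Re (g z) + a))\<^sup>2"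
    by (simp add: power_mult_distrib power2_commute)
  then have "a - Re (g z) \<le> t * (Re (g z) + a)"
    by (rule power2_le_imp_le) (use t a Re(2)[OF z] in simp)
  then have "(1 - t) * a \<le> (1 + t) * Re (g z)" by (simp add: algebra_simps)
  then have "(1 - t) / (1 + t) * a \<le> Re (g z)" using t by (simp add: field_simps)
  thus ?thesis using Re(1)[OF z] Re(1)[of c] d by (simp add: t_def a_def)
qed

text \<open>
  Hopf's boundary lemma: along the radius to the boundary point \<open>\<zeta>\<close>, Harnack's inequality bounds
  \<open>log |f|\<close> from below by a linear function of the distance to \<open>\<zeta>\<close>, where \<open>log |f|\<close> vanishes.
\<close>
lemma hopf_derivative_bound:
  assumes hol: "f holomorphic_on UNIV" and gt: "\<And>z. z \<in> ball c d \<Longrightarrow> 1 < cmod (f z)"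
    and \<zeta>: "dist c \<zeta> = d" "cmod (f \<zeta>) = 1" and d: "d > 0"
  shows "ln (cmod (f c)) \<le> 2 * d * cmod (deriv f \<zeta>)"
proof -
  define U where "U = ln (cmod (f c))"
  have "1 < cmod (f c)" using d by (intro gt) simp
  then have U: "U > 0" unfolding U_def by (rule ln_gt_zero)
  define x where "x = (\<lambda>n. inverse (real (Suc n)))"
  define p where "p = (\<lambda>n. \<zeta> + of_real (x n) * (c - \<zeta>))"
  have x: "0 < x n" "x n \<le> 1" for n by (auto simp: x_def divide_simps)
  have x0: "x \<longlonglongrightarrow> 0" unfolding x_def by (rule LIMSEQ_inverse_real_of_nat)
  have p0: "(\<lambda>n. p n) \<longlonglongrightarrow> \<zeta>"
    unfolding p_def by (rule tendsto_eq_intros x0 tendsto_of_real refl | simp)+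
  have nd: "dist (p n) \<zeta> = x n * d" for n
    using \<zeta>(1) x[of n] by (simp add: p_def dist_norm norm_mult)
  have dc: "dist c (p n) = (1 - x n) * d" for n
  proof -
    have "c - p n = of_real (1 - x n) * (c - \<zeta>)" by (simp add: p_def algebra_simps)
    thus ?thesis using \<zeta>(1) x[of n] by (simp add: dist_norm norm_mult del: of_real_diff)
  qed
  have bd: "U / (2 * d) \<le> cmod ((f (p n) - f \<zeta>) / (p n - \<zeta>))" for n
  proof -
    have inb: "p n \<in> ball c d" using dc x[of n] d by simp
    have "(1 - dist c (p n) / d) / (1 + dist c (p n) / d) * U \<le> ln (cmod (f (p n)))"
      unfolding U_def by (rule harnack_zero_free[OF holomorphic_on_subset[OF hol] gt inb]) auto
    moreover have "(1 - dist c (p n) / d) / (1 + dist c (p n) / d) = x n / (2 - x n)"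
      using d by (simp add: dc)
    moreover have "x n / 2 \<le> x n / (2 - x n)" using x[of n] by (intro divide_left_mono) auto
    ultimately have "x n / 2 * U \<le> ln (cmod (f (p n)))"
      using U by (smt (verit) mult_right_mono)
    then have "exp (x n / 2 * U) \<le> cmod (f (p n))"
      using gt[OF inb] by (metis exp_le_cancel_iff exp_ln less_trans zero_less_one)
    then have "1 + x n / 2 * U \<le> cmod (f (p n))"
      using exp_ge_add_one_self[of "x n / 2 * U"] by linarith
    then have "x n / 2 * U \<le> cmod (f (p n) - f \<zeta>)"
      using \<zeta>(2) norm_triangle_ineq2[of "f (p n)" "f \<zeta>"] by linarith
    then have "x n / 2 * U / (x n * d) \<le> cmod (f (p n) - f \<zeta>) / (x n * d)"
      using x[of n] d by (intro divide_right_mono) auto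
    moreover have "x n / 2 * U / (x n * d) = U / (2 * d)" using x[of n] by (simp add: field_simps)
    moreover have "cmod (p n - \<zeta>) = x n * d" using nd[of n] by (simp add: dist_norm)
    ultimately show ?thesis by (simp add: norm_divide)
  qed
  have "(f has_field_derivative deriv f \<zeta>) (at \<zeta>)"
    using hol holomorphic_derivI by blast
  then have "((\<lambda>z. (f z - f \<zeta>) / (z - \<zeta>)) \<longlongrightarrow> deriv f \<zeta>) (at \<zeta>)"
    by (simp add: has_field_derivative_iff)
  then have "(\<lambda>n. (f (p n) - f \<zeta>) / (p n - \<zeta>)) \<longlonglongrightarrow> deriv f \<zeta>"
  proof (rule filterlim_compose)
    have "p n \<noteq> \<zeta>" for n using nd[of n] x[of n] d by (metis dist_self mult_pos_pos less_irrefl)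
    thus "filterlim p (at \<zeta>) sequentially"
      using p0 by (auto simp: filterlim_at)
  qed
  then have "U / (2 * d) \<le> cmod (deriv f \<zeta>)"
    by (rule Lim_norm_lbound[rotated]) (use bd in auto)
  thus ?thesis using d by (simp add: U_def field_simps)
qed

text \<open>
  If \<open>|f|\<close> starts at a value \<open>\<le> 1\<close> somewhere on a circle and is very large elsewhere on it, then \<open>f\<close> must have a
  large derivative at some point of the level set \<open>{|f| = 1}\<close> near the circle. At points of the circle
  that are close to \<open>{|f| \<le> 1}\<close>, the largest disc around the point on which \<open>|f| > 1\<close> touches the
  level set, and Hopf's lemma bounds \<open>log |f|\<close> by the derivative there. All other points are reached from these by a
  bounded number of Harnack steps along the circle; each of them costs a factor of at most 3.
\<close>
lemma growth_on_circle_le_level_derivative: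
  assumes hol: "f holomorphic_on UNIV" and r: "0 < r" and e: "cmod e = r" "cmod (f e) \<le> 1"
    and T: "0 \<le> T"
    and level: "\<And>\<zeta>. \<lbrakk>3/4 * r \<le> cmod \<zeta>; cmod \<zeta> \<le> 5/4 * r; cmod (f \<zeta>) = 1\<rbrakk> \<Longrightarrow> cmod (deriv f \<zeta>) \<le> T"
    and z: "cmod z = r"
  shows "cmod (f z) \<le> exp (3 ^ 102 * (T * r))"
proof -
  define F where "F = {z. cmod (f z) \<le> 1}"
  have contf: "continuous_on UNIV f" using hol by (rule holomorphic_on_imp_continuous_on)
  have clF: "closed F" unfolding F_def
    by (intro closed_Collect_le continuous_on_norm contf continuous_on_const)
  have eF: "e \<in> F" using e by (simp add: F_def)
  have near: "ln (cmod (f p)) \<le> T * r" if p: "cmod p = r" "p \<notin> F" and y: "y \<in> F" "dist p y \<le> r/8" for p y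
  proof -
    obtain \<zeta> where \<zeta>: "\<zeta> \<in> F" "\<And>y. y \<in> F \<Longrightarrow> dist p \<zeta> \<le> dist p y"
      using distance_attains_inf[OF clF, of p] eF by blast
    define d where "d = dist p \<zeta>"
    have d: "d > 0" using \<zeta> p by (auto simp: d_def)
    have d8: "d \<le> r/8" using \<zeta>(2)[OF y(1)] y(2) by (simp add: d_def)
    have gt: "1 < cmod (f w)" if "w \<in> ball p d" for w
      using \<zeta>(2)[of w] that by (force simp: d_def F_def)
    have "\<zeta> \<in> closure (ball p d)" using d by (simp add: d_def)
    moreover have "continuous_on (closure (ball p d)) (\<lambda>w. cmod (f w))"
      by (intro continuous_on_norm continuous_on_subset[OF contf]) simp
    ultimately have "1 \<le> cmod (f \<zeta>)"
      using continuous_ge_on_closure[of "ball p d" "\<lambda>w. cmod (f w)" \<zeta> 1] gt less_imp_le by blast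
    then have one: "cmod (f \<zeta>) = 1" using \<zeta>(1) by (simp add: F_def)
    have "\<bar>cmod \<zeta> - cmod p\<bar> \<le> r / 8"
      using norm_triangle_ineq3[of \<zeta> p] d8 by (simp add: d_def dist_norm norm_minus_commute)
    then have "3/4 * r \<le> cmod \<zeta>" "cmod \<zeta> \<le> 5/4 * r" using p(1) r by linarith+
    then have "cmod (deriv f \<zeta>) \<le> T" using one by (rule level)
    moreover have "ln (cmod (f p)) \<le> 2 * d * cmod (deriv f \<zeta>)"
      by (rule hopf_derivative_bound[OF hol gt _ one d]) (auto simp: d_def)
    ultimately have "ln (cmod (f p)) \<le> 2 * d * T"
      using d by (smt (verit) mult_left_mono)
    also have "\<dots> \<le> r * T" using d8 T r by (intro mult_right_mono) auto
    finally show ?thesis by (simp add: mult.commute)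
  qed
  obtain \<theta> where \<theta>: "0 \<le> \<theta>" "\<theta> < 2 * pi" "z = e * cis \<theta>"
  proof -
    have e0: "e \<noteq> 0" using e r by auto
    have "cmod (z / e) = 1" using z e r e0 by (simp add: norm_divide)
    then have "z / e = cis (Arg2pi (z / e))"
      using complex_norm_eq_1_exp[of "z/e"] by (simp add: cis_conv_exp)
    then have "z = e * cis (Arg2pi (z / e))" using e0 by (simp add: field_simps)
    thus ?thesis using Arg2pi[of "z/e"] by (intro that) auto
  qed
  \<comment> \<open>102 steps suffice because 2 * pi / 102 < 1/16, and steps of length r/16 stay in the half-radius disc
     for Harnack's inequality in discs of radius r/8.\<close>
  define \<delta> where "\<delta> = \<theta> / 102"
  have \<delta>: "0 \<le> \<delta>" "\<delta> \<le> 1/16" using \<theta> pi_less_4 pi_approx by (auto simp: \<delta>_def)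
  define p where "p = (\<lambda>i. e * cis (real i * \<delta>))"
  have np: "cmod (p i) = r" for i by (simp add: p_def norm_mult e)
  have step: "dist (p (Suc i)) (p i) \<le> r / 16" for i
  proof -
    have "p (Suc i) - p i = e * cis (real i * \<delta>) * (cis \<delta> - 1)"
      by (simp add: p_def algebra_simps cis_mult)
    then have "dist (p (Suc i)) (p i) = r * cmod (cis \<delta> - 1)"
      by (simp add: dist_norm norm_mult e)
    also have "cmod (cis \<delta> - 1) = 2 * \<bar>sin (\<delta>/2)\<bar>"
      using dist_exp_i_1[of \<delta>] by (simp add: cis_conv_exp)
    also have "r * (2 * \<bar>sin (\<delta>/2)\<bar>) \<le> r * (2 * \<bar>\<delta>/2\<bar>)"
      using r abs_sin_x_le_abs_x[of "\<delta>/2"] by (intro mult_left_mono) auto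
    also have "\<dots> \<le> r / 16" using r \<delta> by (simp add: field_simps)
    finally show ?thesis .
  qed
  have chain: "p i \<in> F \<or> ln (cmod (f (p i))) \<le> 3 ^ i * (T * r)" for i
  proof (induction i)
    case 0
    show ?case using eF by (simp add: p_def)
  next
    case (Suc i)
    show ?case
    proof (cases "p (Suc i) \<in> F \<or> (\<exists>y\<in>F. dist (p (Suc i)) y \<le> r / 8)")
      case True
      then have "p (Suc i) \<in> F \<or> ln (cmod (f (p (Suc i)))) \<le> T * r"
        using near np by blast
      moreover have "1 * (T * r) \<le> 3 ^ Suc i * (T * r)"
        by (intro mult_right_mono one_le_power) (use T r in auto)
      ultimately show ?thesis by auto
    next
      case False
      have gt: "1 < cmod (f w)" if "w \<in> ball (p (Suc i)) (r/8)" for w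
      proof (rule ccontr)
        assume "\<not> 1 < cmod (f w)"
        then have "w \<in> F" by (simp add: F_def)
        moreover have "dist (p (Suc i)) w \<le> r / 8" using that by simp
        ultimately show False using False by blast
      qed
      have inb: "p i \<in> ball (p (Suc i)) (r/8)" using step[of i] r by simp
      then have "p i \<notin> F" using False by auto
      define t where "t = dist (p (Suc i)) (p i) / (r/8)"
      have t: "0 \<le> t" "t \<le> 1/2" using step[of i] r by (auto simp: t_def field_simps)
      have "(1 - t) / (1 + t) * ln (cmod (f (p (Suc i)))) \<le> ln (cmod (f (p i)))"
        unfolding t_def by (rule harnack_zero_free[OF holomorphic_on_subset[OF hol] gt inb]) auto
      moreover have "1 / 3 \<le> (1 - t) / (1 + t)" using t by (simp add: field_simps)
      moreover have "0 < ln (cmod (f (p (Suc i))))" using gt[of "p (Suc i)"] r by (intro ln_gt_zero) simp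
      ultimately have "1/3 * ln (cmod (f (p (Suc i)))) \<le> ln (cmod (f (p i)))"
        by (smt (verit) mult_right_mono)
      then show ?thesis using Suc \<open>p i \<notin> F\<close> by simp
    qed
  qed
  have pz: "p 102 = z" by (simp add: p_def \<theta> \<delta>_def)
  show ?thesis
  proof (cases "z \<in> F")
    case True
    then have "cmod (f z) \<le> 1" by (simp add: F_def)
    also have "1 \<le> exp (3 ^ 102 * (T * r))" using T r by simp
    finally show ?thesis .
  next
    case False
    then have "ln (cmod (f z)) \<le> 3 ^ 102 * (T * r)" using chain[of 102] pz by simp
    moreover have "cmod (f z) > 1" using False by (simp add: F_def)
    ultimately show ?thesis by (metis exp_le_cancel_iff exp_ln less_trans zero_less_one)
  qed
qed

section \<open>The spherical derivative as a Lipschitz constant\<close>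

lemma snd_stereo: "snd (stereo w) = 1 - 2 / (1 + (cmod w)\<^sup>2)"
proof -
  have "1 + (cmod w)\<^sup>2 \<noteq> 0" by (metis add_nonneg_eq_0_iff zero_le_one zero_le_power2 zero_neq_one)
  then show ?thesis by (simp add: stereo_def field_simps)
qed

lemma stereo_has_derivative:
  "(stereo has_derivative (\<lambda>u. (u * of_real (2 / (1 + (cmod w)\<^sup>2)) - w * of_real (4 * (w \<bullet> u) / (1 + (cmod w)\<^sup>2)\<^sup>2),
       4 * (w \<bullet> u) / (1 + (cmod w)\<^sup>2)\<^sup>2))) (at w)"
proof -
  have pos: "1 + w \<bullet> w \<noteq> 0" by (metis add_nonneg_eq_0_iff inner_ge_zero zero_le_one zero_neq_one)
  have eq: "stereo = (\<lambda>z. ((2 / (1 + z \<bullet> z)) *\<^sub>R z, 1 - 2 / (1 + z \<bullet> z)))"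
  proof
    fix z
    show "stereo z = ((2 / (1 + z \<bullet> z)) *\<^sub>R z, 1 - 2 / (1 + z \<bullet> z))"
      using snd_stereo[of z]
      by (simp add: stereo_def dot_square_norm scaleR_conv_of_real mult.commute)
  qed
  have d: "((\<lambda>z. 2 / (1 + z \<bullet> z)) has_derivative (\<lambda>u. - 4 * (w \<bullet> u) / (1 + w \<bullet> w)\<^sup>2)) (at w)"
    by (rule derivative_eq_intros refl | simp add: pos)+
       (auto simp: fun_eq_iff inner_commute power2_eq_square field_simps)
  have "((\<lambda>z. ((2 / (1 + z \<bullet> z)) *\<^sub>R z, 1 - 2 / (1 + z \<bullet> z))) has_derivative
     (\<lambda>u. ((2 / (1 + w \<bullet> w)) *\<^sub>R u + (- 4 * (w \<bullet> u) / (1 + w \<bullet> w)\<^sup>2) *\<^sub>R w, 0 - (- 4 * (w \<bullet> u) / (1 + w \<bullet> w)\<^sup>2)))) (at w)"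
    by (intro has_derivative_Pair has_derivative_scaleR has_derivative_diff has_derivative_const d has_derivative_ident)
  then show ?thesis unfolding eq
    by (rule has_derivative_eq_rhs)
       (simp add: fun_eq_iff dot_square_norm scaleR_conv_of_real mult.commute)
qed

lemma norm_stereo_derivative:
  "norm (u * of_real (2 / (1 + (cmod w)\<^sup>2)) - w * of_real (4 * (w \<bullet> u) / (1 + (cmod w)\<^sup>2)\<^sup>2),
       4 * (w \<bullet> u) / (1 + (cmod w)\<^sup>2)\<^sup>2) = 2 * cmod u / (1 + (cmod w)\<^sup>2)"
proof -
  define s where "s = 1 + (cmod w)\<^sup>2"
  define i where "i = w \<bullet> u"
  have s: "s > 0" by (simp add: s_def add_pos_nonneg)
  have "(norm (u * of_real (2 / s) - w * of_real (4 * i / s\<^sup>2), 4 * i / s\<^sup>2))\<^sup>2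
      = (norm (u * of_real (2 / s) - w * of_real (4 * i / s\<^sup>2)))\<^sup>2 + (4 * i / s\<^sup>2)\<^sup>2"
    by (simp add: norm_Pair power_divide)
  also have "(norm (u * of_real (2 / s) - w * of_real (4 * i / s\<^sup>2)))\<^sup>2
      = (norm ((2 / s) *\<^sub>R u - (4 * i / s\<^sup>2) *\<^sub>R w))\<^sup>2"
    by (simp add: scaleR_conv_of_real mult.commute)
  also have "\<dots> = (2 / s)\<^sup>2 * (cmod u)\<^sup>2 - 2 * (2 / s) * (4 * i / s\<^sup>2) * i + (4 * i / s\<^sup>2)\<^sup>2 * (s - 1)"
  proof -
    have "(norm (c *\<^sub>R u - d *\<^sub>R w))\<^sup>2 = c\<^sup>2 * (cmod u)\<^sup>2 - 2 * c * d * i + d\<^sup>2 * (cmod w)\<^sup>2" for c d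
      unfolding power2_norm_eq_inner i_def
      by (simp add: inner_diff_left inner_diff_right inner_commute[of u w] power2_eq_square algebra_simps)
    then show ?thesis by (simp add: s_def)
  qed
  also have "\<dots> + (4 * i / s\<^sup>2)\<^sup>2 = (2 * cmod u / s)\<^sup>2"
    using s by (simp add: power2_eq_square field_simps)
  finally have "norm (u * of_real (2 / s) - w * of_real (4 * i / s\<^sup>2), 4 * i / s\<^sup>2) = 2 * cmod u / s"
    by (rule power2_eq_imp_eq) (use s in auto)
  then show ?thesis by (simp add: s_def i_def)
qed

text \<open>
  Stereographic projection scales lengths at \<open>w\<close> by the factor \<open>2 / (1 + |w|\<^sup>2)\<close>, so the composition of \<open>h\<close>
  with it has derivative of norm twice the spherical derivative of \<open>h\<close>.
\<close>
lemma stereo_comp_lipschitz: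
  assumes h: "h holomorphic_on U" and U: "open U" and S: "convex S" "S \<subseteq> U"
    and bd: "\<And>z. z \<in> S \<Longrightarrow> cmod (deriv h z) \<le> C * (1 + (cmod (h z))\<^sup>2)"
    and xy: "x \<in> S" "y \<in> S"
  shows "dist (stereo (h x)) (stereo (h y)) \<le> 2 * C * dist x y"
proof -
  define D where "D = (\<lambda>w u. (u * of_real (2 / (1 + (cmod w)\<^sup>2)) - w * of_real (4 * (w \<bullet> u) / (1 + (cmod w)\<^sup>2)\<^sup>2),
       4 * (w \<bullet> u) / (1 + (cmod w)\<^sup>2)\<^sup>2) :: complex \<times> real)"
  have "norm ((\<lambda>z. stereo (h z)) x - (\<lambda>z. stereo (h z)) y) \<le> (2 * C) * norm (x - y)"
  proof (rule differentiable_bound[OF S(1) _ _ xy])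
    fix z assume z: "z \<in> S"
    have "(h has_derivative (\<lambda>u. deriv h z * u)) (at z)"
      using holomorphic_derivI[OF h U] z S by (auto simp: has_field_derivative_def)
    then have "((\<lambda>z. stereo (h z)) has_derivative (\<lambda>u. D (h z) (deriv h z * u))) (at z)"
      unfolding D_def by (rule has_derivative_compose[OF _ stereo_has_derivative])
    then show "((\<lambda>z. stereo (h z)) has_derivative (\<lambda>u. D (h z) (deriv h z * u))) (at z within S)"
      by (rule has_derivative_at_withinI)
    show "onorm (\<lambda>u. D (h z) (deriv h z * u)) \<le> 2 * C"
    proof (rule onorm_le)
      fix u
      have pos: "1 + (cmod (h z))\<^sup>2 > 0" by (simp add: add_pos_nonneg)
      have "norm (D (h z) (deriv h z * u)) = 2 * (cmod (deriv h z) * cmod u) / (1 + (cmod (h z))\<^sup>2)"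
        unfolding D_def norm_stereo_derivative by (simp add: norm_mult)
      also have "\<dots> \<le> 2 * (C * (1 + (cmod (h z))\<^sup>2) * cmod u) / (1 + (cmod (h z))\<^sup>2)"
        using bd[OF z] pos by (intro divide_right_mono mult_left_mono mult_right_mono) auto
      also have "\<dots> = 2 * C * norm u" using pos by simp
      finally show "norm (D (h z) (deriv h z * u)) \<le> 2 * C * norm u" .
    qed
  qed
  then show ?thesis by (simp add: dist_norm)
qed

text \<open>
  The last coordinate of the stereographic projection alone. It controls how fast the modulus of \<open>h\<close> can
  change.
\<close>
lemma spherical_lipschitz_inverse:
  assumes h: "h holomorphic_on U" and U: "open U" and S: "convex S" "S \<subseteq> U"
    and bd: "\<And>z. z \<in> S \<Longrightarrow> cmod (deriv h z) \<le> C * (1 + (cmod (h z))\<^sup>2)"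
    and xy: "x \<in> S" "y \<in> S"
  shows "\<bar>1 / (1 + (cmod (h x))\<^sup>2) - 1 / (1 + (cmod (h y))\<^sup>2)\<bar> \<le> C * dist x y"
proof -
  have "dist (snd (stereo (h x))) (snd (stereo (h y))) \<le> 2 * C * dist x y"
    using dist_snd_le stereo_comp_lipschitz[OF assms] by (rule order_trans)
  then show ?thesis by (simp add: snd_stereo dist_real_def abs_if split: if_splits)
qed

section \<open>Entire functions that are totally ramified over five values\<close>

text \<open>
  Differentiating \<open>\<Phi> h = h'\<^sup>2\<close> and multiplying by \<open>\<Phi>\<close> gives \<open>h' \<cdot> (\<Phi>' h' + \<Phi>\<^sup>2 - 2 \<Phi> h'') = 0\<close>, and the factor
  \<open>h'\<close> can be cancelled by the identity theorem. This second-order equation turns Cauchy estimates for \<open>h\<close>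
  into estimates for \<open>\<Phi>\<close>.
\<close>
lemma quotient_identity:
  fixes h \<Phi> :: "complex \<Rightarrow> complex"
  assumes S: "open S" "connected S" and h: "h holomorphic_on S" and \<Phi>: "\<Phi> holomorphic_on S"
    and eq: "\<And>z. z \<in> S \<Longrightarrow> \<Phi> z * h z = (deriv h z)\<^sup>2"
    and nc: "p0 \<in> S" "deriv h p0 \<noteq> 0" and z: "z \<in> S"
  shows "deriv \<Phi> z * deriv h z + (\<Phi> z)\<^sup>2 = 2 * \<Phi> z * deriv (deriv h) z"
proof -
  define E where "E = (\<lambda>z. deriv \<Phi> z * deriv h z + (\<Phi> z)\<^sup>2 - 2 * \<Phi> z * deriv (deriv h) z)"
  have hE: "E holomorphic_on S" unfolding E_def
    by (intro holomorphic_intros h \<Phi> S holomorphic_deriv)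
  have prod0: "deriv h w * E w = 0" if w: "w \<in> S" for w
  proof -
    have "((\<lambda>z. \<Phi> z * h z) has_field_derivative deriv \<Phi> w * h w + deriv h w * \<Phi> w) (at w)"
      by (rule DERIV_mult[OF holomorphic_derivI[OF \<Phi> S(1) w] holomorphic_derivI[OF h S(1) w]])
    moreover have "((\<lambda>z. \<Phi> z * h z) has_field_derivative 2 * deriv h w * deriv (deriv h) w) (at w)"
    proof (rule has_field_derivative_transform_within_open[OF _ S(1) w])
      show "((\<lambda>z. (deriv h z)\<^sup>2) has_field_derivative 2 * deriv h w * deriv (deriv h) w) (at w)"
        by (rule derivative_eq_intros holomorphic_derivI[OF holomorphic_deriv[OF h S(1)] S(1) w] refl | simp)+
    qed (use eq in auto)
    ultimately have "deriv \<Phi> w * h w + deriv h w * \<Phi> w = 2 * deriv h w * deriv (deriv h) w"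
      by (rule DERIV_unique)
    then have "\<Phi> w * (deriv \<Phi> w * h w + deriv h w * \<Phi> w) = \<Phi> w * (2 * deriv h w * deriv (deriv h) w)"
      by simp
    then have "deriv \<Phi> w * (\<Phi> w * h w) + deriv h w * (\<Phi> w)\<^sup>2 = 2 * deriv h w * \<Phi> w * deriv (deriv h) w"
      by (simp add: algebra_simps power2_eq_square)
    then show ?thesis by (simp add: eq[OF w] E_def algebra_simps power2_eq_square)
  qed
  have "E z = 0"
  proof -
    have "open {w \<in> S. deriv h w \<noteq> 0}"
    proof -
      have "continuous_on S (deriv h)" by (intro holomorphic_on_imp_continuous_on holomorphic_deriv h S)
      then have "open (S \<inter> deriv h -` (- {0}))"
        by (rule continuous_open_preimage[OF _ S(1)]) auto
      moreover have "S \<inter> deriv h -` (- {0}) = {w \<in> S. deriv h w \<noteq> 0}" by auto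
      ultimately show ?thesis by simp
    qed
    moreover have "E w = 0" if "w \<in> {w \<in> S. deriv h w \<noteq> 0}" for w using prod0 that by auto
    ultimately show ?thesis
      using analytic_continuation_open[of "{w \<in> S. deriv h w \<noteq> 0}" S E "\<lambda>_. 0" z] S hE nc z
      by (auto intro!: holomorphic_intros)
  qed
  thus ?thesis by (simp add: E_def)
qed

text \<open>
  The quantity \<open>(\<rho> - |z - z\<^sub>0|)\<^sup>2 |\<Phi>(z)|\<close> has a maximum at some point \<open>p\<close>. On a disc around \<open>p\<close> of radius \<open>R\<close>, half the
  distance to the boundary, \<open>|\<Phi>|\<close> is at most \<open>4 |\<Phi>(p)|\<close>, so the Cauchy estimates bound \<open>h'\<close>, \<open>h''\<close> and
  \<open>\<Phi>' / \<Phi>\<close> at \<open>p\<close>. Inserting this into the identity \<open>\<Phi> = 2 h'' - (\<Phi>'/\<Phi>) h'\<close> bounds \<open>|\<Phi>(p)|\<close> by a multiple of \<open>M / R\<^sup>2\<close>.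
\<close>
lemma quotient_bound:
  fixes h \<Phi> :: "complex \<Rightarrow> complex"
  assumes h: "h holomorphic_on ball z0 (2 * \<rho>)" and \<Phi>: "\<Phi> holomorphic_on ball z0 (2 * \<rho>)"
    and eq: "\<And>z. z \<in> ball z0 (2 * \<rho>) \<Longrightarrow> \<Phi> z * h z = (deriv h z)\<^sup>2"
    and nc: "p0 \<in> ball z0 (2 * \<rho>)" "deriv h p0 \<noteq> 0"
    and bd: "\<And>z. z \<in> ball z0 (2 * \<rho>) \<Longrightarrow> cmod (h z) \<le> M" and \<rho>: "\<rho> > 0"
  shows "cmod (\<Phi> z0) \<le> 32 * M / \<rho>\<^sup>2"
proof -
  have sub: "cball z0 \<rho> \<subseteq> ball z0 (2 * \<rho>)" using \<rho> by auto
  have ic: "continuous_on (cball z0 \<rho>) (\<lambda>z. (\<rho> - dist z0 z)\<^sup>2 * cmod (\<Phi> z))"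
    by (intro continuous_intros continuous_on_subset[OF holomorphic_on_imp_continuous_on[OF \<Phi>] sub])
  obtain p where p: "p \<in> cball z0 \<rho>" and max: "\<And>z. z \<in> cball z0 \<rho> \<Longrightarrow>
      (\<rho> - dist z0 z)\<^sup>2 * cmod (\<Phi> z) \<le> (\<rho> - dist z0 p)\<^sup>2 * cmod (\<Phi> p)"
    using continuous_attains_sup[OF _ _ ic] \<rho> by auto
  have M: "0 \<le> M" using bd[of z0] \<rho> by (smt (verit) centre_in_ball norm_ge_zero)
  define B where "B = cmod (\<Phi> p)"
  define R where "R = (\<rho> - dist z0 p) / 2"
  have key: "\<rho>\<^sup>2 * cmod (\<Phi> z0) \<le> 4 * (R\<^sup>2 * B)"
    using max[of z0] \<rho> by (simp add: R_def B_def power_divide)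
  have "R\<^sup>2 * B \<le> 8 * M"
  proof (cases "R = 0 \<or> B = 0")
    case True
    then show ?thesis using M by auto
  next
    case False
    have R: "R > 0" using False p by (auto simp: R_def)
    have B: "B > 0" using False by (simp add: B_def)
    have inb: "cball p R \<subseteq> cball z0 \<rho>"
    proof
      fix x assume "x \<in> cball p R"
      then have "dist z0 x \<le> dist z0 p + R" using dist_triangle[of z0 x p] by simp
      also have "\<dots> \<le> \<rho>" using R by (simp add: R_def field_simps)
      finally show "x \<in> cball z0 \<rho>" by simp
    qed
    have le4: "cmod (\<Phi> x) \<le> 4 * B" if "x \<in> cball p R" for x
    proof -
      have "dist z0 x \<le> dist z0 p + R" using dist_triangle[of z0 x p] that by simp
      moreover have "dist z0 p + 2 * R = \<rho>" by (simp add: R_def field_simps)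
      ultimately have "R \<le> \<rho> - dist z0 x" by linarith
      then have "R\<^sup>2 * cmod (\<Phi> x) \<le> (\<rho> - dist z0 x)\<^sup>2 * cmod (\<Phi> x)"
        using R by (intro mult_right_mono power_mono) auto
      also have "\<dots> \<le> (\<rho> - dist z0 p)\<^sup>2 * B" using max[of x] inb that by (auto simp: B_def)
      also have "\<dots> = R\<^sup>2 * (4 * B)" by (simp add: R_def power_divide)
      finally show ?thesis using R by simp
    qed
    have ball: "ball p R \<subseteq> ball z0 (2 * \<rho>)" "cball p R \<subseteq> ball z0 (2*\<rho>)"
      using inb sub ball_subset_cball by blast+
    have c1: "continuous_on (cball p R) \<Phi>"
      by (intro continuous_on_subset[OF holomorphic_on_imp_continuous_on[OF \<Phi>]] ball)
    have c2: "continuous_on (cball p R) h"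
      by (intro continuous_on_subset[OF holomorphic_on_imp_continuous_on[OF h]] ball)
    have sph: "x \<in> cball p R" if "cmod (p - x) = R" for x using that by (simp add: dist_norm)
    have d\<Phi>: "cmod (deriv \<Phi> p) \<le> 4 * B / R"
      using Cauchy_inequality[OF holomorphic_on_subset[OF \<Phi> ball(1)] c1 R le4[OF sph], of 1] by simp
    have hM: "cmod (h x) \<le> M" if "cmod (p - x) = R" for x using bd ball(2) sph[OF that] by blast
    have dh: "cmod (deriv h p) \<le> M / R" "cmod (deriv (deriv h) p) \<le> 2 * M / R\<^sup>2"
      using Cauchy_inequality[OF holomorphic_on_subset[OF h ball(1)] c2 R hM, of 1]
            Cauchy_inequality[OF holomorphic_on_subset[OF h ball(1)] c2 R hM, of 2]
      by (simp_all add: numeral_2_eq_2)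
    have "deriv \<Phi> p * deriv h p + (\<Phi> p)\<^sup>2 = 2 * \<Phi> p * deriv (deriv h) p"
      by (rule quotient_identity[OF _ _ h \<Phi> eq nc])
         (use p sub in auto)
    then have "(\<Phi> p)\<^sup>2 = 2 * \<Phi> p * deriv (deriv h) p - deriv \<Phi> p * deriv h p" by algebra
    then have "B\<^sup>2 \<le> cmod (2 * \<Phi> p * deriv (deriv h) p) + cmod (deriv \<Phi> p * deriv h p)"
      unfolding B_def by (metis norm_power norm_triangle_ineq4)
    also have "\<dots> = 2 * B * cmod (deriv (deriv h) p) + cmod (deriv \<Phi> p) * cmod (deriv h p)"
      by (simp add: norm_mult B_def)
    also have "\<dots> \<le> 2 * B * (2 * M / R\<^sup>2) + (4 * B / R) * (M / R)"
      using B R M dh d\<Phi> by (intro add_mono mult_mono) auto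
    also have "\<dots> = B * (8 * M / R\<^sup>2)" using R by (simp add: power2_eq_square field_simps)
    finally have "B * B \<le> B * (8 * M / R\<^sup>2)" by (simp add: power2_eq_square)
    then have "B \<le> 8 * M / R\<^sup>2" using B by (simp only: mult_le_cancel_left_pos)
    then show ?thesis using R by (simp add: field_simps)
  qed
  then have "\<rho>\<^sup>2 * cmod (\<Phi> z0) \<le> 32 * M" using key by linarith
  then show ?thesis using \<rho> by (simp add: field_simps)
qed

text \<open>
  At a point where \<open>g\<close> takes the value \<open>a \<in> A\<close> with multiplicity \<open>n\<close>, the numerator vanishes to order \<open>2 (n - 1)\<close>
  and the denominator to order \<open>n\<close>. So the quotient has a removable singularity if \<open>n \<ge> 2\<close>.
\<close>
lemma totally_ramified_quotient_entire:
  assumes g: "g holomorphic_on UNIV" and nc: "\<not> g constant_on UNIV" and fin: "finite A"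
    and ram: "\<And>z a. a \<in> A \<Longrightarrow> g z = a \<Longrightarrow> deriv g z = 0"
  obtains \<Phi> where "\<Phi> holomorphic_on UNIV" "\<And>z. \<Phi> z * (\<Prod>a\<in>A. g z - a) = (deriv g z)\<^sup>2"
proof -
  define P where "P = (\<lambda>z. \<Prod>a\<in>A. g z - a)"
  define q where "q = (\<lambda>z. (deriv g z)\<^sup>2 / P z)"
  have hP: "P holomorphic_on UNIV" unfolding P_def by (intro holomorphic_intros g)
  have hq: "q holomorphic_on S" if "\<And>z. z \<in> S \<Longrightarrow> P z \<noteq> 0" for S
    unfolding q_def using that
    by (intro holomorphic_intros holomorphic_on_subset[OF hP] holomorphic_on_subset[OF holomorphic_deriv[OF g]]) auto
  have local: "\<exists>r>0. \<exists>k. k holomorphic_on ball z r \<and> (\<forall>w\<in>ball z r - {z}. P w \<noteq> 0 \<and> k w = q w)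
        \<and> k z * P z = (deriv g z)\<^sup>2" for z
  proof (cases "P z = 0")
    case False
    have "open {w. P w \<noteq> 0}"
      by (intro open_Collect_neq continuous_on_const holomorphic_on_imp_continuous_on hP)
    then obtain r where r: "r > 0" "ball z r \<subseteq> {w. P w \<noteq> 0}" using False by (auto simp: open_contains_ball)
    show ?thesis
      by (rule exI[of _ r], intro conjI exI[of _ q] hq) (use r False in \<open>auto simp: q_def\<close>)
  next
    case True
    then obtain a where a: "a \<in> A" "g z = a" using fin by (auto simp: P_def)
    have "\<not> (\<lambda>w. g w - a) constant_on UNIV" using nc unfolding constant_on_def by (metis diff_add_cancel)
    from _ _ _ _ _ this obtain k r n where k: "0 < n" "0 < r" "k holomorphic_on ball z r"
       "\<And>w. w \<in> ball z r \<Longrightarrow> g w - a = (w - z) ^ n * k w" "\<And>w. w \<in> ball z r \<Longrightarrow> k w \<noteq> 0"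
      by (rule holomorphic_factor_zero_nonconstant[of "\<lambda>w. g w - a" UNIV z])
         (use g a in \<open>auto intro: holomorphic_intros\<close>)
    define k' where "k' = (\<lambda>w. of_nat n * k w + (w - z) * deriv k w)"
    have dg: "deriv g w = (w - z) ^ (n - 1) * k' w" if w: "w \<in> ball z r" for w
    proof -
      have "((\<lambda>w. a + (w - z) ^ n * k w) has_field_derivative (w - z) ^ (n - 1) * k' w) (at w)"
      proof -
        have "((\<lambda>w. a + (w - z) ^ n * k w) has_field_derivative
                 of_nat n * (w - z) ^ (n - 1) * k w + (w - z) ^ n * deriv k w) (at w)"
          by (rule derivative_eq_intros holomorphic_derivI[OF k(3) _ w] refl | simp)+
        moreover have "(w - z) ^ n = (w - z) ^ (n - 1) * (w - z)"
          using k(1) by (metis Suc_diff_1 power_Suc2)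
        ultimately show ?thesis by (simp add: k'_def algebra_simps)
      qed
      then have "(g has_field_derivative (w - z) ^ (n - 1) * k' w) (at w)"
        by (rule has_field_derivative_transform_within_open[OF _ open_ball w]) (use k(4) in \<open>auto simp: algebra_simps\<close>)
      thus ?thesis by (rule DERIV_imp_deriv)
    qed
    have n2: "n \<ge> 2"
    proof (rule ccontr)
      assume "\<not> n \<ge> 2"
      then have "n = 1" using k(1) by simp
      then have "deriv g z = k z" using dg[of z] k(2) by (simp add: k'_def)
      moreover have "deriv g z = 0" using ram a by auto
      ultimately show False using k(5)[of z] k(2) by auto
    qed
    define Q where "Q = (\<lambda>w. \<Prod>b\<in>A - {a}. g w - b)"
    have PQ: "P w = (g w - a) * Q w" for w
      unfolding P_def Q_def using prod.remove[OF fin a(1)] by simp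
    have hQ: "Q holomorphic_on UNIV" unfolding Q_def by (intro holomorphic_intros g)
    have Qz: "Q z \<noteq> 0" using fin a by (auto simp: Q_def)
    have "open {w. Q w \<noteq> 0}"
      by (intro open_Collect_neq continuous_on_const holomorphic_on_imp_continuous_on hQ)
    then obtain s where s: "s > 0" "ball z s \<subseteq> {w. Q w \<noteq> 0}" using Qz by (auto simp: open_contains_ball)
    define t where "t = min r s"
    have t: "t > 0" "\<And>w. w \<in> ball z t \<Longrightarrow> w \<in> ball z r \<and> Q w \<noteq> 0"
      using s k(2) by (auto simp: t_def)
    define K where "K = (\<lambda>w. (w - z) ^ (n - 2) * (k' w)\<^sup>2 / (k w * Q w))"
    have hk: "k holomorphic_on ball z t" by (rule holomorphic_on_subset[OF k(3)]) (auto simp: t_def)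
    have "K holomorphic_on ball z t"
      unfolding K_def k'_def
      by (intro holomorphic_intros holomorphic_deriv hk holomorphic_on_subset[OF hQ])
         (use t k(5) in auto)
    moreover have "P w \<noteq> 0 \<and> K w = q w" if w: "w \<in> ball z t - {z}" for w
    proof -
      have w': "w \<in> ball z r" "Q w \<noteq> 0" "w \<noteq> z" "k w \<noteq> 0" using t(2)[of w] w k(5) by auto
      have Pw: "P w = (w - z) ^ n * k w * Q w" using PQ[of w] k(4)[OF w'(1)] by simp
      have "(deriv g w)\<^sup>2 = (w - z) ^ (n - 2) * (w - z) ^ n * (k' w)\<^sup>2"
      proof -
        have "(n - 1) * 2 = (n - 2) + n" using n2 by simp
        then show ?thesis by (simp add: dg[OF w'(1)] power_mult_distrib flip: power_add power_mult)
      qed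
      then show ?thesis using w' by (simp add: Pw K_def q_def field_simps)
    qed
    moreover have "K z * P z = (deriv g z)\<^sup>2" using True ram a by auto
    ultimately show ?thesis using t(1) by blast
  qed
  define \<Phi> where "\<Phi> = remove_sings q"
  have main: "\<Phi> analytic_on {z} \<and> \<Phi> z * P z = (deriv g z)\<^sup>2" for z
  proof -
    obtain r k where rk: "r > 0" "k holomorphic_on ball z r"
        "\<And>w. w \<in> ball z r - {z} \<Longrightarrow> P w \<noteq> 0 \<and> k w = q w" "k z * P z = (deriv g z)\<^sup>2"
      using local[of z] by blast
    have hol: "q holomorphic_on ball z r - {z}" by (rule hq) (use rk in auto)
    have iso: "isolated_singularity_at q z"
      using hol rk(1) by (intro isolated_singularity_at_holomorphic[of _ "ball z r"]) auto
    have "k \<midarrow>z\<rightarrow> k z"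
      using rk(1,2) by (metis centre_in_ball continuous_on_eq_continuous_at holomorphic_on_imp_continuous_on isCont_def open_ball)
    then have lim: "q \<midarrow>z\<rightarrow> k z"
      by (rule Lim_transform_within_open[OF _ open_ball[of z r]]) (use rk in auto)
    show ?thesis
      using remove_sings_analytic_at[OF iso lim] remove_sings_eqI[OF lim] rk(4) by (simp add: \<Phi>_def)
  qed
  show ?thesis
  proof
    show "\<Phi> holomorphic_on UNIV"
      by (rule analytic_imp_holomorphic) (use main in \<open>simp add: analytic_on_analytic_at[of \<Phi> UNIV]\<close>)
    show "\<Phi> z * (\<Prod>a\<in>A. g z - a) = (deriv g z)\<^sup>2" for z using main by (simp add: P_def)
  qed
qed


text \<open>
  The quotient \<open>\<Phi> = g'\<^sup>2 / \<Prod> (g - a)\<close> is entire. Where \<open>g\<close> stays away from \<open>A\<close>, it is bounded because \<open>|g'|\<^sup>2\<close> is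
  \<open>O(1 + |g|\<^sup>4)\<close> and the denominator has degree 5 in \<open>g\<close>; where \<open>g\<close> is close to some \<open>a \<in> A\<close>, it is
  bounded by \<open>quotient_bound\<close>. So it is a constant \<open>c\<close>, and comparing degrees once more in
  \<open>|c| |\<Prod> (g - a)| = |g'|\<^sup>2\<close> shows that \<open>g\<close> is bounded.

  The assumption \<open>loc\<close>, which follows from the bound on the spherical derivative, provides a disc of uniform
  size on which \<open>g\<close> stays bounded when it is bounded at the centre.
\<close>
lemma no_entire_totally_ramified:
  assumes g: "g holomorphic_on UNIV"
    and Lip: "\<And>z. cmod (deriv g z) \<le> 2 * (1 + (cmod (g z))\<^sup>2)"
    and card: "card A = 5"
    and loc: "\<And>M. \<exists>\<rho>>0. \<forall>z. cmod (g z) \<le> M \<longrightarrow> (\<forall>w\<in>ball z \<rho>. cmod (g w) \<le> 2 * M + 1)"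
    and ram: "\<And>z a. a \<in> A \<Longrightarrow> g z = a \<Longrightarrow> deriv g z = 0"
  shows "g constant_on UNIV"
proof (rule ccontr)
  assume nc: "\<not> g constant_on UNIV"
  have fin: "finite A" using card by (metis card.infinite zero_neq_numeral)
  obtain \<Phi> where \<Phi>: "\<Phi> holomorphic_on UNIV" "\<And>z. \<Phi> z * (\<Prod>a\<in>A. g z - a) = (deriv g z)\<^sup>2"
  proof (rule totally_ramified_quotient_entire[OF g nc fin])
    show "deriv g z = 0" if "a \<in> A" "g z = a" for z a using ram that by blast
  qed auto
  obtain \<delta> where \<delta>: "\<delta> > 0" "\<And>a b. a \<in> A \<Longrightarrow> b \<in> A \<Longrightarrow> a \<noteq> b \<Longrightarrow> 2 * \<delta> \<le> cmod (a - b)"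
  proof -
    define D where "D = insert 1 ((\<lambda>(a, b). cmod (a - b)) ` {(a, b) \<in> A \<times> A. a \<noteq> b})"
    have D: "finite D" unfolding D_def
      by (intro finite.insertI finite_imageI finite_subset[OF _ finite_cartesian_product[OF fin fin]]) auto
    show ?thesis
    proof (rule that)
      show "Min D / 2 > 0" using D by (auto simp: D_def)
      show "2 * (Min D / 2) \<le> cmod (a - b)" if "a \<in> A" "b \<in> A" "a \<noteq> b" for a b
        using Min_le[OF D, of "cmod (a - b)"] that by (force simp: D_def)
    qed
  qed
  obtain N where N: "\<And>a. a \<in> A \<Longrightarrow> cmod a \<le> N" "N \<ge> 1"
    using finite_imp_bounded[OF fin] unfolding bounded_iff by (metis (no_types) linear order_trans)
  define K where "K = (1 + N) / \<delta> + 1"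
  have K: "1 + cmod w \<le> K * cmod (w - a)" if "a \<in> A" "\<delta> \<le> cmod (w - a)" for w a
  proof -
    have "1 + N \<le> (1 + N) / \<delta> * cmod (w - a)"
    proof -
      have "1 + N = (1 + N) / \<delta> * \<delta>" using \<delta>(1) by simp
      also have "\<dots> \<le> (1 + N) / \<delta> * cmod (w - a)"
        using that \<delta>(1) N(2) by (intro mult_left_mono) auto
      finally show ?thesis .
    qed
    moreover have "cmod w \<le> cmod a + cmod (w - a)" by (metis add.commute diff_add_cancel norm_triangle_ineq)
    ultimately show ?thesis using N(1)[OF that(1)] by (simp add: K_def algebra_simps)
  qed
  have K0: "K \<ge> 0" using \<delta> N by (simp add: K_def)
  have far: "cmod (\<Phi> z) \<le> 4 * K ^ 5" if z: "\<And>a. a \<in> A \<Longrightarrow> \<delta> \<le> cmod (g z - a)" for z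
  proof -
    have "(\<Prod>a\<in>A. 1 + cmod (g z)) \<le> (\<Prod>a\<in>A. K * cmod (g z - a))"
      by (intro prod_mono) (use K z in \<open>auto intro: add_nonneg_nonneg\<close>)
    then have "(1 + cmod (g z)) ^ 5 \<le> K ^ 5 * cmod (\<Prod>a\<in>A. g z - a)"
      by (simp add: prod.distrib card prod_norm)
    have le: "1 + (cmod (g z))\<^sup>2 \<le> (1 + cmod (g z))\<^sup>2" by (simp add: power2_eq_square algebra_simps)
    have "cmod (\<Phi> z) * cmod (\<Prod>a\<in>A. g z - a) = (cmod (deriv g z))\<^sup>2"
      using \<Phi>(2)[of z] by (metis norm_mult norm_power)
    also have "\<dots> \<le> (2 * (1 + (cmod (g z))\<^sup>2))\<^sup>2" by (intro power_mono Lip) auto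
    also have "\<dots> \<le> (2 * (1 + cmod (g z))\<^sup>2)\<^sup>2" using le by (intro power_mono mult_left_mono) auto
    also have "\<dots> = 4 * (1 + cmod (g z)) ^ 4" by (simp add: power_mult_distrib flip: power_mult)
    also have "\<dots> \<le> 4 * (1 + cmod (g z)) ^ 5" by (intro mult_left_mono power_increasing) auto
    also have "\<dots> \<le> 4 * (K ^ 5 * cmod (\<Prod>a\<in>A. g z - a))" using \<open>_ ^ 5 \<le> K ^ 5 * _\<close> by simp
    finally have "cmod (\<Phi> z) * cmod (\<Prod>a\<in>A. g z - a) \<le> 4 * K ^ 5 * cmod (\<Prod>a\<in>A. g z - a)" by simp
    moreover have "(\<Prod>a\<in>A. g z - a) \<noteq> 0" using fin z \<delta>(1) by fastforce
    ultimately show ?thesis by simp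
  qed
  obtain \<rho> where \<rho>: "\<rho> > 0" "\<And>z w. cmod (g z) \<le> N + \<delta> \<Longrightarrow> w \<in> ball z \<rho> \<Longrightarrow> cmod (g w) \<le> 2 * (N + \<delta>) + 1"
    using loc[of "N + \<delta>"] by blast
  define M where "M = 3 * (N + \<delta>) + 1"
  have close: "cmod (\<Phi> z) \<le> 32 * M / (\<rho>/2)\<^sup>2 / \<delta> ^ 4" if a: "a \<in> A" and z: "cmod (g z - a) < \<delta>" for z a
  proof -
    have other: "\<delta> \<le> cmod (g z - b)" if b: "b \<in> A - {a}" for b
    proof -
      have "2 * \<delta> \<le> cmod (a - b)" using \<delta>(2) a b by auto
      also have "\<dots> \<le> cmod (g z - a) + cmod (g z - b)"
        by (metis norm_minus_commute norm_diff_triangle_ineq diff_add_cancel add_diff_cancel dist_norm dist_triangle2)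
      finally show ?thesis using z by linarith
    qed
    define Q where "Q = (\<lambda>w. \<Prod>b\<in>A - {a}. g w - b)"
    have Qlow: "\<delta> ^ 4 \<le> cmod (Q z)"
    proof -
      have "(\<Prod>b\<in>A - {a}. \<delta>) \<le> (\<Prod>b\<in>A - {a}. cmod (g z - b))"
        by (intro prod_mono) (use other \<delta> in auto)
      thus ?thesis using card a fin by (simp add: Q_def prod_norm)
    qed
    have gN: "cmod (g z) \<le> N + \<delta>"
      using z N(1)[OF a] norm_triangle_ineq[of "g z - a" a] by simp
    have "\<exists>p0\<in>ball z (2 * (\<rho>/2)). deriv g p0 \<noteq> 0"
    proof (rule ccontr)
      assume c: "\<not> ?thesis"
      have "deriv g w = 0" for w
        using analytic_continuation_open[of "ball z \<rho>" UNIV "deriv g" "\<lambda>_. 0" w] c \<rho>(1) g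
        by (auto intro!: holomorphic_intros)
      then have "g constant_on UNIV"
        using g by (metis (no_types) UNIV_I constant_on_def connected_UNIV open_UNIV holomorphic_derivI has_field_derivative_0_imp_constant_on)
      with nc show False by simp
    qed
    then obtain p0 where p0: "p0 \<in> ball z (2 * (\<rho>/2))" "deriv g p0 \<noteq> 0" by blast
    have dh: "deriv (\<lambda>w. g w - a) = deriv g"
      by (rule ext, rule DERIV_imp_deriv) (auto intro!: derivative_eq_intros holomorphic_derivI[OF g])
    have "cmod (\<Phi> z * Q z) \<le> 32 * M / (\<rho>/2)\<^sup>2"
    proof (rule quotient_bound[of "\<lambda>w. g w - a" z "\<rho>/2" "\<lambda>w. \<Phi> w * Q w" p0 M])
      show "(\<lambda>w. \<Phi> w * Q w) holomorphic_on ball z (2 * (\<rho>/2))"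
        unfolding Q_def by (intro holomorphic_intros holomorphic_on_subset[OF \<Phi>(1)] holomorphic_on_subset[OF g]) auto
      show "\<Phi> w * Q w * (g w - a) = (deriv (\<lambda>w. g w - a) w)\<^sup>2" for w
        unfolding dh \<Phi>(2)[symmetric] Q_def using prod.remove[OF fin a, of "\<lambda>b. g w - b"] by simp
      show "cmod (g w - a) \<le> M" if "w \<in> ball z (2 * (\<rho>/2))" for w
        using \<rho>(2)[OF gN, of w] that norm_triangle_ineq4[of "g w" a] N(1)[OF a] \<delta>(1) by (simp add: M_def)
      show "deriv (\<lambda>w. g w - a) p0 \<noteq> 0" unfolding dh by fact
      show "(\<lambda>w. g w - a) holomorphic_on ball z (2 * (\<rho>/2))"
        by (intro holomorphic_intros holomorphic_on_subset[OF g]) auto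
    qed (use p0 \<rho>(1) in auto)
    moreover have "cmod (\<Phi> z) * \<delta> ^ 4 \<le> cmod (\<Phi> z * Q z)"
      using Qlow by (simp add: norm_mult mult_left_mono)
    ultimately have "cmod (\<Phi> z) * \<delta> ^ 4 \<le> 32 * M / (\<rho>/2)\<^sup>2" by linarith
    then show ?thesis using \<delta>(1) by (subst pos_le_divide_eq) auto
  qed
  have "cmod (\<Phi> z) \<le> max (4 * K ^ 5) (32 * M / (\<rho>/2)\<^sup>2 / \<delta> ^ 4)" for z
    using far[of z] close[of _ z] by (metis le_max_iff_disj not_le)
  then have "bounded (range \<Phi>)" unfolding bounded_iff by blast
  then obtain c where c: "\<And>z. \<Phi> z = c"
    using Liouville_theorem[OF \<Phi>(1)] by (auto simp: constant_on_def)
  have "c \<noteq> 0"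
  proof
    assume "c = 0"
    then have "deriv g w = 0" for w using \<Phi>(2)[of w] c by simp
    then have "g constant_on UNIV"
      using g by (metis (no_types) UNIV_I constant_on_def connected_UNIV open_UNIV holomorphic_derivI has_field_derivative_0_imp_constant_on)
    with nc show False by simp
  qed
  have "cmod (g z) \<le> N + \<delta> + 4 * K ^ 5 / cmod c" for z
  proof (cases "\<exists>a\<in>A. cmod (g z - a) < \<delta>")
    case True
    then obtain a where a: "a \<in> A" "cmod (g z - a) < \<delta>" by blast
    then have "cmod (g z) \<le> N + \<delta>" using N(1)[OF a(1)] norm_triangle_ineq[of "g z - a" a] by simp
    then show ?thesis using K0 by (smt (verit) divide_nonneg_nonneg norm_ge_zero zero_le_power)
  next
    case False
    have "(\<Prod>a\<in>A. 1 + cmod (g z)) \<le> (\<Prod>a\<in>A. K * cmod (g z - a))"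
      by (intro prod_mono) (use K False in \<open>auto intro: add_nonneg_nonneg simp: not_less\<close>)
    then have P: "(1 + cmod (g z)) ^ 5 \<le> K ^ 5 * cmod (\<Prod>a\<in>A. g z - a)"
      by (simp add: prod.distrib card prod_norm)
    have le: "1 + (cmod (g z))\<^sup>2 \<le> (1 + cmod (g z))\<^sup>2" by (simp add: power2_eq_square algebra_simps)
    have "cmod c * (1 + cmod (g z)) ^ 5 \<le> cmod c * (K ^ 5 * cmod (\<Prod>a\<in>A. g z - a))"
      using P by (intro mult_left_mono) auto
    also have "\<dots> = K ^ 5 * (cmod (deriv g z))\<^sup>2"
      using \<Phi>(2)[of z] c by (metis norm_mult norm_power mult.left_commute)
    also have "\<dots> \<le> K ^ 5 * (2 * (1 + (cmod (g z))\<^sup>2))\<^sup>2" using K0 by (intro mult_left_mono power_mono Lip) auto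
    also have "\<dots> \<le> K ^ 5 * (2 * (1 + cmod (g z))\<^sup>2)\<^sup>2" using le K0 by (intro power_mono mult_left_mono) auto
    also have "\<dots> = (4 * K ^ 5) * (1 + cmod (g z)) ^ 4" by (simp add: power_mult_distrib flip: power_mult)
    finally have "(cmod c * (1 + cmod (g z))) * (1 + cmod (g z)) ^ 4 \<le> (4 * K ^ 5) * (1 + cmod (g z)) ^ 4"
      by (simp add: power_numeral_reduce mult.assoc)
    moreover have "(1 + cmod (g z)) ^ 4 > 0" by (intro zero_less_power) (simp add: add_pos_nonneg)
    ultimately have "cmod c * (1 + cmod (g z)) \<le> 4 * K ^ 5" by simp
    then have "1 + cmod (g z) \<le> 4 * K ^ 5 / cmod c" using \<open>c \<noteq> 0\<close> by (simp add: field_simps)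
    then show ?thesis using N(2) \<delta>(1) by linarith
  qed
  then have "bounded (range g)" unfolding bounded_iff by blast
  then show False using Liouville_theorem[OF g] nc by blast
qed

section \<open>Zalcman rescaling\<close>

lemma spherical_bound_local:
  assumes h: "h holomorphic_on UNIV"
    and bd: "\<And>z. z \<in> ball x \<rho> \<Longrightarrow> cmod (deriv h z) \<le> 2 * (1 + (cmod (h z))\<^sup>2)"
    and w: "w \<in> ball x \<rho>"
  shows "cmod (h x) \<le> M \<Longrightarrow> dist x w \<le> 1 / (8 * (1 + M\<^sup>2)) \<Longrightarrow> cmod (h w) \<le> 2 * M + 1"
    and "2 \<le> cmod (h x) \<Longrightarrow> dist x w \<le> 1 / 20 \<Longrightarrow> 1 < cmod (h w)"
proof -
  have "x \<in> ball x \<rho>" using w by (metis ball_empty centre_in_ball empty_iff not_le)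
  then have L: "\<bar>1 / (1 + (cmod (h x))\<^sup>2) - 1 / (1 + (cmod (h w))\<^sup>2)\<bar> \<le> 2 * dist x w"
    by (intro spherical_lipschitz_inverse[OF h open_UNIV convex_ball[of x \<rho>] _ bd _ w]) auto
  have pos: "1 + (cmod (h v))\<^sup>2 > 0" for v by (simp add: add_pos_nonneg)
  {
    assume M: "cmod (h x) \<le> M" and d: "dist x w \<le> 1 / (8 * (1 + M\<^sup>2))"
    have M0: "0 \<le> M" using M norm_ge_zero order_trans by blast
    have Mp: "1 + M\<^sup>2 > 0" by (simp add: add_pos_nonneg)
    have "1 / (1 + M\<^sup>2) \<le> 1 / (1 + (cmod (h x))\<^sup>2)"
      using M M0 pos[of x] Mp by (intro divide_left_mono add_left_mono power_mono mult_pos_pos) auto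
    moreover have "2 * dist x w \<le> (1/4) * (1 / (1 + M\<^sup>2))" using d Mp by (simp add: field_simps)
    ultimately have "(3/4) * (1 / (1 + M\<^sup>2)) \<le> 1 / (1 + (cmod (h w))\<^sup>2)" using L by linarith
    then have "3 * (1 + (cmod (h w))\<^sup>2) \<le> 4 * (1 + M\<^sup>2)" using pos[of w] Mp by (simp add: field_simps)
    moreover have "0 \<le> M\<^sup>2" "(2 * M + 1)\<^sup>2 = 4 * M\<^sup>2 + 4 * M + 1" by (simp_all add: power2_eq_square algebra_simps)
    moreover have "(cmod (h w))\<^sup>2 \<le> 4 * M\<^sup>2 + 4 * M + 1"
      using \<open>3 * _ \<le> _\<close> \<open>0 \<le> M\<^sup>2\<close> M0 by argo
    ultimately have "(cmod (h w))\<^sup>2 \<le> (2 * M + 1)\<^sup>2" by simp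
    then show "cmod (h w) \<le> 2 * M + 1" by (rule power2_le_imp_le) (use M0 in simp)
  }
  {
    assume M: "2 \<le> cmod (h x)" and d: "dist x w \<le> 1 / 20"
    have "2\<^sup>2 \<le> (cmod (h x))\<^sup>2" using M by (intro power_mono) auto
    then have "1 / (1 + (cmod (h x))\<^sup>2) \<le> 1 / 5" by (intro divide_left_mono) auto
    then have "1 / (1 + (cmod (h w))\<^sup>2) \<le> 1/5 + 1/10" using L d by linarith
    then have "1\<^sup>2 < (cmod (h w))\<^sup>2" using pos[of w] by (simp add: field_simps)
    then show "1 < cmod (h w)" by (rule power2_less_imp_less) simp
  }
qed

text \<open>
  The bound on the spherical derivative keeps \<open>|h| > 1\<close> on a disc of fixed radius around a point where \<open>|h|\<close>
  is at least 2, so Harnack's inequality is available there.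
\<close>
lemma harnack_spherical:
  assumes h: "h holomorphic_on UNIV"
    and bd: "\<And>z. z \<in> ball x (1/20) \<Longrightarrow> cmod (deriv h z) \<le> 2 * (1 + (cmod (h z))\<^sup>2)"
    and x: "2 \<le> cmod (h x)" and w: "dist x w \<le> 1/40"
  shows "ln (cmod (h x)) / 3 \<le> ln (cmod (h w))" "1 < cmod (h w)"
proof -
  have gt: "1 < cmod (h z)" if "z \<in> ball x (1/20)" for z
    using spherical_bound_local(2)[OF h bd that x] that by simp
  have wb: "w \<in> ball x (1/20)" using w by simp
  show "1 < cmod (h w)" using gt[OF wb] .
  define t where "t = dist x w / (1/20)"
  have t: "0 \<le> t" "t \<le> 1/2" using w by (auto simp: t_def)
  have "(1 - t) / (1 + t) * ln (cmod (h x)) \<le> ln (cmod (h w))"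
    unfolding t_def by (rule harnack_zero_free[OF holomorphic_on_subset[OF h] gt wb]) auto
  moreover have "1 / 3 \<le> (1 - t) / (1 + t)" using t by (simp add: field_simps)
  moreover have "0 \<le> ln (cmod (h x))" using x by (intro ln_ge_zero) simp
  ultimately show "ln (cmod (h x)) / 3 \<le> ln (cmod (h w))"
    using mult_right_mono[of "1/3" "(1 - t) / (1 + t)" "ln (cmod (h x))"] by linarith
qed

text \<open>
  This local boundedness allows Montel's theorem in the plane, rather than on the sphere, to be used for rescaled
  functions. If \<open>|h(0)|\<close> were large, then by Harnack's inequality \<open>1/h\<close> would be small near 0,
  and so would be its derivative at 0, which has modulus at least 1 by the normalisation. From 0,
  the bound propagates by Harnack steps of length \<open>1/40\<close>; the threshold 64000 is \<open>40\<^sup>3\<close>.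
\<close>
lemma spherical_normalised_bound:
  assumes h: "h holomorphic_on UNIV"
    and bd: "\<And>z. z \<in> ball 0 N \<Longrightarrow> cmod (deriv h z) \<le> 2 * (1 + (cmod (h z))\<^sup>2)"
    and one: "1 + (cmod (h 0))\<^sup>2 \<le> cmod (deriv h 0)"
    and m: "real m / 40 + 1/20 \<le> N" and x: "cmod x \<le> real m / 40"
  shows "cmod (h x) \<le> exp (3 ^ m * ln 64000)"
proof -
  have bdx: "cmod (deriv h z) \<le> 2 * (1 + (cmod (h z))\<^sup>2)" if "cmod y + 1/20 \<le> N" "z \<in> ball y (1/20)" for y z
  proof -
    have "cmod z \<le> cmod y + dist y z" by (metis dist_0_norm dist_triangle)
    then show ?thesis using that by (intro bd) simp
  qed
  have start: "cmod (h 0) \<le> 64000"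
  proof (rule ccontr)
    assume "\<not> ?thesis"
    then have big: "64000 < cmod (h 0)" by simp
    define l where "l = ln (cmod (h 0)) / 3"
    have near: "exp l \<le> cmod (h w)" "h w \<noteq> 0" if "cmod w \<le> 1/40" for w
    proof -
      have H: "l \<le> ln (cmod (h w))" "1 < cmod (h w)"
        unfolding l_def by (rule harnack_spherical[where x = 0 and w = w, OF h bdx[of 0]]; use that big m in simp)+
      show "h w \<noteq> 0" using H by auto
      show "exp l \<le> cmod (h w)" using H by (metis exp_le_cancel_iff exp_ln less_trans zero_less_one)
    qed
    define k where "k = (\<lambda>w. 1 / h w)"
    have hk: "k holomorphic_on cball 0 (1/40)" unfolding k_def
      by (intro holomorphic_intros holomorphic_on_subset[OF h]) (use near in auto)
    have "cmod ((deriv ^^ 1) k 0) \<le> fact 1 * exp (- l) / (1/40) ^ 1"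
    proof (rule Cauchy_inequality)
      show "k holomorphic_on ball 0 (1/40)" by (rule holomorphic_on_subset[OF hk]) auto
      show "continuous_on (cball 0 (1/40)) k" by (rule holomorphic_on_imp_continuous_on[OF hk])
      show "cmod (k w) \<le> exp (- l)" if "cmod (0 - w) = 1/40" for w
        using near[of w] that by (simp add: k_def norm_divide exp_minus field_simps)
    qed simp
    moreover have "deriv k 0 = - deriv h 0 / (h 0)\<^sup>2"
      unfolding k_def
      by (rule DERIV_imp_deriv)
         (rule derivative_eq_intros holomorphic_derivI[OF h] refl | use near in \<open>simp add: power2_eq_square\<close>)+
    ultimately have "cmod (deriv h 0) / (cmod (h 0))\<^sup>2 \<le> 40 * exp (- l)"
      by (simp add: norm_divide norm_power)
    moreover have "1 \<le> cmod (deriv h 0) / (cmod (h 0))\<^sup>2"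
    proof -
      have "0 < (cmod (h 0))\<^sup>2" using big by (intro zero_less_power) linarith
      then show ?thesis using one by (subst le_divide_eq_1_pos) auto
    qed
    ultimately have "1 \<le> 40 * exp (- l)" by linarith
    then have "exp l \<le> 40" by (simp add: exp_minus field_simps)
    then have "l \<le> ln 40" by (metis exp_gt_zero exp_ln ln_exp ln_le_cancel_iff less_le_trans)
    then have "ln (cmod (h 0)) \<le> 3 * ln 40" by (simp add: l_def)
    also have "\<dots> = ln (40 ^ 3)" by (subst ln_realpow) auto
    finally have "cmod (h 0) \<le> 40 ^ 3" using big by (subst (asm) ln_le_cancel_iff) auto
    then show False using big by simp
  qed
  have "ln (cmod (h x)) \<le> 3 ^ m * ln 64000"
    using m x
  proof (induction m arbitrary: x)
    case 0
    then have "x = 0" by simp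
    show ?case
    proof (cases "h 0 = 0")
      case False
      then show ?thesis using start \<open>x = 0\<close> by (simp add: ln_le_cancel_iff)
    qed (use \<open>x = 0\<close> in simp)
  next
    case (Suc m)
    show ?case
    proof (cases "2 \<le> cmod (h x)")
      case False
      have "ln (cmod (h x)) \<le> ln 64000"
        using False by (cases "h x = 0") (auto simp: ln_le_cancel_iff)
      also have "\<dots> \<le> 3 ^ Suc m * ln 64000"
        using mult_right_mono[OF one_le_power[of "3::real" "Suc m"], of "ln 64000"] by simp
      finally show ?thesis .
    next
      case True
      define y where "y = of_real (real m / real (Suc m)) * x"
      have ny: "cmod y \<le> real m / 40"
      proof -
        have "cmod y = real m / real (Suc m) * cmod x" by (simp add: y_def norm_mult norm_divide del: of_nat_Suc)
        also have "\<dots> \<le> real m / real (Suc m) * (real (Suc m) / 40)"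
          using Suc.prems by (intro mult_left_mono) auto
        finally show ?thesis by (simp del: of_nat_Suc)
      qed
      have "x - y = of_real (1 / real (Suc m)) * x"
      proof -
        have "real m / real (Suc m) = 1 - 1 / real (Suc m)" by (simp add: field_simps)
        then have "1 / real (Suc m) = 1 - real m / real (Suc m)" by simp
        moreover have "x - y = of_real (1 - real m / real (Suc m)) * x"
          by (simp add: y_def algebra_simps del: of_nat_Suc)
        ultimately show ?thesis by (simp only:)
      qed
      then have "dist x y = cmod x / real (Suc m)" by (simp add: dist_norm norm_mult norm_divide del: of_nat_Suc)
      also have "\<dots> \<le> 1 / 40" using Suc.prems by (simp add: field_simps)
      finally have dxy: "dist x y \<le> 1/40" .
      have "ln (cmod (h x)) / 3 \<le> ln (cmod (h y))"
      proof (rule harnack_spherical[OF h bdx[of x] True dxy])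
        have "real (Suc m) / 40 + 1/20 \<le> N" "cmod x \<le> real (Suc m) / 40" using Suc.prems by blast+
        then show "cmod x + 1/20 \<le> N" by linarith
      qed
      also have "\<dots> \<le> 3 ^ m * ln 64000" by (rule Suc.IH) (use Suc.prems ny in \<open>auto simp: field_simps\<close>)
      finally show ?thesis by simp
    qed
  qed
  then show ?thesis
    by (cases "h x = 0") (auto, metis exp_le_cancel_iff exp_ln zero_less_norm_iff)
qed

text \<open>
  Zalcman's choice of the centre: a maximum point \<open>z\<^sub>0\<close> of \<open>(1/2 - |z|) h\<^sup>#(z)\<close>. Rescaling by
  \<open>B = h\<^sup>#(z\<^sub>0)\<close> gives a function whose spherical derivative is 1 at 0 and at most 2 on the disc of radius
  \<open>n/4\<close>.
\<close>
lemma zalcman_rescaling: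
  assumes h: "h holomorphic_on UNIV" and n: "0 < n" "n * (1 + (cmod (h 0))\<^sup>2) \<le> cmod (deriv h 0)"
  obtains z0 B where "n \<le> B" "\<And>x. cmod x < n / 4 \<Longrightarrow> cmod (z0 + x / of_real B) < 1"
    "\<And>x. cmod x < n / 4 \<Longrightarrow> cmod (deriv h (z0 + x / of_real B)) \<le> 2 * B * (1 + (cmod (h (z0 + x / of_real B)))\<^sup>2)"
    "cmod (deriv h z0) = B * (1 + (cmod (h z0))\<^sup>2)"
proof -
  define q where "q = (\<lambda>z. cmod (deriv h z) / (1 + (cmod (h z))\<^sup>2))"
  have pos: "1 + (cmod (h v))\<^sup>2 > 0" for v by (simp add: add_pos_nonneg)
  have cq: "continuous_on (cball 0 (1/2)) (\<lambda>z. (1/2 - cmod z) * q z)"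
    unfolding q_def
    by (intro continuous_intros holomorphic_on_imp_continuous_on holomorphic_on_subset[OF h]
        holomorphic_on_subset[OF holomorphic_deriv[OF h]]) (use pos in \<open>auto simp: less_le\<close>)
  obtain z0 where z0: "z0 \<in> cball 0 (1/2)" and max: "\<And>z. z \<in> cball 0 (1/2) \<Longrightarrow>
      (1/2 - cmod z) * q z \<le> (1/2 - cmod z0) * q z0"
    using continuous_attains_sup[OF _ _ cq] by auto
  define B where "B = q z0"
  define R where "R = (1/2 - cmod z0) / 2"
  have q0: "n \<le> q 0" using n pos[of 0] by (simp add: q_def field_simps)
  have RB: "n / 4 \<le> R * B" using max[of 0] q0 by (simp add: R_def B_def)
  have R0: "R \<ge> 0" using z0 by (simp add: R_def)
  have B0: "B \<ge> 0" using pos[of z0] by (simp add: B_def q_def)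
  have R: "R > 0" using RB n(1) R0 by (cases "R = 0") auto
  have B: "B > 0" using RB n(1) B0 by (cases "B = 0") auto
  have "R \<le> 1/4" by (simp add: R_def)
  then have "R * B \<le> 1/4 * B" using B by (intro mult_right_mono) auto
  then have nB: "n \<le> B" using RB by simp
  have near: "cmod (z0 + x / of_real B) \<le> cmod z0 + R" if "cmod x < n/4" for x
  proof -
    have "cmod (x / of_real B) \<le> R" using that RB B by (simp add: norm_divide field_simps)
    then show ?thesis using norm_triangle_ineq[of z0 "x / of_real B"] by linarith
  qed
  have zR: "cmod z0 + 2 * R = 1/2" by (simp add: R_def field_simps)
  show thesis
  proof
    show "n \<le> B" by fact
    show "cmod (z0 + x / of_real B) < 1" if "cmod x < n/4" for x
      using near[OF that] R zR by linarith
    show "cmod (deriv h z0) = B * (1 + (cmod (h z0))\<^sup>2)" using pos[of z0] by (simp add: B_def q_def)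
    show "cmod (deriv h (z0 + x / of_real B)) \<le> 2 * B * (1 + (cmod (h (z0 + x / of_real B)))\<^sup>2)"
      if "cmod x < n/4" for x
    proof -
      let ?z = "z0 + x / of_real B"
      have "R * q ?z \<le> (1/2 - cmod ?z) * q ?z"
        using near[OF that] zR pos[of ?z] by (intro mult_right_mono) (auto simp: q_def)
      also have "\<dots> \<le> (1/2 - cmod z0) * q z0"
        using near[OF that] R zR by (intro max) simp
      also have "\<dots> = R * (2 * B)" by (simp add: R_def B_def)
      finally have "q ?z \<le> 2 * B" using R by simp
      then show ?thesis using pos[of ?z] by (simp add: q_def pos_divide_le_eq)
    qed
  qed
qed

section \<open>Points with prescribed value and large derivative\<close>

lemma simultaneous_convergent_subsequence:
  fixes a :: "nat \<Rightarrow> nat \<Rightarrow> 'a :: metric_space"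
  assumes comp: "\<And>i. i < q \<Longrightarrow> compact (K i)" and a: "\<And>n i. i < q \<Longrightarrow> a n i \<in> K i"
  shows "\<exists>s b. strict_mono s \<and> (\<forall>i<q. b i \<in> K i \<and> (\<lambda>n. a (s n) i) \<longlonglongrightarrow> b i)"
  using assms
proof (induction q)
  case 0
  show ?case by (intro exI[of _ id]) (auto simp: strict_mono_def)
next
  case (Suc q)
  then obtain s b where s: "strict_mono s" "\<And>i. i < q \<Longrightarrow> b i \<in> K i \<and> (\<lambda>n. a (s n) i) \<longlonglongrightarrow> b i"
    by fastforce
  have "seq_compact (K q)" using Suc.prems(1)[of q] by (simp add: compact_imp_seq_compact)
  then obtain l t where t: "l \<in> K q" "strict_mono t" "((\<lambda>n. a (s n) q) \<circ> t) \<longlonglongrightarrow> l"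
    using Suc.prems(2)[of q] unfolding seq_compact_def by (metis lessI)
  show ?case
  proof (intro exI conjI allI impI)
    show "strict_mono (s \<circ> t)" using s(1) t(2) by (rule strict_mono_o)
    fix i assume "i < Suc q"
    show "(b(q := l)) i \<in> K i" using s(2)[of i] t(1) \<open>i < Suc q\<close> by auto
    show "(\<lambda>n. a ((s \<circ> t) n) i) \<longlonglongrightarrow> (b(q := l)) i"
    proof (cases "i = q")
      case True
      then show ?thesis using t(3) by (simp add: o_def)
    next
      case False
      then have "(\<lambda>n. a (s n) i) \<longlonglongrightarrow> b i" using s(2)[of i] \<open>i < Suc q\<close> by auto
      then show ?thesis using LIMSEQ_subseq_LIMSEQ[OF _ t(2)] False by (simp add: o_def)
    qed
  qed
qed

text \<open>
  By Hurwitz's theorem, a simple \<open>b\<close>-point of the limit \<open>g\<close> is a limit of \<open>\<beta>\<^sub>n\<close>-points of \<open>H\<^sub>n\<close>, where the derivatives of \<open>H\<^sub>n\<close>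
  are small by assumption but close to a nonzero value by convergence.
\<close>
lemma limit_totally_ramified:
  fixes H :: "nat \<Rightarrow> complex \<Rightarrow> complex"
  assumes H: "\<And>n. H n holomorphic_on UNIV" and g: "g holomorphic_on UNIV" "\<not> g constant_on UNIV"
    and conv: "\<And>K. compact K \<Longrightarrow> uniform_limit K H g sequentially"
    and b: "\<beta> \<longlonglongrightarrow> b" and e: "\<epsilon> \<longlonglongrightarrow> 0"
    and small: "\<And>R. eventually (\<lambda>n. \<forall>x\<in>ball 0 R. H n x = \<beta> n \<longrightarrow> cmod (deriv (H n) x) \<le> \<epsilon> n) sequentially"
    and z: "g z = b"
  shows "deriv g z = 0"
proof (rule ccontr)
  assume nz: "deriv g z \<noteq> 0"
  define \<eta> where "\<eta> = cmod (deriv g z) / 4"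
  have \<eta>: "\<eta> > 0" using nz by (simp add: \<eta>_def)
  have "isCont (deriv g) z"
    using holomorphic_on_imp_continuous_on[OF holomorphic_deriv[OF g(1) open_UNIV]]
    by (simp add: continuous_on_eq_continuous_at)
  then obtain \<rho>0 where \<rho>0: "\<rho>0 > 0" "\<And>x. dist x z < \<rho>0 \<Longrightarrow> dist (deriv g x) (deriv g z) < \<eta>"
    using \<eta> unfolding continuous_at_eps_delta by blast
  define \<rho> where "\<rho> = min \<rho>0 1"
  have \<rho>: "\<rho> > 0" "\<rho> \<le> 1" using \<rho>0 by (auto simp: \<rho>_def)
  have gd: "3 * \<eta> \<le> cmod (deriv g x)" if "x \<in> ball z \<rho>" for x
  proof -
    have "dist (deriv g x) (deriv g z) < \<eta>" using that by (intro \<rho>0) (simp add: \<rho>_def dist_commute)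
    then show ?thesis using norm_triangle_ineq2[of "deriv g z" "deriv g x"]
      by (simp add: dist_norm norm_minus_commute \<eta>_def)
  qed
  have "eventually (\<lambda>n. \<forall>x\<in>cball z 2. dist (H n x) (g x) < \<eta>) sequentially"
    using conv[of "cball z 2"] \<eta> by (simp add: uniform_limit_iff)
  moreover have "eventually (\<lambda>n. dist (\<epsilon> n) 0 < \<eta>) sequentially" using e \<eta> by (rule tendstoD)
  moreover have "eventually (\<lambda>n. \<forall>x\<in>ball 0 (cmod z + 1). H n x = \<beta> n \<longrightarrow> cmod (deriv (H n) x) \<le> \<epsilon> n) sequentially"
    by (rule small)
  ultimately have "eventually (\<lambda>n. \<forall>x\<in>ball z \<rho>. H n x \<noteq> \<beta> n) sequentially"
  proof eventually_elim
    case (elim n)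
    show ?case
    proof
      fix x assume x: "x \<in> ball z \<rho>"
      show "H n x \<noteq> \<beta> n"
      proof
        assume eq: "H n x = \<beta> n"
        have "cmod x < cmod z + 1"
          using x \<rho> norm_triangle_ineq2[of x z] by (simp add: dist_norm norm_minus_commute)
        then have "cmod (deriv (H n) x) \<le> \<epsilon> n" using elim(3) eq by simp
        then have 1: "cmod (deriv (H n) x) < \<eta>" using elim(2) by simp
        have "cmod ((deriv ^^ 1) (\<lambda>y. H n y - g y) x) \<le> fact 1 * \<eta> / 1 ^ 1"
        proof (rule Cauchy_inequality)
          show "cmod (H n y - g y) \<le> \<eta>" if "cmod (x - y) = 1" for y
          proof -
            have "dist z y \<le> dist z x + dist x y" by (rule dist_triangle)
            then have "y \<in> cball z 2" using x \<rho> that by (simp add: dist_norm)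
            then show ?thesis using elim(1) by (simp add: dist_norm less_imp_le)
          qed
          show "(\<lambda>y. H n y - g y) holomorphic_on ball x 1"
            by (intro holomorphic_on_diff holomorphic_on_subset[OF H] holomorphic_on_subset[OF g(1)]) auto
          show "continuous_on (cball x 1) (\<lambda>y. H n y - g y)"
            by (intro holomorphic_on_imp_continuous_on holomorphic_on_diff
                holomorphic_on_subset[OF H] holomorphic_on_subset[OF g(1)]) auto
        qed simp
        moreover have "deriv (\<lambda>y. H n y - g y) x = deriv (H n) x - deriv g x"
          by (rule DERIV_imp_deriv) (intro DERIV_diff holomorphic_derivI[OF H] holomorphic_derivI[OF g(1)]; simp)
        ultimately have "cmod (deriv (H n) x - deriv g x) \<le> \<eta>" by simp
        then show False using 1 gd[OF x] \<eta> norm_triangle_ineq2[of "deriv g x" "deriv (H n) x"]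
          by (simp add: norm_minus_commute)
      qed
    qed
  qed
  then obtain N where N: "\<And>n x. n \<ge> N \<Longrightarrow> x \<in> ball z \<rho> \<Longrightarrow> H n x \<noteq> \<beta> n"
    unfolding eventually_sequentially by blast
  have "g z - b \<noteq> 0"
  proof (rule Hurwitz_no_zeros[of "ball z \<rho>" "\<lambda>n x. H (n + N) x - \<beta> (n + N)" "\<lambda>x. g x - b"])
    show "\<not> (\<lambda>x. g x - b) constant_on ball z \<rho>"
    proof
      assume "(\<lambda>x. g x - b) constant_on ball z \<rho>"
      then obtain c where "\<And>x. x \<in> ball z \<rho> \<Longrightarrow> g x - b = c"
        unfolding constant_on_def by blast
      then have const: "c + b = g x" if "x \<in> ball z \<rho>" for x using that by (simp add: algebra_simps)
      have "(g has_field_derivative 0) (at z)"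
        by (rule has_field_derivative_transform_within_open[OF DERIV_const open_ball _ const])
           (use \<rho>(1) in auto)
      from DERIV_imp_deriv[OF this] nz show False by simp
    qed
    show "uniform_limit K (\<lambda>n x. H (n + N) x - \<beta> (n + N)) (\<lambda>x. g x - b) sequentially"
      if "compact K" for K
    proof (rule uniform_limit_minus)
      show "uniform_limit K (\<lambda>n. H (n + N)) g sequentially"
        using filterlim_compose[OF conv[OF that] filterlim_add_const_nat_at_top[of N]]
        by (simp add: o_def)
      show "uniform_limit K (\<lambda>n x. \<beta> (n + N)) (\<lambda>x. b) sequentially"
        using tendstoD[OF LIMSEQ_ignore_initial_segment[OF b, of N]]
        unfolding uniform_limit_iff by (auto elim: eventually_mono)
    qed
    show "(\<lambda>x. H (n + N) x - \<beta> (n + N)) holomorphic_on ball z \<rho>" for n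
      by (intro holomorphic_intros holomorphic_on_subset[OF H]) auto
    show "(\<lambda>x. g x - b) holomorphic_on ball z \<rho>"
      by (intro holomorphic_intros holomorphic_on_subset[OF g(1)]) auto
    show "H (n + N) x - \<beta> (n + N) \<noteq> 0" if "x \<in> ball z \<rho>" for n x
      using N[of "n + N" x] that by simp
  qed (use \<rho> in auto)
  then show False using z by simp
qed

text \<open>
  If the claim fails, rescaling a sequence of counterexamples with \<open>C = n\<close> produces a nonconstant entire function
  with bounded spherical derivative. At the relevant points the derivatives of the counterexamples are less
  than 1, so those of the rescaled functions are less than \<open>1/n\<close>. Hence the limit is totally ramified over
  five values. The values \<open>a\<^sub>i\<close> may vary in disjoint compact sets since such sequences have subsequences with
  distinct limits.
\<close>
theorem lappan_five_values:
  fixes K :: "nat \<Rightarrow> complex set"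
  assumes comp: "\<And>i. i < 5 \<Longrightarrow> compact (K i)" and disj: "\<And>i j. i < 5 \<Longrightarrow> j < 5 \<Longrightarrow> i \<noteq> j \<Longrightarrow> K i \<inter> K j = {}"
  shows "\<exists>C>0. \<forall>h a. h holomorphic_on UNIV \<and> (\<forall>i<5. a i \<in> K i) \<and> C * (1 + (cmod (h 0))\<^sup>2) \<le> cmod (deriv h 0)
      \<longrightarrow> (\<exists>i<5. \<exists>x. cmod x < 1 \<and> h x = a i \<and> 1 \<le> cmod (deriv h x))"
proof (rule ccontr)
  assume "\<not> ?thesis"
  then have neg: "\<not> (\<forall>h a. h holomorphic_on UNIV \<and> (\<forall>i<5. a i \<in> K i) \<and> C * (1 + (cmod (h 0))\<^sup>2) \<le> cmod (deriv h 0)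
      \<longrightarrow> (\<exists>i<5. \<exists>x. cmod x < 1 \<and> h x = a i \<and> 1 \<le> cmod (deriv h x)))" if "C > 0" for C
    using that by blast
  define Bad where "Bad = (\<lambda>n h a. h holomorphic_on UNIV \<and> (\<forall>i<5. a i \<in> K i) \<and>
      real (Suc n) * (1 + (cmod (h 0))\<^sup>2) \<le> cmod (deriv h 0)
      \<and> \<not> (\<exists>i<5. \<exists>x. cmod x < 1 \<and> h x = a i \<and> 1 \<le> cmod (deriv h x)))"
  have "\<exists>h a. Bad n h a" for n
    using neg[of "real (Suc n)"] unfolding Bad_def by auto
  then obtain h a where "\<And>n. Bad n (h n) (a n)" by metis
  then have h: "\<And>n. h n holomorphic_on UNIV" and a: "\<And>n i. i < 5 \<Longrightarrow> a n i \<in> K i"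
    and big: "\<And>n. real (Suc n) * (1 + (cmod (h n 0))\<^sup>2) \<le> cmod (deriv (h n) 0)"
    and no: "\<And>n i x. i < 5 \<Longrightarrow> cmod x < 1 \<Longrightarrow> h n x = a n i \<Longrightarrow> cmod (deriv (h n) x) < 1"
    unfolding Bad_def not_le[symmetric] by blast+
  define Resc where "Resc = (\<lambda>n z0 B. real (Suc n) \<le> B \<and>
    (\<forall>x. cmod x < real (Suc n) / 4 \<longrightarrow> cmod (z0 + x / of_real B) < 1) \<and>
    (\<forall>x. cmod x < real (Suc n) / 4 \<longrightarrow>
       cmod (deriv (h n) (z0 + x / of_real B)) \<le> 2 * B * (1 + (cmod (h n (z0 + x / of_real B)))\<^sup>2)) \<and>
    cmod (deriv (h n) z0) = B * (1 + (cmod (h n z0))\<^sup>2))"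
  have "\<exists>z0 B. Resc n z0 B" for n
    by (rule zalcman_rescaling[OF h _ big[of n]]) (simp, unfold Resc_def, blast)
  then obtain z0 B where "\<And>n. Resc n (z0 n) (B n)" by metis
  then have B: "\<And>n. real (Suc n) \<le> B n"
    and in1: "\<And>n x. cmod x < real (Suc n) / 4 \<Longrightarrow> cmod (z0 n + x / of_real (B n)) < 1"
    and bd: "\<And>n x. cmod x < real (Suc n) / 4 \<Longrightarrow> cmod (deriv (h n) (z0 n + x / of_real (B n)))
         \<le> 2 * B n * (1 + (cmod (h n (z0 n + x / of_real (B n))))\<^sup>2)"
    and one: "\<And>n. cmod (deriv (h n) (z0 n)) = B n * (1 + (cmod (h n (z0 n)))\<^sup>2)"
    unfolding Resc_def by blast+
  have Bpos: "B n > 0" for n using B[of n] by (smt (verit) of_nat_0_less_iff zero_less_Suc)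
  define H where "H = (\<lambda>n x. h n (z0 n + x / of_real (B n)))"
  have holH: "H n holomorphic_on UNIV" for n
    unfolding H_def using Bpos[of n]
    by (intro holomorphic_on_compose_gen[OF _ h, unfolded o_def] holomorphic_intros) auto
  have dH: "deriv (H n) x = deriv (h n) (z0 n + x / of_real (B n)) / of_real (B n)" for n x
  proof -
    have "((\<lambda>x. z0 n + x / of_real (B n)) has_field_derivative 1 / of_real (B n)) (at x)"
      by (rule derivative_eq_intros refl | use Bpos[of n] in simp)+
    then have "(H n has_field_derivative deriv (h n) (z0 n + x / of_real (B n)) * (1 / of_real (B n))) (at x)"
      unfolding H_def using DERIV_chain2[OF holomorphic_derivI[OF h open_UNIV UNIV_I]] by blast
    then show ?thesis using DERIV_imp_deriv by force
  qed
  have Hbd: "cmod (deriv (H n) x) \<le> 2 * (1 + (cmod (H n x))\<^sup>2)" if "cmod x < real (Suc n) / 4" for n x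
    unfolding dH using bd[OF that] Bpos[of n] by (simp add: H_def norm_divide pos_divide_le_eq mult_ac)
  have Hone: "cmod (deriv (H n) 0) = 1 + (cmod (H n 0))\<^sup>2" for n
    unfolding dH using one[of n] Bpos[of n] by (simp add: H_def norm_divide)
  have Hsmall: "cmod (deriv (H n) x) \<le> 1 / real (Suc n)"
    if "i < 5" "cmod x < real (Suc n) / 4" "H n x = a n i" for n i x
  proof -
    have "cmod (deriv (h n) (z0 n + x / of_real (B n))) \<le> 1"
      using no[OF that(1) in1[OF that(2)]] that(3) by (simp add: H_def less_imp_le)
    then have "cmod (deriv (H n) x) \<le> 1 / B n" using Bpos[of n] by (simp add: dH norm_divide divide_right_mono)
    also have "\<dots> \<le> 1 / real (Suc n)" using B[of n] Bpos[of n] by (intro divide_left_mono) auto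
    finally show ?thesis .
  qed
  obtain s b where s: "strict_mono s" and b: "\<And>i. i < 5 \<Longrightarrow> b i \<in> K i" "\<And>i. i < 5 \<Longrightarrow> (\<lambda>n. a (s n) i) \<longlonglongrightarrow> b i"
    using simultaneous_convergent_subsequence[of 5 K a] comp a by blast
  have locbd: "\<exists>M. \<forall>f\<in>range (\<lambda>n. H (s n)). \<forall>z\<in>Q. cmod (f z) \<le> M" if Q: "compact Q" for Q
  proof -
    obtain R where R: "\<And>z. z \<in> Q \<Longrightarrow> cmod z \<le> R" using compact_imp_bounded[OF Q] by (auto simp: bounded_iff)
    obtain m where m: "R * 40 \<le> real m" using real_arch_simple by blast
    have late: "cmod (H n z) \<le> exp (3 ^ m * ln 64000)" if "n \<ge> m" "z \<in> Q" for n z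
    proof (rule spherical_normalised_bound[OF holH, of "real (Suc n) / 4"])
      show "real m / 40 + 1 / 20 \<le> real (Suc n) / 4" using that by simp
      show "cmod z \<le> real m / 40" using R[OF that(2)] m by simp
    qed (use Hbd Hone in auto)
    have "\<forall>n. \<exists>M. \<forall>z\<in>Q. cmod (H n z) \<le> M"
    proof
      fix n
      have "bounded (H n ` Q)"
        by (intro compact_imp_bounded compact_continuous_image holomorphic_on_imp_continuous_on
             holomorphic_on_subset[OF holH] Q) auto
      then show "\<exists>M. \<forall>z\<in>Q. cmod (H n z) \<le> M" by (auto simp: bounded_iff)
    qed
    from choice[OF this] obtain M where M: "\<And>n z. z \<in> Q \<Longrightarrow> cmod (H n z) \<le> M n" by blast
    define M' where "M' = Max (insert (exp (3 ^ m * ln 64000)) (M ` {..<m}))"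
    have "cmod (H n z) \<le> M'" if "z \<in> Q" for n z
    proof (cases "n < m")
      case True
      then have "M n \<le> M'" unfolding M'_def by (intro Max_ge) auto
      then show ?thesis using M[OF that, of n] by linarith
    next
      case False
      have "exp (3 ^ m * ln 64000) \<le> M'" unfolding M'_def by (intro Max_ge) auto
      then show ?thesis using late[of n z] that False by linarith
    qed
    then show ?thesis by blast
  qed
  obtain g r where g: "g holomorphic_on UNIV" "strict_mono r"
    and gp: "\<And>x. (\<lambda>n. H (s (r n)) x) \<longlonglongrightarrow> g x"
    and gu: "\<And>Q. compact Q \<Longrightarrow> uniform_limit Q ((\<lambda>n. H (s n)) \<circ> r) g sequentially"
  proof (rule Montel[OF open_UNIV _ locbd subset_refl])
    show "f holomorphic_on UNIV" if "f \<in> range (\<lambda>n. H (s n))" for f using that holH by auto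
  qed auto
  define t where "t = s \<circ> r"
  have t: "strict_mono t" unfolding t_def using s g(2) by (rule strict_mono_o)
  have tn: "n \<le> t n" for n using t by (rule seq_suble)
  define G where "G = (\<lambda>n. H (t n))"
  have Gu: "uniform_limit Q G g sequentially" if "compact Q" for Q
    using gu[OF that] by (simp add: G_def t_def o_def)
  have Gp: "(\<lambda>n. G n x) \<longlonglongrightarrow> g x" for x using gp[of x] by (simp add: G_def t_def)
  have Gd: "(\<lambda>n. deriv (G n) x) \<longlonglongrightarrow> deriv g x" for x
  proof (rule deriv_complex_uniform_limit)
    show "uniform_limit (ball x 1) G g sequentially"
      by (rule uniform_limit_on_subset[OF Gu[of "cball x 1"]]) auto
  qed (auto simp: G_def intro!: always_eventually holomorphic_on_subset[OF holH])
  have ev: "eventually (\<lambda>n. R < real (Suc (t n)) / 4) sequentially" for R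
  proof -
    obtain m where m: "R * 4 \<le> real m" using real_arch_simple by blast
    have "R < real (Suc (t n)) / 4" if "n \<ge> m" for n using tn[of n] that m by simp
    then show ?thesis unfolding eventually_sequentially by blast
  qed
  have glip: "cmod (deriv g x) \<le> 2 * (1 + (cmod (g x))\<^sup>2)" for x
  proof (rule tendsto_le[OF sequentially_bot])
    show "(\<lambda>n. 2 * (1 + (cmod (G n x))\<^sup>2)) \<longlonglongrightarrow> 2 * (1 + (cmod (g x))\<^sup>2)"
      by (intro tendsto_intros Gp)
    show "(\<lambda>n. cmod (deriv (G n) x)) \<longlonglongrightarrow> cmod (deriv g x)" by (intro tendsto_intros Gd)
    show "\<forall>\<^sub>F n in sequentially. cmod (deriv (G n) x) \<le> 2 * (1 + (cmod (G n x))\<^sup>2)"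
      using ev[of "cmod x"] by eventually_elim (use Hbd in \<open>auto simp: G_def\<close>)
  qed
  have gone: "cmod (deriv g 0) = 1 + (cmod (g 0))\<^sup>2"
  proof (rule LIMSEQ_unique)
    show "(\<lambda>n. cmod (deriv (G n) 0)) \<longlonglongrightarrow> cmod (deriv g 0)" by (intro tendsto_intros Gd)
    have "(\<lambda>n. 1 + (cmod (G n 0))\<^sup>2) \<longlonglongrightarrow> 1 + (cmod (g 0))\<^sup>2" by (intro tendsto_intros Gp)
    then show "(\<lambda>n. cmod (deriv (G n) 0)) \<longlonglongrightarrow> 1 + (cmod (g 0))\<^sup>2" by (simp add: G_def Hone)
  qed
  have gnc: "\<not> g constant_on UNIV"
  proof
    assume "g constant_on UNIV"
    then obtain c where "g = (\<lambda>_. c)" by (auto simp: constant_on_def)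
    then have "deriv g 0 = 0" by simp
    then show False using gone by (smt (verit) norm_zero zero_le_power2)
  qed
  have "g constant_on UNIV"
  proof (rule no_entire_totally_ramified[OF g(1) glip])
    have "inj_on b {..<5}"
    proof (rule inj_onI, rule ccontr)
      fix i j assume ij: "i \<in> {..<5::nat}" "j \<in> {..<5::nat}" "b i = b j" "i \<noteq> j"
      then have "b i \<in> K i" "b i \<in> K j" using b(1)[of i] b(1)[of j] by simp_all
      then show False using disj[of i j] ij by auto
    qed
    then show "card (b ` {..<5}) = 5" by (simp add: card_image)
    show "\<exists>\<rho>>0. \<forall>z. cmod (g z) \<le> M \<longrightarrow> (\<forall>w\<in>ball z \<rho>. cmod (g w) \<le> 2 * M + 1)" for M
    proof (intro exI conjI allI impI ballI)
      show p: "0 < 1 / (8 * (1 + M\<^sup>2))" by (simp add: add_pos_nonneg)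
      show "cmod (g w) \<le> 2 * M + 1" if "cmod (g z) \<le> M" "w \<in> ball z (1 / (8 * (1 + M\<^sup>2)))" for z w
        by (rule spherical_bound_local(1)[OF g(1) glip that(2,1)]) (use that in simp)
    qed
    show "deriv g z = 0" if cb: "c \<in> b ` {..<5}" "g z = c" for z c
    proof -
      obtain i where i: "i < 5" "c = b i" using cb(1) by blast
      show ?thesis
      proof (rule limit_totally_ramified[of G g "\<lambda>n. a (t n) i" "b i" "\<lambda>n. 1 / real (Suc (t n))"])
        show "(\<lambda>n. a (t n) i) \<longlonglongrightarrow> b i"
          using LIMSEQ_subseq_LIMSEQ[OF b(2)[OF i(1)] g(2)] by (simp add: o_def t_def)
        show "(\<lambda>n. 1 / real (Suc (t n))) \<longlonglongrightarrow> 0"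
          using LIMSEQ_subseq_LIMSEQ[OF LIMSEQ_inverse_real_of_nat t] by (simp add: o_def inverse_eq_divide)
        show "\<forall>\<^sub>F n in sequentially. \<forall>x\<in>ball 0 R. G n x = a (t n) i \<longrightarrow> cmod (deriv (G n) x) \<le> 1 / real (Suc (t n))" for R
          using ev[of R] by eventually_elim (use Hsmall[OF i(1)] in \<open>auto simp: G_def\<close>)
        show "G n holomorphic_on UNIV" for n unfolding G_def by (rule holH)
        show "g z = b i" using cb i by simp
      qed (use Gu g gnc in simp_all)
    qed
  qed
  with gnc show False by simp
qed

section \<open>Consequences of a logarithmic singularity, and the maximum modulus\<close>

text \<open>
  The tract \<open>U\<close> is unbounded since \<open>f\<close> is unbounded on it, so it meets every large circle. If such a circle were
  contained in \<open>{|f| > R}\<close>, it would be contained in \<open>U\<close>. But then a point inside it with \<open>|f| \<le> R\<close>, which exists by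
  Liouville's theorem, has winding number 1 in spite of \<open>U\<close> being simply connected.
\<close>
lemma circles_meet_sublevel:
  assumes f: "f holomorphic_on UNIV" and sing: "has_log_singularity_over_infinity f"
  obtains R r0 where "0 < R" "\<And>r. r0 \<le> r \<Longrightarrow> \<exists>z. cmod z = r \<and> cmod (f z) \<le> R"
proof -
  obtain R U where R: "R > 0" and U: "U \<in> components {z. cmod (f z) > R}" and sc: "simply_connected U"
    and cov: "covering_space U f {w. cmod w > R}"
    using sing unfolding has_log_singularity_over_infinity_def by blast
  have im: "f ` U = {w. cmod w > R}" using cov by (rule covering_space_imp_surjective)
  have big: "\<exists>z\<in>U. f z = of_real t" if "t > R" for t :: real
  proof -
    have "of_real t \<in> f ` U" using that R unfolding im by simp
    then show ?thesis by auto
  qed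
  obtain p where p: "cmod (f p) \<le> R"
  proof (rule ccontr)
    assume "\<not> thesis"
    then have gt: "cmod (f z) > R" for z using that[of z] by (meson not_le)
    then have nz: "f z \<noteq> 0" for z using R by (metis norm_zero not_less_iff_gr_or_eq)
    have "(\<lambda>z. 1 / f z) holomorphic_on UNIV" by (intro holomorphic_intros f nz)
    moreover have "bounded (range (\<lambda>z. 1 / f z))"
      unfolding bounded_iff
    proof (intro exI ballI)
      fix y assume "y \<in> range (\<lambda>z. 1 / f z)"
      then obtain z where "y = 1 / f z" by blast
      then show "cmod y \<le> 1 / R" using frac_le[of 1 1 R "cmod (f z)"] gt[of z] R by (simp add: norm_divide)
    qed
    ultimately have "(\<lambda>z. 1 / f z) constant_on UNIV" by (rule Liouville_theorem)
    then obtain c where c: "\<And>z. 1 / f z = c"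
      unfolding constant_on_def by blast
    have val: "f z = 1 / c" for z using c[of z, symmetric] by simp
    obtain z1 where z1: "f z1 = of_real (R + 1)" using big[of "R + 1"] by auto
    obtain z2 where z2: "f z2 = of_real (R + 2)" using big[of "R + 2"] by auto
    have "(of_real (R + 1) :: complex) = of_real (R + 2)"
      using z1 z2 val[of z1] val[of z2] by (simp only:)
    then show False by (simp only: of_real_eq_iff)
  qed
  obtain u where u: "u \<in> U" using big[of "R + 1"] by auto
  have unb: "\<exists>v\<in>U. r < cmod v" for r
  proof (rule ccontr)
    assume "\<not> ?thesis"
    then have sub: "U \<subseteq> cball 0 r" by (auto simp: not_less)
    have "bounded (f ` cball 0 r)"
      by (intro compact_imp_bounded compact_continuous_image holomorphic_on_imp_continuous_on
          holomorphic_on_subset[OF f]) auto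
    then obtain B where B: "\<And>z. z \<in> cball 0 r \<Longrightarrow> cmod (f z) \<le> B" unfolding bounded_iff by blast
    have "\<exists>v\<in>U. f v = of_real (max B R + 1)" by (rule big) simp
    then obtain v where v: "v \<in> U" "f v = of_real (max B R + 1)" by blast
    then have "cmod (f v) \<le> B" using B sub by blast
    moreover have "cmod (f v) = max B R + 1" unfolding v(2) norm_of_real using R by simp
    ultimately show False by linarith
  qed
  show thesis
  proof (rule that[OF R, of "max (cmod p + 1) (cmod u)"])
    fix r assume r: "max (cmod p + 1) (cmod u) \<le> r"
    show "\<exists>z. cmod z = r \<and> cmod (f z) \<le> R"
    proof (rule ccontr)
      assume no: "\<not> ?thesis"
      have rp: "r > 0" using r norm_ge_zero[of p] by linarith
      obtain v where v: "v \<in> U" "r < cmod v" using unb by blast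
      have "connected U" using U by (rule in_components_connected)
      then have "connected (cmod ` U)" by (intro connected_continuous_image continuous_intros)
      then have "r \<in> cmod ` U"
        using connectedD_interval[of "cmod ` U" "cmod u" "cmod v" r] u v r by auto
      then obtain x where x: "x \<in> U" "cmod x = r" by auto
      have "sphere 0 r \<subseteq> U"
      proof (rule components_maximal[OF U])
        show "connected (sphere (0::complex) r)" by (intro connected_sphere) simp
        show "sphere 0 r \<subseteq> {z. R < cmod (f z)}" using no by (auto simp: not_le[symmetric])
        show "U \<inter> sphere 0 r \<noteq> {}" using x by auto
      qed
      moreover have "p \<notin> U" using in_components_subset[OF U] p by auto
      ultimately have "winding_number (circlepath 0 r) p = 0"
        using rp by (intro simply_connected_imp_winding_number_zero[OF sc]) auto
      moreover have "winding_number (circlepath 0 r) p = 1"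
        using r by (intro winding_number_circlepath) auto
      ultimately show False by simp
    qed
  qed
qed

lemma max_modulus_upper:
  assumes f: "f holomorphic_on UNIV" and z: "cmod z = r"
  shows "cmod (f z) \<le> max_modulus r f"
proof -
  have "compact ((\<lambda>z. cmod (f z)) ` sphere 0 r)"
    by (intro compact_continuous_image continuous_on_norm holomorphic_on_imp_continuous_on
        holomorphic_on_subset[OF f]) auto
  then have "bdd_above ((\<lambda>z. cmod (f z)) ` sphere 0 r)" by (intro bounded_imp_bdd_above compact_imp_bounded)
  then show ?thesis unfolding max_modulus_def by (intro cSUP_upper) (use z in auto)
qed

lemma max_modulus_attained:
  assumes f: "f holomorphic_on UNIV" and r: "0 \<le> r"
  obtains z where "cmod z = r" "cmod (f z) = max_modulus r f"
proof -
  have "sphere (0::complex) r \<noteq> {}" using r by (simp add: sphere_eq_empty)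
  moreover have "continuous_on (sphere 0 r) (\<lambda>z. cmod (f z))"
    by (intro continuous_on_norm holomorphic_on_imp_continuous_on holomorphic_on_subset[OF f]) auto
  ultimately obtain z where z: "z \<in> sphere 0 r" "\<And>y. y \<in> sphere 0 r \<Longrightarrow> cmod (f y) \<le> cmod (f z)"
    using continuous_attains_sup[OF compact_sphere] by blast
  have "max_modulus r f \<le> cmod (f z)"
    unfolding max_modulus_def using z by (intro cSUP_least) auto
  then show thesis using max_modulus_upper[OF f, of z r] z by (intro that[of z]) auto
qed

lemma max_modulus_mono:
  assumes f: "f holomorphic_on UNIV" and r: "0 \<le> r" "r \<le> s"
  shows "max_modulus r f \<le> max_modulus s f"
proof -
  obtain z where z: "cmod z = r" "cmod (f z) = max_modulus r f" using max_modulus_attained[OF f r(1)] .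
  have "cmod (f z) \<le> max_modulus s f"
  proof (rule maximum_modulus_frontier[where S = "cball 0 s" and f = f and B = "max_modulus s f" and \<xi> = z])
    show "f holomorphic_on interior (cball 0 s)" by (rule holomorphic_on_subset[OF f]) auto
    show "continuous_on (closure (cball 0 s)) f"
      by (rule holomorphic_on_imp_continuous_on, rule holomorphic_on_subset[OF f]) auto
    show "cmod (f w) \<le> max_modulus s f" if "w \<in> frontier (cball 0 s)" for w
      using that by (intro max_modulus_upper[OF f]) (simp add: frontier_cball)
  qed (use z r in auto)
  then show ?thesis using z by simp
qed

text \<open>
  Lower bounds along a sequence of radii would not suffice for orbits with prescribed \<open>r\<^sub>k\<close>, so the bound is stated
  for all large \<open>r\<close>. If it fails for arbitrarily large \<open>r\<close>, then the Cauchy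
  estimates at these radii show that the Taylor coefficients of order greater than \<open>K\<close> vanish.
\<close>
lemma max_modulus_superpolynomial:
  assumes "transcendental_entire f"
  shows "eventually (\<lambda>r. r ^ K \<le> max_modulus r f) at_top"
proof (rule ccontr)
  assume neg: "\<not> ?thesis"
  have f: "f holomorphic_on UNIV" using assms by (simp add: transcendental_entire_def)
  have freq: "\<exists>r\<ge>X. max_modulus r f < r ^ K" for X
    using neg unfolding eventually_at_top_linorder by (meson not_le)
  have zero: "(deriv ^^ k) f 0 = 0" if k: "K < k" for k
  proof (rule ccontr)
    assume nz: "(deriv ^^ k) f 0 \<noteq> 0"
    define c where "c = cmod ((deriv ^^ k) f 0)"
    have c: "c > 0" using nz by (simp add: c_def)
    obtain r where r: "r \<ge> max 1 (2 * fact k / c)" "max_modulus r f < r ^ K" using freq by blast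
    have r1: "r \<ge> 1" "r > 0" using r(1) by auto
    have "c \<le> fact k * r ^ K / r ^ k" unfolding c_def
    proof (rule Cauchy_inequality)
      show "cmod (f x) \<le> r ^ K" if "cmod (0 - x) = r" for x
        using max_modulus_upper[OF f, of x r] that r(2) by simp
    qed (use r1 in \<open>auto intro!: holomorphic_on_subset[OF f] holomorphic_on_imp_continuous_on\<close>)
    also have "\<dots> \<le> fact k / r"
    proof -
      have "r ^ K * r \<le> r ^ k" using power_increasing[of "Suc K" k r] k r1 by (simp add: mult.commute)
      then show ?thesis using r1 by (simp add: field_simps)
    qed
    finally have "c * r \<le> fact k" using r1 by (simp add: field_simps)
    moreover have "2 * fact k \<le> c * r" using r(1) c by (simp add: field_simps)
    ultimately have "(fact k :: real) \<le> 0" by linarith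
    then show False using fact_gt_zero[of k, where 'a = real] by linarith
  qed
  define p where "p = (\<Sum>k\<le>K. monom ((deriv ^^ k) f 0 / fact k) k)"
  have "f z = poly p z" for z
  proof -
    have "(\<lambda>n. (deriv ^^ n) f 0 / fact n * (z - 0) ^ n) sums f z"
      by (rule holomorphic_power_series[of f 0 "cmod z + 1"]) (auto intro: holomorphic_on_subset[OF f])
    moreover have "(\<lambda>n. (deriv ^^ n) f 0 / fact n * (z - 0) ^ n) sums (\<Sum>n\<le>K. (deriv ^^ n) f 0 / fact n * (z - 0) ^ n)"
      by (rule sums_finite) (use zero in auto)
    ultimately have "f z = (\<Sum>n\<le>K. (deriv ^^ n) f 0 / fact n * (z - 0) ^ n)" by (rule sums_unique2)
    then show ?thesis by (simp add: p_def poly_sum poly_monom)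
  qed
  then show False using assms by (auto simp: transcendental_entire_def)
qed

section \<open>One expanding step\<close>

text \<open>
  The five zones of scale \<open>r\<close> are those with \<open>j < 5\<close>. The factor 8 makes them disjoint, although each of them extends
  by a factor 2 to both sides of its central circle.
\<close>
definition zone :: "real \<Rightarrow> nat \<Rightarrow> complex set" where
  "zone r j = {z. 8 ^ j * r / 2 \<le> cmod z \<and> cmod z \<le> 2 * 8 ^ j * r}"

lemma compact_zone: "compact (zone r j)"
proof -
  have "closed {z. 8 ^ j * r / 2 \<le> cmod z}" "closed {z. cmod z \<le> 2 * 8 ^ j * r}"
    by (intro closed_Collect_le continuous_intros)+
  then have "closed (zone r j)" by (auto simp: zone_def Collect_conj_eq)
  moreover have "bounded (zone r j)" by (auto simp: bounded_iff zone_def)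
  ultimately show ?thesis by (simp add: compact_eq_bounded_closed)
qed

lemma zone_disjoint:
  assumes "i < j" "0 < r"
  shows "zone r i \<inter> zone r j = {}"
proof -
  have "(8::real) ^ Suc i \<le> 8 ^ j" using assms by (intro power_increasing) auto
  then have "8 * 8 ^ i * r \<le> 8 ^ j * r" using assms by simp
  moreover have "0 < 8 ^ i * r" using assms by simp
  ultimately show ?thesis by (auto simp: zone_def)
qed

lemma zone_divide:
  assumes "0 < s" "w \<in> zone s j"
  shows "w / of_real s \<in> zone 1 j"
  using assms by (simp add: zone_def norm_divide field_simps)

text \<open>
  On the circle of radius \<open>q = 8\<^sup>j r\<close> the function \<open>f/s\<close> takes a value of modulus at most 1 and one of modulus at
  least \<open>M(r)/s \<ge> M(r)\<^sup>1\<^sup>/\<^sup>2\<close>. So the level set \<open>{|f| = s}\<close> has a point \<open>\<zeta>\<close> near this circle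
  where \<open>|f'|\<close> exceeds a multiple of \<open>s log M(r) / q\<close>. A disc around \<open>\<zeta>\<close> whose radius \<open>\<rho>\<close> is a multiple of
  \<open>q / log M(r)\<close> is then large enough for \<open>lappan_five_values\<close>, applied to \<open>f/s\<close> in that disc.
\<close>
lemma expanding_step:
  assumes te: "transcendental_entire f" and sing: "has_log_singularity_over_infinity f"
  obtains K r0 where "1 \<le> K" "1 \<le> r0"
    "\<And>r s j w. \<lbrakk>r0 \<le> r; r0 \<le> s; ln s \<le> ln (max_modulus r f) / 2; j < 5; \<And>i. i < 5 \<Longrightarrow> w i \<in> zone s i\<rbrakk>
       \<Longrightarrow> \<exists>i<5. \<exists>z\<in>zone r j. f z = w i \<and> s / r * (ln (max_modulus r f) / K) \<le> cmod (deriv f z)"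
proof -
  have f: "f holomorphic_on UNIV" using te by (simp add: transcendental_entire_def)
  obtain R r1 where R: "0 < R" and circ: "\<And>r. r1 \<le> r \<Longrightarrow> \<exists>z. cmod z = r \<and> cmod (f z) \<le> R"
    by (rule circles_meet_sublevel[OF f sing]) (rule that; blast)
  have "\<exists>C>0. \<forall>h a. h holomorphic_on UNIV \<and> (\<forall>i<5. a i \<in> zone 1 i) \<and> C * (1 + (cmod (h 0))\<^sup>2) \<le> cmod (deriv h 0)
      \<longrightarrow> (\<exists>i<5. \<exists>x. cmod x < 1 \<and> h x = a i \<and> 1 \<le> cmod (deriv h x))"
  proof (rule lappan_five_values)
    show "zone 1 i \<inter> zone 1 j = {}" if "i \<noteq> j" for i j
      using zone_disjoint[of i j 1] zone_disjoint[of j i 1] that by (cases "i < j") auto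
  qed (rule compact_zone)
  then obtain C where C: "C > 0" and lappan': "\<forall>h a. h holomorphic_on UNIV \<and> (\<forall>i<5. a i \<in> zone 1 i) \<and>
      C * (1 + (cmod (h 0))\<^sup>2) \<le> cmod (deriv h 0)
      \<longrightarrow> (\<exists>i<5. \<exists>x. cmod x < 1 \<and> h x = a i \<and> 1 \<le> cmod (deriv h x))"
    by (elim exE conjE)
  have lappan: "\<exists>i<5. \<exists>x. cmod x < 1 \<and> h x = a i \<and> 1 \<le> cmod (deriv h x)"
    if "h holomorphic_on UNIV" "\<And>i. i < 5 \<Longrightarrow> a i \<in> zone 1 i" "C * (1 + (cmod (h 0))\<^sup>2) \<le> cmod (deriv h 0)" for h a
    by (rule lappan'[rule_format]) (use that in simp)
  define Q where "Q = (3 :: real) ^ 102"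
  have Q: "Q \<ge> 1" by (simp add: Q_def)
  define L0 where "L0 = max 1 (32 * C * Q)"
  obtain r2 where r2: "\<And>r. r2 \<le> r \<Longrightarrow> r \<le> max_modulus r f"
    using max_modulus_superpolynomial[OF te, of 1] by (auto simp: eventually_at_top_linorder)
  define r0 where "r0 = Max {1, R, r1, r2, exp L0}"
  have r0: "1 \<le> r0" "R \<le> r0" "r1 \<le> r0" "r2 \<le> r0" "exp L0 \<le> r0"
    unfolding r0_def by (intro Max_ge; simp)+
  define K where "K = max 1 (8 ^ 5 * C * Q)"
  show thesis
  proof (rule that[of K r0])
    show "1 \<le> K" "1 \<le> r0" using r0 by (auto simp: K_def)
    fix r s :: real and j :: nat and w :: "nat \<Rightarrow> complex"
    assume r: "r0 \<le> r" and s: "r0 \<le> s" "ln s \<le> ln (max_modulus r f) / 2" and j: "j < 5"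
      and w: "\<And>i. i < 5 \<Longrightarrow> w i \<in> zone s i"
    define M where "M = max_modulus r f"
    have s0: "s > 0" "s \<ge> 1" and rp: "r > 0" using r s r0 by auto
    have "exp L0 \<le> M" using r2[of r] r r0 by (simp add: M_def)
    then have Mp: "M > 0" by (rule less_le_trans[OF exp_gt_zero])
    then have LM: "L0 \<le> ln M" using \<open>exp L0 \<le> M\<close> by (subst ln_ge_iff) auto
    then have lnM: "1 \<le> ln M" "32 * C * Q \<le> ln M" by (auto simp: L0_def)
    define q where "q = 8 ^ j * r"
    have q: "r \<le> q" "q \<le> 8 ^ 4 * r" "q > 0"
    proof -
      have "(8::real) ^ j \<le> 8 ^ 4" using j by (intro power_increasing) auto
      then show "q \<le> 8 ^ 4 * r" unfolding q_def using rp by (intro mult_right_mono) auto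
      have "(1::real) \<le> 8 ^ j" by simp
      then show "r \<le> q" unfolding q_def using rp by simp
      then show "q > 0" using rp by simp
    qed
    \<comment> \<open>Four times smaller than what growth up to M(r) requires; since ln s uses up at most half of ln M,
       this leaves a contradiction.\<close>
    define T where "T = ln M / (4 * Q * q)"
    have T: "T > 0" using lnM Q q by (simp add: T_def)
    have "\<exists>\<zeta>. 3/4 * q \<le> cmod \<zeta> \<and> cmod \<zeta> \<le> 5/4 * q \<and> cmod (f \<zeta>) = s \<and> s * T \<le> cmod (deriv f \<zeta>)"
    proof (rule ccontr)
      assume no: "\<not> ?thesis"
      define F where "F = (\<lambda>z. f z / of_real s)"
      have F: "F holomorphic_on UNIV" unfolding F_def using s0 by (intro holomorphic_intros f) auto
      have dF: "deriv F z = deriv f z / of_real s" for z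
      proof -
        have "(F has_field_derivative deriv f z / of_real s) (at z)"
          unfolding F_def by (rule DERIV_cdivide[OF holomorphic_derivI[OF f]]) auto
        then show ?thesis by (rule DERIV_imp_deriv)
      qed
      obtain e where e: "cmod e = q" "cmod (f e) \<le> R" using circ[of q] q r r0 by auto
      obtain z where z: "cmod z = q" "cmod (f z) = max_modulus q f"
        using max_modulus_attained[OF f, of q] q by auto
      have "cmod (F z) \<le> exp (3 ^ 102 * (T * q))"
      proof (rule growth_on_circle_le_level_derivative[OF F q(3) e(1) _ _ _ z(1)])
        show "cmod (F e) \<le> 1" using e(2) s0 s(1) r0 by (simp add: F_def norm_divide)
        show "0 \<le> T" using T by simp
        show "cmod (deriv F \<zeta>) \<le> T" if "3/4 * q \<le> cmod \<zeta>" "cmod \<zeta> \<le> 5/4 * q" "cmod (F \<zeta>) = 1" for \<zeta>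
        proof -
          have "cmod (f \<zeta>) = s" using that(3) s0 by (simp add: F_def norm_divide)
          then have "\<not> s * T \<le> cmod (deriv f \<zeta>)" using no that(1,2) by blast
          then show ?thesis using s0 by (simp add: dF norm_divide field_simps)
        qed
      qed
      also have "3 ^ 102 * (T * q) = ln M / 4" unfolding T_def Q_def[symmetric] using Q q by simp
      finally have "cmod (f z) \<le> s * exp (ln M / 4)" using s0 by (simp add: F_def norm_divide field_simps)
      moreover have "M \<le> cmod (f z)" unfolding z(2) M_def using max_modulus_mono[OF f _ q(1)] rp by simp
      moreover have "s * exp (ln M / 4) \<le> exp (ln M / 2) * exp (ln M / 4)"
      proof (rule mult_right_mono)
        have "exp (ln s) \<le> exp (ln M / 2)" using s(2) by (simp add: M_def)
        then show "s \<le> exp (ln M / 2)" using s0 by simp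
      qed simp
      ultimately have "M \<le> exp (ln M / 2) * exp (ln M / 4)" by linarith
      also have "\<dots> = exp (3/4 * ln M)" by (simp flip: exp_add)
      finally have "exp (ln M) \<le> exp (3/4 * ln M)" using Mp by simp
      then have "ln M \<le> 3/4 * ln M" by (simp only: exp_le_cancel_iff)
      then show False using lnM(1) by linarith
    qed
    then obtain \<zeta> where \<zeta>: "3/4 * q \<le> cmod \<zeta>" "cmod \<zeta> \<le> 5/4 * q" "cmod (f \<zeta>) = s" "s * T \<le> cmod (deriv f \<zeta>)"
      by blast
    define \<rho> where "\<rho> = 2 * C / T"
    have \<rho>: "\<rho> > 0" using C T by (simp add: \<rho>_def)
    have \<rho>eq: "\<rho> = 8 * C * Q * q / ln M" using lnM by (simp add: \<rho>_def T_def)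
    have \<rho>le: "\<rho> \<le> q / 4"
    proof -
      have "32 * C * Q * q \<le> ln M * q" using lnM(2) q by (intro mult_right_mono) auto
      then show ?thesis using lnM(1) by (simp add: \<rho>eq field_simps)
    qed
    define h where "h = (\<lambda>x. f (\<zeta> + of_real \<rho> * x) / of_real s)"
    have "(\<lambda>x. f (\<zeta> + of_real \<rho> * x)) holomorphic_on UNIV"
      by (rule holomorphic_on_compose_gen[OF _ f, unfolded o_def]) (auto intro!: holomorphic_intros)
    then have hh: "h holomorphic_on UNIV" unfolding h_def using s0
      by (intro holomorphic_on_divide holomorphic_on_const) auto
    have dh: "deriv h x = of_real (\<rho> / s) * deriv f (\<zeta> + of_real \<rho> * x)" for x
    proof -
      have "((\<lambda>x. \<zeta> + of_real \<rho> * x) has_field_derivative of_real \<rho>) (at x)"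
        by (rule derivative_eq_intros refl | simp)+
      then have "((\<lambda>x. f (\<zeta> + of_real \<rho> * x)) has_field_derivative deriv f (\<zeta> + of_real \<rho> * x) * of_real \<rho>) (at x)"
        by (rule DERIV_chain2[OF holomorphic_derivI[OF f open_UNIV UNIV_I]])
      then have "(h has_field_derivative deriv f (\<zeta> + of_real \<rho> * x) * of_real \<rho> / of_real s) (at x)"
        unfolding h_def by (rule DERIV_cdivide)
      from DERIV_imp_deriv[OF this] show ?thesis by simp
    qed
    have "\<exists>i<5. \<exists>x. cmod x < 1 \<and> h x = w i / of_real s \<and> 1 \<le> cmod (deriv h x)"
    proof (rule lappan[OF hh])
      show "w i / of_real s \<in> zone 1 i" if "i < 5" for i using zone_divide[OF s0(1) w[OF that]] .
      have "cmod (h 0) = 1" using \<zeta>(3) s0 by (simp add: h_def norm_divide)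
      moreover have "2 * C \<le> cmod (deriv h 0)"
      proof -
        have "2 * C = \<rho> / s * (s * T)" using s0 T by (simp add: \<rho>_def)
        also have "\<dots> \<le> \<rho> / s * cmod (deriv f \<zeta>)" using \<zeta>(4) \<rho> s0 by (intro mult_left_mono) auto
        also have "\<dots> = cmod (deriv h 0)" using \<rho> s0 by (simp add: dh norm_mult norm_divide)
        finally show ?thesis .
      qed
      ultimately show "C * (1 + (cmod (h 0))\<^sup>2) \<le> cmod (deriv h 0)" by simp
    qed
    then obtain i x where ix: "i < 5" "cmod x < 1" "h x = w i / of_real s" "1 \<le> cmod (deriv h x)" by blast
    define z where "z = \<zeta> + of_real \<rho> * x"
    have fz: "f z = w i" using ix(3) s0 by (simp add: h_def z_def)
    have "cmod (z - \<zeta>) \<le> q / 4"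
    proof -
      have "cmod (z - \<zeta>) = \<rho> * cmod x" using \<rho> by (simp add: z_def norm_mult)
      also have "\<dots> \<le> \<rho> * 1" using \<rho> ix(2) by (intro mult_left_mono) auto
      finally show ?thesis using \<rho>le by simp
    qed
    then have "\<bar>cmod z - cmod \<zeta>\<bar> \<le> q / 4" using norm_triangle_ineq3[of z \<zeta>] by linarith
    then have "q / 2 \<le> cmod z" "cmod z \<le> 2 * q" using \<zeta>(1,2) q(3) by linarith+
    then have zz: "z \<in> zone r j" by (simp add: zone_def q_def mult.assoc)
    have "s / r * (ln M / K) \<le> cmod (deriv f z)"
    proof -
      have "8 * C * Q * q \<le> 8 * C * Q * (8 ^ 4 * r)" using q(2) C Q by (intro mult_left_mono) auto
      also have "\<dots> = (8 ^ 5 * C * Q) * r" by simp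
      also have "\<dots> \<le> K * r" using rp by (intro mult_right_mono) (auto simp: K_def)
      finally have "\<rho> \<le> K * r / ln M" unfolding \<rho>eq using lnM(1) by (intro divide_right_mono) auto
      moreover have "K > 0" by (simp add: K_def)
      ultimately have "s / (K * r / ln M) \<le> s / \<rho>"
        using s0 \<rho> rp lnM by (intro divide_left_mono mult_pos_pos divide_pos_pos) auto
      also have "\<dots> \<le> cmod (deriv f z)"
      proof -
        have "deriv h x = of_real (\<rho> / s) * deriv f z" by (simp add: dh z_def)
        then have "1 \<le> \<rho> / s * cmod (deriv f z)" using ix(4) \<rho> s0 by (simp add: norm_mult norm_divide)
        then show ?thesis using \<rho> s0 by (simp add: field_simps)
      qed
      finally show ?thesis by (simp add: mult.commute)
    qed
    then show "\<exists>i<5. \<exists>z\<in>zone r j. f z = w i \<and> s / r * (ln (max_modulus r f) / K) \<le> cmod (deriv f z)"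
      using ix(1) zz fz unfolding M_def by (intro exI[of _ i] conjI bexI[of _ z])
  qed
qed

section \<open>Expanding orbits\<close>

lemma holomorphic_funpow:
  assumes "f holomorphic_on UNIV"
  shows "(f ^^ n) holomorphic_on UNIV"
proof (induction n)
  case 0
  show ?case by (simp add: id_def)
next
  case (Suc n)
  show ?case unfolding funpow.simps by (rule holomorphic_on_compose_gen[OF Suc assms]) auto
qed

lemma deriv_funpow_add:
  assumes f: "f holomorphic_on UNIV"
  shows "deriv (f ^^ (m + n)) z = deriv (f ^^ m) ((f ^^ n) z) * deriv (f ^^ n) z"
proof -
  have "(((f ^^ m) \<circ> (f ^^ n)) has_field_derivative deriv (f ^^ m) ((f ^^ n) z) * deriv (f ^^ n) z) (at z)"
    by (intro DERIV_chain holomorphic_derivI[OF holomorphic_funpow[OF f] open_UNIV UNIV_I])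
  then show ?thesis unfolding funpow_add by (rule DERIV_imp_deriv)
qed

lemma deriv_funpow_prod:
  assumes f: "f holomorphic_on UNIV"
  shows "deriv (f ^^ n) z = (\<Prod>k<n. deriv f ((f ^^ k) z))"
proof (induction n)
  case 0
  show ?case by (simp add: id_def)
next
  case (Suc n)
  have "f ^^ 1 = f" by (simp add: fun_eq_iff)
  then have "deriv (f ^^ Suc n) z = deriv f ((f ^^ n) z) * deriv (f ^^ n) z"
    using deriv_funpow_add[OF f, of 1 n z] unfolding plus_1_eq_Suc by simp
  then show ?case using Suc by (simp add: mult.commute del: funpow.simps)
qed

text \<open>
  Backwards construction: the orbit of length \<open>n\<close> starting at level \<open>k + 1\<close> is chosen in each of the \<open>q\<close>
  sets before the step from level \<open>k\<close> selects one of them. This is why every level needs several candidates.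
\<close>
lemma expanding_orbit_finite:
  fixes Z :: "nat \<Rightarrow> nat \<Rightarrow> complex set"
  assumes step: "\<And>k j w. \<lbrakk>j < q; \<And>i. i < q \<Longrightarrow> w i \<in> Z (Suc k) i\<rbrakk>
      \<Longrightarrow> \<exists>i<q. \<exists>z\<in>Z k j. f z = w i \<and> \<mu> k \<le> cmod (deriv f z)"
    and ne: "\<And>k j. j < q \<Longrightarrow> Z k j \<noteq> {}" and j: "j < q"
  shows "\<exists>z\<in>Z k j. (\<forall>m\<le>n. (f ^^ m) z \<in> (\<Union>i<q. Z (k + m) i)) \<and> (\<forall>m<n. \<mu> (k + m) \<le> cmod (deriv f ((f ^^ m) z)))"
  using j
proof (induction n arbitrary: k j)
  case 0
  then show ?case using ne[of j k] by auto
next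
  case (Suc n)
  define good where "good = (\<lambda>z. (\<forall>m\<le>n. (f ^^ m) z \<in> (\<Union>i<q. Z (Suc k + m) i))
      \<and> (\<forall>m<n. \<mu> (Suc k + m) \<le> cmod (deriv f ((f ^^ m) z))))"
  have "\<forall>i. \<exists>w. i < q \<longrightarrow> w \<in> Z (Suc k) i \<and> good w"
    using Suc.IH[of _ "Suc k"] unfolding good_def by blast
  from choice[OF this] obtain w where w: "\<And>i. i < q \<Longrightarrow> w i \<in> Z (Suc k) i" "\<And>i. i < q \<Longrightarrow> good (w i)" by blast
  obtain i z where z: "i < q" "z \<in> Z k j" "f z = w i" "\<mu> k \<le> cmod (deriv f z)"
    using step[OF Suc.prems w(1)] by blast
  have g: "good (f z)" using w(2)[OF z(1)] z(3) by simp
  show ?case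
  proof (intro bexI[OF _ z(2)] conjI allI impI)
    fix m assume m: "m \<le> Suc n"
    show "(f ^^ m) z \<in> (\<Union>i<q. Z (k + m) i)"
    proof (cases m)
      case 0
      then show ?thesis using z(2) Suc.prems by auto
    next
      case (Suc m')
      then have "(f ^^ m') (f z) \<in> (\<Union>i<q. Z (Suc k + m') i)" using g m unfolding good_def by simp
      then show ?thesis using Suc by (simp add: funpow_swap1)
    qed
  next
    fix m assume m: "m < Suc n"
    show "\<mu> (k + m) \<le> cmod (deriv f ((f ^^ m) z))"
    proof (cases m)
      case 0
      then show ?thesis using z(4) by simp
    next
      case (Suc m')
      then have "\<mu> (Suc k + m') \<le> cmod (deriv f ((f ^^ m') (f z)))" using g m unfolding good_def by simp
      then show ?thesis using Suc by (simp add: funpow_swap1)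
    qed
  qed
qed

text \<open>
  The points with a good orbit of length \<open>n\<close> form a decreasing sequence of nonempty compact sets.
\<close>
lemma expanding_orbit:
  fixes Z :: "nat \<Rightarrow> nat \<Rightarrow> complex set"
  assumes f: "f holomorphic_on UNIV"
    and step: "\<And>k j w. \<lbrakk>j < q; \<And>i. i < q \<Longrightarrow> w i \<in> Z (Suc k) i\<rbrakk>
      \<Longrightarrow> \<exists>i<q. \<exists>z\<in>Z k j. f z = w i \<and> \<mu> k \<le> cmod (deriv f z)"
    and ne: "\<And>k j. j < q \<Longrightarrow> Z k j \<noteq> {}" and comp: "\<And>k j. j < q \<Longrightarrow> compact (Z k j)" and j: "j < q"
  shows "\<exists>z\<in>Z 0 j. \<forall>k. (f ^^ k) z \<in> (\<Union>i<q. Z k i) \<and> \<mu> k \<le> cmod (deriv f ((f ^^ k) z))"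
proof -
  define A where "A = (\<lambda>m. {z. (f ^^ m) z \<in> (\<Union>i<q. Z m i)})"
  define B where "B = (\<lambda>m. {z. \<mu> m \<le> cmod (deriv f ((f ^^ m) z))})"
  have contf: "continuous_on UNIV (f ^^ m)" for m
    by (intro holomorphic_on_imp_continuous_on holomorphic_funpow f)
  have clA: "closed (A m)" for m
  proof -
    have "closed (\<Union>i<q. Z m i)" by (intro closed_UN finite_lessThan compact_imp_closed comp ballI) auto
    then have "closed ((f ^^ m) -` (\<Union>i<q. Z m i))" by (intro closed_vimage contf)
    moreover have "A m = (f ^^ m) -` (\<Union>i<q. Z m i)" by (auto simp: A_def)
    ultimately show ?thesis by simp
  qed
  have clB: "closed (B m)" for m
  proof -
    have "continuous_on UNIV (\<lambda>z. deriv f ((f ^^ m) z))"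
      by (rule continuous_on_compose2[OF holomorphic_on_imp_continuous_on[OF holomorphic_deriv[OF f open_UNIV]] contf]) auto
    then show ?thesis unfolding B_def by (intro closed_Collect_le continuous_on_const continuous_on_norm)
  qed
  define E where "E = (\<lambda>n. Z 0 j \<inter> ((\<Inter>m\<in>{..n}. A m) \<inter> (\<Inter>m\<in>{..<n}. B m)))"
  have "\<Inter>(range E) \<noteq> {}"
  proof (rule compact_nest)
    show "compact (E n)" for n
      unfolding E_def by (intro compact_Int_closed comp j closed_Int closed_INT ballI clA clB)
    show "E n \<noteq> {}" for n
    proof -
      have "\<exists>z\<in>Z 0 j. (\<forall>m\<le>n. (f ^^ m) z \<in> (\<Union>i<q. Z (0 + m) i)) \<and> (\<forall>m<n. \<mu> (0 + m) \<le> cmod (deriv f ((f ^^ m) z)))"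
        by (rule expanding_orbit_finite[OF step ne j])
      then obtain z where "z \<in> Z 0 j" "\<forall>m\<le>n. (f ^^ m) z \<in> (\<Union>i<q. Z m i)" "\<forall>m<n. \<mu> m \<le> cmod (deriv f ((f ^^ m) z))"
        unfolding add_0 by blast
      then have "z \<in> E n" by (simp add: E_def A_def B_def)
      then show ?thesis by blast
    qed
    show "E n \<subseteq> E m" if "m \<le> n" for m n
      unfolding E_def by (intro Int_mono INT_anti_mono subset_refl) (use that in auto)
  qed
  then obtain z where z: "\<And>n. z \<in> E n" by auto
  show ?thesis
  proof (intro bexI[of _ z] allI conjI)
    show "z \<in> Z 0 j" using z[of 0] by (simp add: E_def)
    fix k
    have "z \<in> A k" "z \<in> B k" using z[of "Suc k"] by (auto simp: E_def)
    then show "(f ^^ k) z \<in> (\<Union>i<q. Z k i)" "\<mu> k \<le> cmod (deriv f ((f ^^ k) z))"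
      by (auto simp: A_def B_def)
  qed
qed

section \<open>The sequence of radii\<close>

lemma lower_order_nonneg:
  assumes te: "transcendental_entire f"
  shows "0 \<le> lower_order f"
  unfolding lower_order_def
proof (rule Liminf_bounded)
  show "\<forall>\<^sub>F r in at_top. 0 \<le> ereal (ln (ln (max_modulus r f)) / ln r)"
    using max_modulus_superpolynomial[OF te, of 1] eventually_ge_at_top[of "exp 1"]
  proof eventually_elim
    case (elim r)
    have r: "1 < r" using elim(2) exp_ge_add_one_self[of 1] by linarith
    have "exp 1 \<le> max_modulus r f" using elim by simp
    then have "1 \<le> ln (max_modulus r f)" by (subst ln_ge_iff) (use exp_gt_zero[of "1::real"] in \<open>auto simp del: exp_gt_zero\<close>)
    then show ?case using r by simp
  qed
qed

text \<open>
  The radii \<open>e\<^sup>a\<^sup>n\<close> of the scales. The next logarithmic radius exhausts all but the fraction \<open>1/(n+2)\<close> of the available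
  expansion \<open>b(a\<^sub>n)\<close>. These fractions tend to 0, so they do not affect the exponential rate, but their sum diverges,
  so the total gain is infinite even when \<open>b(a\<^sub>n)\<close> grows slowly. In \<open>large\<close>, the first two bounds keep \<open>a\<^sub>n\<close> and
  \<open>b(a\<^sub>n)\<close> below a quarter of \<open>log M\<close> each, and the third one says that \<open>b \<ge> 1\<close>.
\<close>
locale radius_sequence =
  fixes f :: "complex \<Rightarrow> complex" and K a0 :: real and a :: "nat \<Rightarrow> real"
  assumes te: "transcendental_entire f" and K: "1 \<le> K"
    and a0: "1 \<le> a0" "a 0 = a0"
    and large: "\<And>x. a0 \<le> x \<Longrightarrow> 16 \<le> ln (max_modulus (exp x) f)
        \<and> 4 * x \<le> ln (max_modulus (exp x) f) \<and> K * exp 1 \<le> ln (max_modulus (exp x) f)"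
    and a_Suc: "\<And>n. a (Suc n) = a n + (1 - 1 / real (n + 2)) * ln (ln (max_modulus (exp (a n)) f) / K)"
begin

definition b :: "real \<Rightarrow> real" where
  "b x = ln (ln (max_modulus (exp x) f) / K)"

lemma a_rec: "a (Suc n) = a n + (1 - 1 / real (n + 2)) * b (a n)"
  unfolding b_def by (rule a_Suc)

lemma b_ge_1: "a0 \<le> x \<Longrightarrow> 1 \<le> b x"
proof -
  assume x: "a0 \<le> x"
  have "exp 1 \<le> ln (max_modulus (exp x) f) / K" using large[OF x] K by (simp add: field_simps)
  moreover have "0 < ln (max_modulus (exp x) f) / K" using large[OF x] K by (intro divide_pos_pos) auto
  ultimately show "1 \<le> b x" unfolding b_def by (subst ln_ge_iff) auto
qed

lemma a_lower: "a0 + real n / 2 \<le> a n"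
proof (induction n)
  case 0
  show ?case using a0 by simp
next
  case (Suc n)
  then have "1 \<le> b (a n)" by (intro b_ge_1) (smt (verit) divide_nonneg_nonneg of_nat_0_le_iff)
  moreover have "1/2 \<le> 1 - 1 / real (n + 2)" by (simp add: field_simps)
  ultimately have "1/2 * 1 \<le> (1 - 1 / real (n + 2)) * b (a n)" by (intro mult_mono) auto
  moreover have "a (Suc n) = a n + (1 - 1 / real (n + 2)) * b (a n)" by (rule a_rec)
  moreover have "real (Suc n) / 2 = real n / 2 + 1 / 2" by simp
  ultimately show ?case using Suc by linarith
qed

lemma a_ge: "a0 \<le> a n"
  using a_lower[of n] by (smt (verit) divide_nonneg_nonneg of_nat_0_le_iff)

text \<open>
  The condition on consecutive radii in \<open>expanding_step\<close>.
\<close>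
lemma admissible: "a (Suc n) \<le> ln (max_modulus (exp (a n)) f) / 2"
proof -
  define L where "L = ln (max_modulus (exp (a n)) f)"
  have L: "16 \<le> L" "4 * a n \<le> L" using large[OF a_ge[of n]] by (auto simp: L_def)
  have "b (a n) \<le> ln L"
    unfolding b_def L_def[symmetric] using K L(1) by (subst ln_le_cancel_iff) (auto simp: field_simps)
  also have "ln L = ln (L / 16) + ln 16" using L(1) by (simp add: ln_div)
  also have "\<dots> \<le> (L / 16 - 1) + 4"
  proof (rule add_mono)
    show "ln (L / 16) \<le> L / 16 - 1" using L(1) by (intro ln_le_minus_one) simp
    have "ln (16::real) = 4 * ln 2" using ln_realpow[of 2 4] by simp
    also have "\<dots> \<le> 4 * 1" using ln_le_minus_one[of 2] by simp
    finally show "ln (16::real) \<le> 4" by simp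
  qed
  also have "\<dots> \<le> L / 4" using L(1) by simp
  finally have "b (a n) \<le> L / 4" .
  moreover have "(1 - 1 / real (n + 2)) * b (a n) \<le> 1 * b (a n)"
    using b_ge_1[OF a_ge[of n]] by (intro mult_right_mono) auto
  ultimately show ?thesis using L(2) by (simp add: a_rec L_def[symmetric] del: of_nat_add)
qed

text \<open>
  The logarithm of the lower bound for \<open>(f\<^sup>n)\<^sup>#\<close>, up to a constant: what remains of the total expansion after
  division by the squared modulus of the \<open>n\<close>-th iterate.
\<close>
definition gain :: "nat \<Rightarrow> real" where
  "gain n = (\<Sum>k<n. b (a k) / real (k + 2))"

lemma sum_b: "(\<Sum>k<n. b (a k)) = a n - a0 + gain n"
  by (induction n) (simp_all add: gain_def a0 a_rec algebra_simps)

text \<open>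
  Comparison with the harmonic series.
\<close>
lemma gain_at_top: "filterlim gain at_top sequentially"
proof -
  have "harm (Suc n) - 1 \<le> gain n" for n
  proof -
    have "harm (Suc n) = 1 + (\<Sum>k<n. 1 / real (k + 2))"
      by (induction n) (simp_all add: harm_Suc inverse_eq_divide harm_def algebra_simps)
    moreover have "(\<Sum>k<n. 1 / real (k + 2)) \<le> gain n"
      unfolding gain_def by (intro sum_mono divide_right_mono b_ge_1 a_ge) auto
    ultimately show ?thesis by simp
  qed
  moreover have "filterlim (\<lambda>n. harm (Suc n) - 1 :: real) at_top sequentially"
  proof -
    have "filterlim (\<lambda>n. harm (Suc n) :: real) at_top sequentially"
      using filterlim_compose[OF harm_at_top filterlim_Suc] by (simp add: o_def)
    then show ?thesis
      using filterlim_tendsto_add_at_top[OF tendsto_const[of "-1"], of "\<lambda>n. harm (Suc n) :: real" sequentially]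
      by simp
  qed
  ultimately show ?thesis by (intro filterlim_at_top_mono[of _ sequentially gain]) (auto intro: always_eventually)
qed

text \<open>
  For \<open>\<mu> < \<mu>\<^sub>1 < \<mu>\<^sub>3 < \<lambda>\<close> the definition of the lower order gives \<open>b(x) \<ge> \<mu>\<^sub>3 x\<close> for large \<open>x\<close>, so eventually \<open>a\<close> grows by a
  factor of at least \<open>1 + \<mu>\<^sub>1\<close> in each step. The last summand of the gain alone is then at least a multiple of
  \<open>(1 + \<mu>\<^sub>1)\<^sup>n / n\<close>.
\<close>
lemma gain_exponential:
  assumes \<mu>: "0 < \<mu>" "ereal \<mu> < lower_order f"
  shows "eventually (\<lambda>n. A * (1 + \<mu>) ^ n \<le> gain n) sequentially"
proof -
  obtain \<mu>2 where \<mu>2: "\<mu> < \<mu>2" "ereal \<mu>2 < lower_order f"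
    using ereal_dense2[OF \<mu>(2)] by auto
  define \<mu>3 where "\<mu>3 = (\<mu> + \<mu>2) / 2"
  define \<mu>1 where "\<mu>1 = (\<mu> + \<mu>3) / 2"
  have ord: "\<mu> < \<mu>1" "\<mu>1 < \<mu>3" "\<mu>3 < \<mu>2" using \<mu>2(1) by (auto simp: \<mu>1_def \<mu>3_def)
  have at: "filterlim a at_top sequentially"
  proof (rule filterlim_at_top_mono)
    have "filterlim (\<lambda>n. real n * (1/2)) at_top sequentially"
      by (rule filterlim_at_top_mult_tendsto_pos[OF tendsto_const _ filterlim_real_sequentially]) simp
    then show "filterlim (\<lambda>n. real n / 2) at_top sequentially" by simp
    show "\<forall>\<^sub>F n in sequentially. real n / 2 \<le> a n"
    proof (rule always_eventually, rule allI)
      fix n show "real n / 2 \<le> a n" using a_lower[of n] a0 by linarith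
    qed
  qed
  have "\<forall>\<^sub>F r in at_top. ereal \<mu>2 < ereal (ln (ln (max_modulus r f)) / ln r)"
    using \<mu>2(2) unfolding lower_order_def by (rule less_LiminfD)
  then have "\<forall>\<^sub>F x in at_top. ereal \<mu>2 < ereal (ln (ln (max_modulus (exp x) f)) / ln (exp x))"
    using exp_at_top by (rule eventually_compose_filterlim)
  moreover have "\<forall>\<^sub>F x in at_top. max a0 (ln K / (\<mu>2 - \<mu>3)) \<le> x" by (rule eventually_ge_at_top)
  ultimately have "\<forall>\<^sub>F x in at_top. \<mu>3 * x \<le> b x"
  proof eventually_elim
    case (elim x)
    have x: "x > 0" "a0 \<le> x" using elim(2) a0 by auto
    have "\<mu>2 * x < ln (ln (max_modulus (exp x) f))" using elim(1) x by (simp add: field_simps)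
    moreover have "b x = ln (ln (max_modulus (exp x) f)) - ln K"
      unfolding b_def using large[OF x(2)] K by (subst ln_div) auto
    moreover have "ln K \<le> (\<mu>2 - \<mu>3) * x" using elim(2) ord by (simp add: field_simps)
    ultimately show ?case by (simp add: algebra_simps)
  qed
  then have "\<forall>\<^sub>F n in sequentially. \<mu>3 * a n \<le> b (a n)" using at by (rule eventually_compose_filterlim)
  moreover have "\<forall>\<^sub>F n in sequentially. \<mu>1 \<le> (1 - 1 / real (n + 2)) * \<mu>3"
  proof -
    have "(\<lambda>n. (1 - inverse (real (Suc (n + 1)))) * \<mu>3) \<longlonglongrightarrow> (1 - 0) * \<mu>3"
      by (intro tendsto_intros LIMSEQ_ignore_initial_segment[OF LIMSEQ_inverse_real_of_nat])
    then have "\<forall>\<^sub>F n in sequentially. \<mu>1 < (1 - inverse (real (Suc (n + 1)))) * \<mu>3"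
      by (rule order_tendstoD) (use ord in simp)
    then show ?thesis by eventually_elim (simp add: inverse_eq_divide)
  qed
  ultimately have "\<forall>\<^sub>F n in sequentially. \<mu>3 * a n \<le> b (a n) \<and> \<mu>1 \<le> (1 - 1 / real (n + 2)) * \<mu>3"
    by (rule eventually_conj)
  then obtain N where N: "\<And>n. N \<le> n \<Longrightarrow> \<mu>3 * a n \<le> b (a n)" "\<And>n. N \<le> n \<Longrightarrow> \<mu>1 \<le> (1 - 1 / real (n + 2)) * \<mu>3"
    unfolding eventually_sequentially by blast
  have grow: "(1 + \<mu>1) ^ m \<le> a (N + m)" for m
  proof (induction m)
    case 0
    show ?case using a_ge[of N] a0 by simp
  next
    case (Suc m)
    let ?n = "N + m"
    have an: "a ?n > 0" using a_ge[of ?n] a0 by linarith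
    have "\<mu>1 * a ?n \<le> (1 - 1 / real (?n + 2)) * \<mu>3 * a ?n"
      using N(2)[of ?n] an by (intro mult_right_mono) auto
    also have "\<dots> = (1 - 1 / real (?n + 2)) * (\<mu>3 * a ?n)" by simp
    also have "\<dots> \<le> (1 - 1 / real (?n + 2)) * b (a ?n)"
      using N(1)[of ?n] by (intro mult_left_mono) auto
    finally have "(1 + \<mu>1) * a ?n \<le> a (N + Suc m)" by (simp add: a_rec algebra_simps del: of_nat_add of_nat_Suc)
    moreover have "(1 + \<mu>1) * (1 + \<mu>1) ^ m \<le> (1 + \<mu>1) * a ?n"
      using Suc ord \<mu> by (intro mult_left_mono) auto
    ultimately show ?case by simp
  qed
  have gl: "\<mu>3 * (1 + \<mu>1) ^ m / real (N + m + 2) \<le> gain (Suc (N + m))" for m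
  proof -
    have "\<mu>3 * (1 + \<mu>1) ^ m \<le> \<mu>3 * a (N + m)" using grow[of m] ord \<mu> by (intro mult_left_mono) auto
    also have "\<dots> \<le> b (a (N + m))" by (rule N) simp
    finally have "\<mu>3 * (1 + \<mu>1) ^ m / real (N + m + 2) \<le> b (a (N + m)) / real (N + m + 2)"
      by (intro divide_right_mono) auto
    also have "\<dots> \<le> gain (Suc (N + m))"
    proof -
      have "0 \<le> gain (N + m)" unfolding gain_def
        by (intro sum_nonneg divide_nonneg_nonneg) (use b_ge_1[OF a_ge] in \<open>auto intro: order_trans[of 0 1]\<close>)
      then show ?thesis by (simp add: gain_def)
    qed
    finally show ?thesis .
  qed
  define y where "y = (1 + \<mu>) / (1 + \<mu>1)"
  have y: "0 < y" "y < 1" using ord \<mu> by (auto simp: y_def)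
  have "(\<lambda>m. A * (1 + \<mu>) ^ (N + 1) / \<mu>3 * (real m * y ^ m + real (N + 2) * y ^ m)) \<longlonglongrightarrow>
      A * (1 + \<mu>) ^ (N + 1) / \<mu>3 * (0 + real (N + 2) * 0)"
    by (intro tendsto_intros powser_times_n_limit_0 LIMSEQ_power_zero) (use y in auto)
  then have "\<forall>\<^sub>F m in sequentially. A * (1 + \<mu>) ^ (N + 1) / \<mu>3 * (real m * y ^ m + real (N + 2) * y ^ m) < 1"
    by (rule order_tendstoD) simp
  then obtain M where M: "\<And>m. M \<le> m \<Longrightarrow> A * (1 + \<mu>) ^ (N + 1) / \<mu>3 * (real m * y ^ m + real (N + 2) * y ^ m) < 1"
    unfolding eventually_sequentially by blast
  show ?thesis unfolding eventually_sequentially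
  proof (intro exI allI impI)
    fix n assume n: "Suc (N + M) \<le> n"
    define m where "m = n - Suc N"
    have nm: "n = Suc (N + m)" "M \<le> m" using n by (auto simp: m_def)
    have pos: "\<mu>3 > 0" "1 + \<mu>1 > 0" "real (N + m + 2) > 0" using ord \<mu> by auto
    have "A * (1 + \<mu>) ^ (N + 1) * (real (N + m + 2) * y ^ m) / \<mu>3 < 1"
    proof -
      have "real m * y ^ m + real (N + 2) * y ^ m = real (N + m + 2) * y ^ m" by (simp add: algebra_simps)
      then show ?thesis using M[OF nm(2)] by (simp del: of_nat_add power_Suc power_add)
    qed
    then have "A * (1 + \<mu>) ^ (N + 1) * (real (N + m + 2) * y ^ m) < \<mu>3" using pos by (simp add: field_simps)
    then have "A * (1 + \<mu>) ^ (N + 1) * real (N + m + 2) * (1 + \<mu>) ^ m < \<mu>3 * (1 + \<mu>1) ^ m"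
      using pos by (simp add: y_def power_divide field_simps)
    then have "A * ((1 + \<mu>) ^ (N + 1) * (1 + \<mu>) ^ m) * real (N + m + 2) \<le> \<mu>3 * (1 + \<mu>1) ^ m"
      by (simp add: mult_ac)
    then have "A * (1 + \<mu>) ^ n * real (N + m + 2) \<le> \<mu>3 * (1 + \<mu>1) ^ m"
      unfolding power_add[symmetric] nm(1) by simp
    then have "A * (1 + \<mu>) ^ n \<le> \<mu>3 * (1 + \<mu>1) ^ m / real (N + m + 2)"
      using pos(3) by (simp add: pos_le_divide_eq)
    also have "\<dots> \<le> gain n" unfolding nm(1) by (rule gl)
    finally show "A * (1 + \<mu>) ^ n \<le> gain n" .
  qed
qed

end

section \<open>The Julia set and the spherical derivative\<close>

text \<open>
  If \<open>F(v)\<close> is in the closed unit disc, then \<open>F\<close> is bounded by 2 near \<open>v\<close>; otherwise \<open>1/F\<close> is. In both cases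
  a Cauchy estimate applies, because the spherical derivatives of \<open>F\<close> and \<open>1/F\<close> agree.
\<close>
lemma spherical_deriv_le_of_close:
  assumes F: "F holomorphic_on UNIV" and \<delta>: "\<delta> > 0"
    and close: "\<And>y. y \<in> cball v \<delta> \<Longrightarrow> dist (stereo (F y)) (stereo (F v)) \<le> 1/2"
  shows "spherical_deriv F v \<le> 2 / \<delta>"
proof -
  have pos: "1 + (cmod (F y))\<^sup>2 > 0" for y by (simp add: add_pos_nonneg)
  have snd: "\<bar>2 / (1 + (cmod (F v))\<^sup>2) - 2 / (1 + (cmod (F y))\<^sup>2)\<bar> \<le> 1/2" if "y \<in> cball v \<delta>" for y
    using order_trans[OF dist_snd_le close[OF that]] by (simp add: snd_stereo dist_real_def)
  have contF: "continuous_on (cball v \<delta>) F" by (intro holomorphic_on_imp_continuous_on holomorphic_on_subset[OF F]) auto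
  show ?thesis
  proof (cases "cmod (F v) \<le> 1")
    case True
    then have "(cmod (F v))\<^sup>2 \<le> 1\<^sup>2" by (intro power_mono) auto
    then have "1 \<le> 2 / (1 + (cmod (F v))\<^sup>2)" using pos[of v] by (simp add: field_simps)
    have le2: "cmod (F y) \<le> 2" if "cmod (v - y) = \<delta>" for y
    proof -
      have "1/2 \<le> 2 / (1 + (cmod (F y))\<^sup>2)"
      proof -
        have "y \<in> cball v \<delta>" using that by (simp add: dist_norm)
        from snd[OF this] \<open>1 \<le> 2 / _\<close> show ?thesis by linarith
      qed
      then have "(cmod (F y))\<^sup>2 \<le> 2\<^sup>2" using pos[of y] by (simp add: field_simps)
      then show ?thesis by (rule power2_le_imp_le) simp
    qed
    have "cmod ((deriv ^^ 1) F v) \<le> fact 1 * 2 / \<delta> ^ 1"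
      by (rule Cauchy_inequality[OF holomorphic_on_subset[OF F] contF \<delta> le2]) auto
    moreover have "spherical_deriv F v \<le> cmod (deriv F v)"
      unfolding spherical_deriv_def using pos[of v] by (simp add: field_simps)
    ultimately show ?thesis by simp
  next
    case False
    then have "1\<^sup>2 \<le> (cmod (F v))\<^sup>2" by (intro power_mono) auto
    then have "2 / (1 + (cmod (F v))\<^sup>2) \<le> 1" using pos[of v] by (simp add: field_simps)
    have ge: "1/2 \<le> cmod (F y)" if "y \<in> cball v \<delta>" for y
    proof -
      have "2 / (1 + (cmod (F y))\<^sup>2) \<le> 3/2" using snd[OF that] \<open>2 / _ \<le> 1\<close> by linarith
      then have "(1/2)\<^sup>2 \<le> (cmod (F y))\<^sup>2" using pos[of y] by (simp add: field_simps)
      then show ?thesis by (rule power2_le_imp_le) simp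
    qed
    have nz: "F y \<noteq> 0" if "y \<in> cball v \<delta>" for y using ge[OF that] by auto
    define G where "G = (\<lambda>y. 1 / F y)"
    have hG: "G holomorphic_on cball v \<delta>" unfolding G_def
      by (intro holomorphic_on_divide holomorphic_on_const holomorphic_on_subset[OF F]) (use nz in auto)
    have "cmod ((deriv ^^ 1) G v) \<le> fact 1 * 2 / \<delta> ^ 1"
    proof (rule Cauchy_inequality)
      show "G holomorphic_on ball v \<delta>" by (rule holomorphic_on_subset[OF hG]) auto
      show "continuous_on (cball v \<delta>) G" by (rule holomorphic_on_imp_continuous_on[OF hG])
      show "cmod (G y) \<le> 2" if "cmod (v - y) = \<delta>" for y
      proof -
        have "1/2 \<le> cmod (F y)" by (rule ge) (simp add: dist_norm that)
        then show ?thesis using frac_le[of 1 1 "1/2" "cmod (F y)"] by (simp add: G_def norm_divide)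
      qed
    qed (rule \<delta>)
    moreover have "deriv G v = - deriv F v / (F v)\<^sup>2"
    proof (rule DERIV_imp_deriv)
      show "(G has_field_derivative - deriv F v / (F v)\<^sup>2) (at v)"
        unfolding G_def
        by (rule derivative_eq_intros holomorphic_derivI[OF F] refl | use nz[of v] \<delta> in \<open>simp add: power2_eq_square\<close>)+
    qed
    moreover have "spherical_deriv F v \<le> cmod (deriv F v) / (cmod (F v))\<^sup>2"
      unfolding spherical_deriv_def using pos[of v] nz[of v] \<delta>
      by (intro divide_left_mono mult_pos_pos) auto
    ultimately show ?thesis by (simp add: norm_divide norm_power)
  qed
qed

lemma continuous_on_stereo: "continuous_on S stereo"
  by (intro continuous_at_imp_continuous_on ballI has_derivative_continuous[OF stereo_has_derivative])

text \<open>
  One half of Marty's criterion: near \<open>v\<close>, a uniformly convergent subsequence oscillates little, and this bounds its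
  spherical derivatives at \<open>v\<close>.
\<close>
lemma Julia_if_spherical_deriv_unbounded:
  assumes f: "f holomorphic_on UNIV"
    and lim: "filterlim (\<lambda>n. spherical_deriv (f ^^ n) v) at_top sequentially"
  shows "v \<in> Julia_set f"
proof -
  have "\<not> normal_family_on U (range (\<lambda>n. f ^^ n))" if U: "open U" "v \<in> U" for U
  proof
    assume nf: "normal_family_on U (range (\<lambda>n. f ^^ n))"
    obtain r g where r: "strict_mono r" and
      lim_unif: "\<And>K. compact K \<Longrightarrow> K \<subseteq> U \<Longrightarrow> uniform_limit K (\<lambda>k z. stereo ((f ^^ (r k)) z)) g sequentially"
      using nf[unfolded normal_family_on_def, rule_format, of "\<lambda>n. f ^^ n"] by auto
    obtain \<epsilon> where \<epsilon>: "\<epsilon> > 0" "cball v \<epsilon> \<subseteq> U" using U by (meson open_contains_cball)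
    have ul: "uniform_limit (cball v \<epsilon>) (\<lambda>k z. stereo ((f ^^ (r k)) z)) g sequentially"
      by (rule lim_unif) (use \<epsilon> in auto)
    have "continuous_on (cball v \<epsilon>) g"
    proof (rule uniform_limit_theorem[OF _ ul])
      show "\<forall>\<^sub>F n in sequentially. continuous_on (cball v \<epsilon>) (\<lambda>z. stereo ((f ^^ r n) z))"
        by (intro always_eventually allI continuous_on_compose2[OF continuous_on_stereo[of UNIV]]
            holomorphic_on_imp_continuous_on holomorphic_on_subset[OF holomorphic_funpow[OF f]]) auto
    qed simp
    then obtain \<delta>0 where \<delta>0: "\<delta>0 > 0" "\<And>y. y \<in> cball v \<epsilon> \<Longrightarrow> dist y v < \<delta>0 \<Longrightarrow> dist (g y) (g v) < 1/8"
      unfolding continuous_on_iff using \<epsilon>(1) by (metis centre_in_cball less_imp_le zero_less_divide_1_iff zero_less_numeral)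
    define \<delta> where "\<delta> = min \<epsilon> (\<delta>0 / 2)"
    have \<delta>: "\<delta> > 0" "\<delta> \<le> \<epsilon>" "\<delta> < \<delta>0" using \<epsilon> \<delta>0(1) by (auto simp: \<delta>_def)
    have "\<forall>\<^sub>F k in sequentially. \<forall>y\<in>cball v \<epsilon>. dist (stereo ((f ^^ (r k)) y)) (g y) < 1/8"
      by (rule ul[unfolded uniform_limit_iff, rule_format]) simp
    then have "\<forall>\<^sub>F k in sequentially. spherical_deriv (f ^^ (r k)) v \<le> 2 / \<delta>"
    proof eventually_elim
      case (elim k)
      show ?case
      proof (rule spherical_deriv_le_of_close[OF holomorphic_funpow[OF f] \<delta>(1)])
        fix y assume y: "y \<in> cball v \<delta>"
        then have y': "y \<in> cball v \<epsilon>" "dist y v < \<delta>0" using \<delta> by (auto simp: dist_commute)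
        have "dist (stereo ((f ^^ r k) y)) (stereo ((f ^^ r k) v)) \<le>
           dist (stereo ((f ^^ r k) y)) (g y) + dist (g y) (g v) + dist (stereo ((f ^^ r k) v)) (g v)"
          by (smt (verit) dist_commute dist_triangle)
        moreover have "dist (stereo ((f ^^ r k) y)) (g y) < 1/8" "dist (stereo ((f ^^ r k) v)) (g v) < 1/8"
          using elim y'(1) \<epsilon>(1) by auto
        ultimately show "dist (stereo ((f ^^ r k) y)) (stereo ((f ^^ r k) v)) \<le> 1/2"
          using \<delta>0(2)[OF y'] by linarith
      qed
    qed
    moreover have "filterlim (\<lambda>k. spherical_deriv (f ^^ (r k)) v) at_top sequentially"
      using filterlim_compose[OF lim filterlim_subseq[OF r]] by (simp add: o_def)
    then have "\<forall>\<^sub>F k in sequentially. 2 / \<delta> < spherical_deriv (f ^^ (r k)) v"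
      by (simp add: filterlim_at_top_dense)
    ultimately have "\<forall>\<^sub>F k in sequentially. False" by eventually_elim simp
    then show False by simp
  qed
  then show ?thesis unfolding Julia_set_def by blast
qed

text \<open>
  The other half of Marty's criterion: functions with uniformly bounded spherical derivatives are uniformly
  Lipschitz as maps into the sphere, and the Arzela-Ascoli theorem applies.
\<close>
lemma spherical_deriv_unbounded_near_Julia:
  assumes f: "f holomorphic_on UNIV" and z: "z \<in> Julia_set f" and e: "e > 0"
  shows "\<exists>n. \<exists>p\<in>ball z e. C < spherical_deriv (f ^^ n) p"
proof (rule ccontr)
  assume "\<not> ?thesis"
  then have le: "spherical_deriv (f ^^ n) p \<le> C" if "p \<in> ball z e" for n p
    using that by (meson not_le)
  define B where "B = max C 1"
  have Bd: "cmod (deriv (f ^^ n) p) \<le> B * (1 + (cmod ((f ^^ n) p))\<^sup>2)" if "p \<in> ball z e" for n p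
  proof -
    have pos: "1 + (cmod ((f ^^ n) p))\<^sup>2 > 0" by (simp add: add_pos_nonneg)
    have "spherical_deriv (f ^^ n) p \<le> B" using le[OF that, of n] by (simp add: B_def)
    then show ?thesis using pos by (simp add: spherical_deriv_def pos_divide_le_eq)
  qed
  have lip: "dist (stereo ((f ^^ n) x)) (stereo ((f ^^ n) y)) \<le> 2 * B * dist x y"
    if "x \<in> ball z e" "y \<in> ball z e" for n x y
    by (rule stereo_comp_lipschitz[OF holomorphic_funpow[OF f] open_UNIV convex_ball[of z e] _ Bd that]) auto
  have B0: "B > 0" by (simp add: B_def)
  have "normal_family_on (ball z (e/2)) (range (\<lambda>n. f ^^ n))"
    unfolding normal_family_on_def
  proof (intro allI impI)
    fix h :: "nat \<Rightarrow> complex \<Rightarrow> complex" assume h: "range h \<subseteq> range (\<lambda>n. f ^^ n)"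
    have hn: "\<exists>m. h n = f ^^ m" for n using h by blast
    have hlip: "dist (stereo (h n x)) (stereo (h n y)) \<le> 2 * B * dist x y" if "x \<in> ball z e" "y \<in> ball z e" for n x y
      using hn[of n] lip[OF that] by auto
    have sub: "cball z (e/2) \<subseteq> ball z e" using e by auto
    obtain g k where gk: "strict_mono (k :: nat \<Rightarrow> nat)"
      "\<And>\<epsilon>. 0 < \<epsilon> \<Longrightarrow> \<exists>N. \<forall>n x. n \<ge> N \<and> x \<in> cball z (e/2) \<longrightarrow> norm (stereo (h (k n) x) - g x) < \<epsilon>"
    proof (rule Arzela_Ascoli[of "cball z (e/2)" "\<lambda>n x. stereo (h n x)" 1])
      show "norm (stereo (h n x)) \<le> 1" for n x by (simp add: norm_stereo)
      show "\<exists>d>0. \<forall>n y. y \<in> cball z (e/2) \<and> norm (x - y) < d \<longrightarrow> norm (stereo (h n x) - stereo (h n y)) < \<epsilon>"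
        if x: "x \<in> cball z (e/2)" and \<epsilon>: "0 < \<epsilon>" for x \<epsilon>
      proof (intro exI[of _ "\<epsilon> / (2 * B)"] conjI allI impI)
        show "0 < \<epsilon> / (2 * B)" using \<epsilon> B0 by simp
        fix n y assume y: "y \<in> cball z (e/2) \<and> norm (x - y) < \<epsilon> / (2 * B)"
        have "norm (stereo (h n x) - stereo (h n y)) \<le> 2 * B * dist x y"
        proof -
          have "x \<in> ball z e" "y \<in> ball z e" using x y sub by blast+
          from hlip[OF this, of n] show ?thesis by (simp add: dist_norm)
        qed
        also have "\<dots> < \<epsilon>" using y B0 by (simp add: dist_norm field_simps)
        finally show "norm (stereo (h n x) - stereo (h n y)) < \<epsilon>" .
      qed
    qed auto
    show "\<exists>r g. strict_mono r \<and> (\<forall>K. compact K \<and> K \<subseteq> ball z (e/2) \<longrightarrow>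
            uniform_limit K (\<lambda>k z. stereo (h (r k) z)) g sequentially)"
    proof (intro exI[of _ k] exI[of _ g] conjI allI impI)
      fix K assume K: "compact K \<and> K \<subseteq> ball z (e/2)"
      show "uniform_limit K (\<lambda>i z. stereo (h (k i) z)) g sequentially"
        unfolding uniform_limit_iff eventually_sequentially
      proof (intro allI impI)
        fix \<epsilon> :: real assume "0 < \<epsilon>"
        then obtain N where N: "\<forall>n x. n \<ge> N \<and> x \<in> cball z (e/2) \<longrightarrow> norm (stereo (h (k n) x) - g x) < \<epsilon>"
          using gk(2) by blast
        have "x \<in> cball z (e/2)" if "x \<in> K" for x using K that by auto
        then show "\<exists>N. \<forall>n\<ge>N. \<forall>x\<in>K. dist (stereo (h (k n) x)) (g x) < \<epsilon>"
          using N by (intro exI[of _ N]) (auto simp: dist_norm)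
      qed
    qed (rule gk(1))
  qed
  moreover have "open (ball z (e/2))" "z \<in> ball z (e/2)" using e by auto
  ultimately show False using z unfolding Julia_set_def by blast
qed

section \<open>Growth of the spherical derivative along expanding orbits\<close>

context radius_sequence
begin

text \<open>
  The shift by \<open>N\<close> iterates and the factor \<open>\<kappa>\<close> only cost constants, and these are absorbed by the arbitrary factor
  \<open>A\<close> in \<open>gain_exponential\<close>.
\<close>
lemma fast_growth_if_gain:
  assumes \<kappa>: "\<kappa> > 0" and q: "\<And>n. \<kappa> * exp (gain n) \<le> spherical_deriv (f ^^ (n + N)) v"
  shows "filterlim (\<lambda>n. spherical_deriv (f ^^ n) v) at_top sequentially" "v \<in> fast_growth_set f"
proof -
  define s where "s = (\<lambda>n. spherical_deriv (f ^^ n) v)"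
  have low: "\<kappa> * exp (gain n) \<le> s (n + N)" for n using q[of n] by (simp add: s_def)
  have "filterlim (\<lambda>n. \<kappa> * exp (gain n)) at_top sequentially"
    by (rule filterlim_tendsto_pos_mult_at_top[OF tendsto_const \<kappa>])
       (rule filterlim_compose[OF exp_at_top gain_at_top])
  then have "filterlim (\<lambda>n. s (n + N)) at_top sequentially"
    by (rule filterlim_at_top_mono) (use low in auto)
  then have top: "filterlim s at_top sequentially"
    unfolding filterlim_at_top eventually_sequentially_seg[of "\<lambda>n. _ \<le> s n" N] .
  then show "filterlim (\<lambda>n. spherical_deriv (f ^^ n) v) at_top sequentially" by (simp add: s_def)
  define l where "l = liminf (\<lambda>n. ereal (1 / real n * ln (ln (s n))))"
  have l0: "0 \<le> l" unfolding l_def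
  proof (rule Liminf_bounded)
    have "\<forall>\<^sub>F n in sequentially. exp 1 \<le> s n" using top unfolding filterlim_at_top by blast
    then show "\<forall>\<^sub>F n in sequentially. 0 \<le> ereal (1 / real n * ln (ln (s n)))"
    proof eventually_elim
      case (elim n)
      have "0 < s n" using elim by (rule less_le_trans[OF exp_gt_zero])
      then have "1 \<le> ln (s n)" using elim by (subst ln_ge_iff) auto
      then show ?case by simp
    qed
  qed
  have l\<mu>: "ereal (ln (1 + \<mu>)) \<le> l" if \<mu>: "0 < \<mu>" "ereal \<mu> < lower_order f" for \<mu>
    unfolding l_def
  proof (rule Liminf_bounded)
    define A where "A = (1 + \<mu>) ^ N + \<bar>ln \<kappa>\<bar>"
    obtain M where M: "\<And>n. M \<le> n \<Longrightarrow> A * (1 + \<mu>) ^ n \<le> gain n"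
      using gain_exponential[OF \<mu>, of A] unfolding eventually_sequentially by blast
    show "\<forall>\<^sub>F n in sequentially. ereal (ln (1 + \<mu>)) \<le> ereal (1 / real n * ln (ln (s n)))"
      unfolding eventually_sequentially
    proof (intro exI allI impI)
      fix n assume n: "Suc (M + N) \<le> n"
      define m where "m = n - N"
      have m: "n = m + N" "M \<le> m" using n by (auto simp: m_def)
      have one: "1 \<le> (1 + \<mu>) ^ m" using \<mu>(1) by (intro one_le_power) simp
      have "(1 + \<mu>) ^ n + \<bar>ln \<kappa>\<bar> * 1 \<le> (1 + \<mu>) ^ n + \<bar>ln \<kappa>\<bar> * (1 + \<mu>) ^ m"
        using one by (intro add_left_mono mult_left_mono) auto
      also have "\<dots> = A * (1 + \<mu>) ^ m" by (simp add: A_def m(1) power_add algebra_simps)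
      also have "\<dots> \<le> gain m" by (rule M[OF m(2)])
      finally have "(1 + \<mu>) ^ n \<le> ln \<kappa> + gain m" by linarith
      also have "\<dots> = ln (\<kappa> * exp (gain m))" using \<kappa> by (simp add: ln_mult)
      also have "\<dots> \<le> ln (s n)"
      proof -
        have "0 < \<kappa> * exp (gain m)" using \<kappa> by simp
        then show ?thesis using low[of m] unfolding m(1) by (subst ln_le_cancel_iff) auto
      qed
      finally have le: "(1 + \<mu>) ^ n \<le> ln (s n)" .
      have p: "0 < (1 + \<mu>) ^ n" using \<mu>(1) by (intro zero_less_power) simp
      have "real n * ln (1 + \<mu>) = ln ((1 + \<mu>) ^ n)" using \<mu>(1) by (subst ln_realpow) auto
      also have "\<dots> \<le> ln (ln (s n))" using le p by (subst ln_le_cancel_iff) auto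
      finally have "real n * ln (1 + \<mu>) \<le> ln (ln (s n))" .
      then show "ereal (ln (1 + \<mu>)) \<le> ereal (1 / real n * ln (ln (s n)))"
        using n by (simp add: field_simps)
    qed
  qed
  have "log_one_plus (lower_order f) \<le> l"
  proof (cases "lower_order f")
    case (real t)
    have t0: "0 \<le> t" using lower_order_nonneg[OF te] real by simp
    show ?thesis
    proof (cases "t = 0")
      case True
      then show ?thesis using l0 real by (simp add: log_one_plus_def zero_ereal_def)
    next
      case False
      then have t: "t > 0" using t0 by simp
      have "ereal (ln (1 + t)) \<le> l"
      proof (rule dense_le_bounded[of "-\<infinity>"])
        show "-\<infinity> < ereal (ln (1 + t))" by simp
        fix w assume w: "-\<infinity> < w" "w < ereal (ln (1 + t))"
        then obtain y where y: "w = ereal y" by (cases w) auto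
        then have "y < ln (1 + t)" using w(2) by simp
        then have "exp y < exp (ln (1 + t))" by simp
        then have y2: "exp y < 1 + t" using t by simp
        define \<mu> where "\<mu> = max (t / 2) (exp y - 1)"
        have \<mu>: "0 < \<mu>" "\<mu> < t" using t y2 by (auto simp: \<mu>_def)
        have "y \<le> ln (1 + \<mu>)" using \<mu> by (subst ln_ge_iff) (auto simp: \<mu>_def)
        then have "w \<le> ereal (ln (1 + \<mu>))" by (simp add: y)
        also have "\<dots> \<le> l" by (rule l\<mu>) (use \<mu> real in auto)
        finally show "w \<le> l" .
      qed
      then show ?thesis using real by (simp add: log_one_plus_def)
    qed
  next
    case PInf
    have "l = \<infinity>"
    proof (rule ereal_top)
      fix B :: real
      define \<mu> where "\<mu> = exp \<bar>B\<bar>"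
      have "B \<le> ln (1 + \<mu>)" by (subst ln_ge_iff) (auto simp: \<mu>_def add_pos_pos intro: order_trans[of _ "exp \<bar>B\<bar>"])
      then have "ereal B \<le> ereal (ln (1 + \<mu>))" by simp
      also have "\<dots> \<le> l" by (rule l\<mu>) (simp_all add: PInf \<mu>_def)
      finally show "ereal B \<le> l" .
    qed
    then show ?thesis by simp
  next
    case MInf
    then show ?thesis using lower_order_nonneg[OF te] by simp
  qed
  moreover have "\<forall>\<^sub>F n in sequentially. 1 < s n" using top unfolding filterlim_at_top_dense by blast
  ultimately show "v \<in> fast_growth_set f" by (simp add: fast_growth_set_def l_def s_def)
qed

text \<open>
  The lower bound for \<open>|f'|\<close> in \<open>expanding_step\<close> between the scales \<open>k\<close> and \<open>k + 1\<close>.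
\<close>
definition expansion :: "nat \<Rightarrow> real" where
  "expansion k = exp (a (Suc k)) / exp (a k) * (ln (max_modulus (exp (a k)) f) / K)"

lemma expansion_prod: "(\<Prod>k<n. expansion k) = exp (2 * (a n - a0) + gain n)"
proof -
  have "expansion k = exp (a (Suc k) - a k + b (a k))" for k
  proof -
    have "0 < ln (max_modulus (exp (a k)) f) / K" using large[OF a_ge[of k]] K by (intro divide_pos_pos) auto
    then show ?thesis unfolding expansion_def b_def by (simp add: exp_add exp_diff)
  qed
  then have "(\<Prod>k<n. expansion k) = exp (\<Sum>k<n. a (Suc k) - a k + b (a k))" by (simp add: exp_sum)
  also have "(\<Sum>k<n. a (Suc k) - a k + b (a k)) = 2 * (a n - a0) + gain n"
    using sum_lessThan_telescope[of a n] by (simp add: sum.distrib sum_b a0)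
  finally show ?thesis .
qed

text \<open>
  The product of the expansion factors is of order \<open>e\<^bsup>2 (a n - a0) + gain n\<^esup>\<close>, and the square of \<open>|f\<^sup>n(z)| \<le> 8192 e\<^bsup>a n\<^esup>\<close>
  cancels the factor \<open>e\<^bsup>2 a n\<^esup>\<close>. The constant 8192 is \<open>2 * 8\<^sup>4\<close>, from the outermost zone.
\<close>
lemma spherical_deriv_orbit:
  assumes orb: "\<And>k. (f ^^ k) z \<in> (\<Union>i<5. zone (exp (a k)) i) \<and> expansion k \<le> cmod (deriv f ((f ^^ k) z))"
  shows "exp (- 2 * a0) / (1 + 8192\<^sup>2) * exp (gain n) \<le> spherical_deriv (f ^^ n) z"
proof -
  have f: "f holomorphic_on UNIV" using te by (simp add: transcendental_entire_def)
  have D: "cmod ((f ^^ n) z) \<le> 8192 * exp (a n)"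
  proof -
    obtain i where i: "i < 5" "(f ^^ n) z \<in> zone (exp (a n)) i" using orb[of n] by auto
    have "(8::real) ^ i \<le> 8 ^ 4" using i by (intro power_increasing) auto
    then have "2 * 8 ^ i * exp (a n) \<le> 2 * 8 ^ 4 * exp (a n)" by (intro mult_right_mono) auto
    moreover have "cmod ((f ^^ n) z) \<le> 2 * 8 ^ i * exp (a n)" using i(2) by (simp add: zone_def)
    ultimately have "cmod ((f ^^ n) z) \<le> 2 * 8 ^ 4 * exp (a n)" by (rule order_trans[rotated])
    then show ?thesis by simp
  qed
  have pos: "1 + (cmod ((f ^^ n) z))\<^sup>2 > 0" by (simp add: add_pos_nonneg)
  have "exp (2 * (a n - a0) + gain n) = (\<Prod>k<n. expansion k)" by (simp add: expansion_prod)
  also have "\<dots> \<le> (\<Prod>k<n. cmod (deriv f ((f ^^ k) z)))"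
  proof (rule prod_mono)
    fix k
    have "0 \<le> expansion k" unfolding expansion_def using large[OF a_ge[of k]] K by simp
    then show "0 \<le> expansion k \<and> expansion k \<le> cmod (deriv f ((f ^^ k) z))" using orb by blast
  qed
  also have "\<dots> = cmod (deriv (f ^^ n) z)" unfolding deriv_funpow_prod[OF f] by (rule prod_norm)
  finally have num: "exp (2 * (a n - a0) + gain n) \<le> cmod (deriv (f ^^ n) z)" .
  have den: "1 + (cmod ((f ^^ n) z))\<^sup>2 \<le> (1 + 8192\<^sup>2) * exp (2 * a n)"
  proof -
    have "(cmod ((f ^^ n) z))\<^sup>2 \<le> (8192 * exp (a n))\<^sup>2" using D by (intro power_mono) auto
    also have "\<dots> = 8192\<^sup>2 * exp (2 * a n)" by (simp add: power_mult_distrib exp_double)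
    finally have 1: "(cmod ((f ^^ n) z))\<^sup>2 \<le> 8192\<^sup>2 * exp (2 * a n)" .
    have "1 \<le> exp (2 * a n)" using a_ge[of n] a0 by simp
    then have "1 + (cmod ((f ^^ n) z))\<^sup>2 \<le> exp (2 * a n) + 8192\<^sup>2 * exp (2 * a n)" using 1 by (rule add_mono)
    then show ?thesis by (simp only: distrib_right mult_1)
  qed
  have "exp (- 2 * a0) / (1 + 8192\<^sup>2) * exp (gain n) = exp (2 * (a n - a0) + gain n) / ((1 + 8192\<^sup>2) * exp (2 * a n))"
    by (simp add: exp_add exp_diff exp_minus right_diff_distrib field_simps)
  also have "\<dots> \<le> cmod (deriv (f ^^ n) z) / (1 + (cmod ((f ^^ n) z))\<^sup>2)"
    by (rule frac_le[OF _ num pos den]) simp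
  finally show ?thesis by (simp add: spherical_deriv_def)
qed

end

lemma radius_sequence_exists:
  assumes te: "transcendental_entire f" and K: "1 \<le> K"
  obtains a0 a where "radius_sequence f K a0 a" "r0 \<le> exp a0"
proof -
  obtain r3 where r3: "\<And>r. r3 \<le> r \<Longrightarrow> r ^ 4 \<le> max_modulus r f"
    using max_modulus_superpolynomial[OF te, of 4] by (auto simp: eventually_at_top_linorder)
  define a0 where "a0 = Max {4, K * exp 1, r3, r0}"
  have a0: "4 \<le> a0" "K * exp 1 \<le> a0" "r3 \<le> a0" "r0 \<le> a0" unfolding a0_def by (intro Max_ge; simp)+
  have big: "4 * x \<le> ln (max_modulus (exp x) f)" if "a0 \<le> x" for x
  proof -
    have "r3 \<le> exp x" using a0(3) that exp_ge_add_one_self[of x] by linarith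
    then have "exp x ^ 4 \<le> max_modulus (exp x) f" by (rule r3)
    moreover have "exp (4 * x) = exp x ^ 4" using exp_of_nat_mult[of 4 x] by simp
    ultimately have "exp (4 * x) \<le> max_modulus (exp x) f" by simp
    then show ?thesis by (subst ln_ge_iff) (auto intro: less_le_trans[OF exp_gt_zero])
  qed
  define a where "a = rec_nat a0 (\<lambda>n x. x + (1 - 1 / real (n + 2)) * ln (ln (max_modulus (exp x) f) / K))"
  show thesis
  proof (rule that)
    show "radius_sequence f K a0 a"
    proof
      show "16 \<le> ln (max_modulus (exp x) f) \<and> 4 * x \<le> ln (max_modulus (exp x) f) \<and>
          K * exp 1 \<le> ln (max_modulus (exp x) f)" if "a0 \<le> x" for x
        using big[OF that] that a0 by linarith
    qed (use te K a0 in \<open>simp_all add: a_def\<close>)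
    show "r0 \<le> exp a0" using a0(4) exp_ge_add_one_self[of a0] by linarith
  qed
qed

section \<open>Density in the Julia set\<close>

lemma expanding_orbits_exist:
  assumes te: "transcendental_entire f" and sing: "has_log_singularity_over_infinity f"
  shows "\<exists>K a0 a z. radius_sequence f K a0 a \<and> (\<forall>j<5. z j \<in> zone (exp a0) j \<and>
      (\<forall>k. (f ^^ k) (z j) \<in> (\<Union>i<5. zone (exp (a k)) i)
       \<and> radius_sequence.expansion f K a k \<le> cmod (deriv f ((f ^^ k) (z j)))))"
proof -
  have f: "f holomorphic_on UNIV" using te by (simp add: transcendental_entire_def)
  obtain K r0 where K: "1 \<le> K" "1 \<le> r0"
    and step: "\<And>r s j w. \<lbrakk>r0 \<le> r; r0 \<le> s; ln s \<le> ln (max_modulus r f) / 2; j < 5; \<And>i. i < 5 \<Longrightarrow> w i \<in> zone s i\<rbrakk>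
       \<Longrightarrow> \<exists>i<5. \<exists>z\<in>zone r j. f z = w i \<and> s / r * (ln (max_modulus r f) / K) \<le> cmod (deriv f z)"
    using expanding_step[OF te sing] by metis
  obtain a0 a where rs: "radius_sequence f K a0 a" and ra: "r0 \<le> exp a0"
    using radius_sequence_exists[OF te K(1)] by metis
  interpret radius_sequence f K a0 a by (rule rs)
  have r0a: "r0 \<le> exp (a k)" for k using ra a_ge[of k] by (meson exp_le_cancel_iff order_trans)
  have "\<exists>z\<in>zone (exp (a 0)) j. \<forall>k. (f ^^ k) z \<in> (\<Union>i<5. zone (exp (a k)) i)
      \<and> expansion k \<le> cmod (deriv f ((f ^^ k) z))" if "j < 5" for j
  proof (rule expanding_orbit[OF f _ _ _ that])
    show "\<exists>i<5. \<exists>z\<in>zone (exp (a k)) j. f z = w i \<and> expansion k \<le> cmod (deriv f z)"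
      if "j < 5" "\<And>i. i < 5 \<Longrightarrow> w i \<in> zone (exp (a (Suc k))) i" for k j w
      unfolding expansion_def
      by (rule step[OF r0a r0a _ that]) (use admissible[of k] in simp)
    show "zone (exp (a k)) j \<noteq> {}" for k j
    proof -
      have "of_real (8 ^ j * exp (a k)) \<in> zone (exp (a k)) j" by (simp add: zone_def norm_mult norm_power)
      then show ?thesis by blast
    qed
    show "compact (zone (exp (a k)) j)" for k j by (rule compact_zone)
  qed
  then have "\<forall>j. \<exists>z. j < 5 \<longrightarrow> z \<in> zone (exp a0) j \<and> (\<forall>k. (f ^^ k) z \<in> (\<Union>i<5. zone (exp (a k)) i)
      \<and> expansion k \<le> cmod (deriv f ((f ^^ k) z)))"
    unfolding a0(2) by blast
  from choice[OF this] obtain z where "\<And>j. j < 5 \<Longrightarrow> z j \<in> zone (exp a0) j \<and>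
     (\<forall>k. (f ^^ k) (z j) \<in> (\<Union>i<5. zone (exp (a k)) i) \<and> expansion k \<le> cmod (deriv f ((f ^^ k) (z j))))"
    by blast
  with rs show ?thesis by blast
qed

theorem theorem1p5:
  fixes f :: "complex \<Rightarrow> complex"
  assumes "transcendental_entire f"
    and "has_log_singularity_over_infinity f"
  shows "Julia_set f \<subseteq> closure (Julia_set f \<inter> fast_growth_set f)"
proof
  have f: "f holomorphic_on UNIV" using assms(1) by (simp add: transcendental_entire_def)
  obtain K a0 a z0 where rs: "radius_sequence f K a0 a"
    and z0: "\<And>j. j < 5 \<Longrightarrow> z0 j \<in> zone (exp a0) j"
    and orb: "\<And>j k. j < 5 \<Longrightarrow> (f ^^ k) (z0 j) \<in> (\<Union>i<5. zone (exp (a k)) i)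
       \<and> radius_sequence.expansion f K a k \<le> cmod (deriv f ((f ^^ k) (z0 j)))"
    using expanding_orbits_exist[OF assms] by blast
  interpret radius_sequence f K a0 a by (rule rs)
  define c where "c = exp (- 2 * a0) / (1 + 8192\<^sup>2)"
  have c: "c > 0" unfolding c_def by (intro divide_pos_pos) auto
  have z0_growth: "c * exp (gain n) \<le> spherical_deriv (f ^^ n) (z0 j)" if "j < 5" for j n
    unfolding c_def by (rule spherical_deriv_orbit[OF orb[OF that]])
  have "\<exists>C>0. \<forall>h w. h holomorphic_on UNIV \<and> (\<forall>i<5. w i \<in> {z0 i}) \<and> C * (1 + (cmod (h 0))\<^sup>2) \<le> cmod (deriv h 0)
      \<longrightarrow> (\<exists>i<5. \<exists>x. cmod x < 1 \<and> h x = w i \<and> 1 \<le> cmod (deriv h x))"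
  proof (rule lappan_five_values)
    show "{z0 i} \<inter> {z0 j} = {}" if "i < 5" "j < 5" "i \<noteq> j" for i j
      using zone_disjoint[of i j "exp a0"] zone_disjoint[of j i "exp a0"] z0[of i] z0[of j] that
      by (cases "i < j") auto
  qed simp
  then obtain C where C: "C > 0" and lappan: "\<forall>h w. h holomorphic_on UNIV \<and> (\<forall>i<5. w i \<in> {z0 i}) \<and>
      C * (1 + (cmod (h 0))\<^sup>2) \<le> cmod (deriv h 0)
      \<longrightarrow> (\<exists>i<5. \<exists>x. cmod x < 1 \<and> h x = w i \<and> 1 \<le> cmod (deriv h x))"
    by (elim exE conjE)
  fix z assume z: "z \<in> Julia_set f"
  show "z \<in> closure (Julia_set f \<inter> fast_growth_set f)"
    unfolding closure_approachable
  proof (intro allI impI)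
    fix e :: real assume e: "0 < e"
    obtain n p where p: "p \<in> ball z (e/2)" "2 * C / e < spherical_deriv (f ^^ n) p"
      using spherical_deriv_unbounded_near_Julia[OF f z, of "e/2" "2 * C / e"] e by auto
    define F where "F = f ^^ n"
    have F: "F holomorphic_on UNIV" unfolding F_def by (rule holomorphic_funpow[OF f])
    define h where "h = (\<lambda>x. F (p + of_real (e/2) * x))"
    have hh: "h holomorphic_on UNIV" unfolding h_def
      by (rule holomorphic_on_compose_gen[OF _ F, unfolded o_def]) (auto intro!: holomorphic_intros)
    have dh: "deriv h x = deriv F (p + of_real (e/2) * x) * of_real (e/2)" for x
    proof (rule DERIV_imp_deriv)
      have "((\<lambda>x. p + of_real (e/2) * x) has_field_derivative of_real (e/2)) (at x)"
        by (rule derivative_eq_intros refl | simp)+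
      then show "(h has_field_derivative deriv F (p + of_real (e/2) * x) * of_real (e/2)) (at x)"
        unfolding h_def by (rule DERIV_chain2[OF holomorphic_derivI[OF F open_UNIV UNIV_I]])
    qed
    have "\<exists>i<5. \<exists>x. cmod x < 1 \<and> h x = z0 i \<and> 1 \<le> cmod (deriv h x)"
    proof (rule lappan[rule_format])
      have pos: "0 < 1 + (cmod (F p))\<^sup>2" by (simp add: add_pos_nonneg)
      have "2 * C / e < cmod (deriv F p) / (1 + (cmod (F p))\<^sup>2)"
        using p(2) by (simp add: spherical_deriv_def F_def)
      then have "2 * C / e * (1 + (cmod (F p))\<^sup>2) < cmod (deriv F p)" using pos by (simp add: pos_less_divide_eq)
      then have "C * (1 + (cmod (F p))\<^sup>2) \<le> cmod (deriv F p) * (e / 2)" using e by (simp add: field_simps)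
      then have "C * (1 + (cmod (h 0))\<^sup>2) \<le> cmod (deriv h 0)"
        unfolding dh using e by (simp add: h_def norm_mult)
      then show "h holomorphic_on UNIV \<and> (\<forall>i<5. z0 i \<in> {z0 i}) \<and> C * (1 + (cmod (h 0))\<^sup>2) \<le> cmod (deriv h 0)"
        using hh by simp
    qed
    then obtain i x where ix: "i < 5" "cmod x < 1" "h x = z0 i" "1 \<le> cmod (deriv h x)" by blast
    define v where "v = p + of_real (e/2) * x"
    have Fv: "(f ^^ n) v = z0 i" using ix(3) by (simp add: h_def v_def F_def)
    define \<kappa> where "\<kappa> = cmod (deriv F v)"
    have "\<kappa> \<noteq> 0" using ix(4) unfolding dh \<kappa>_def v_def[symmetric] by auto
    then have \<kappa>: "\<kappa> > 0" by (simp add: \<kappa>_def)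
    have "dist v p < e/2" using ix(2) e by (simp add: v_def dist_norm norm_mult)
    then have vz: "dist v z < e" using p(1) dist_triangle[of v z p] by (simp add: dist_commute)
    have growth: "\<kappa> * c * exp (gain m) \<le> spherical_deriv (f ^^ (m + n)) v" for m
    proof -
      have "spherical_deriv (f ^^ (m + n)) v = \<kappa> * spherical_deriv (f ^^ m) (z0 i)"
        unfolding spherical_deriv_def deriv_funpow_add[OF f]
        by (simp add: funpow_add Fv norm_mult \<kappa>_def F_def)
      moreover have "\<kappa> * (c * exp (gain m)) \<le> \<kappa> * spherical_deriv (f ^^ m) (z0 i)"
        using z0_growth[OF ix(1), of m] \<kappa> by (intro mult_left_mono) auto
      ultimately show ?thesis by (simp add: mult.assoc)
    qed
    have \<kappa>c: "\<kappa> * c > 0" using \<kappa> c by simp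
    note fast = fast_growth_if_gain[OF \<kappa>c growth]
    have "v \<in> Julia_set f" by (rule Julia_if_spherical_deriv_unbounded[OF f fast(1)])
    with fast(2) vz show "\<exists>y\<in>Julia_set f \<inter> fast_growth_set f. dist y z < e" by blast
  qed
qed

end
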